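(* Let $N\ge3$ be an integer, $p\ge q\ge1$ and $pq>1$. (i) If $(N-1)pq<\max(N+p,N+q)$, then any supersolution $(u_1,u_2)$ in $\mathbb{R}^N$, without condition of sign, of the system $-\Delta u_1=|\nabla u_2|^p$, $-\Delta u_2=|\nabla u_1|^q$ is constant. (ii) Let $(u_1,u_2)$, $u_1,u_2\ge0$, be any supersolution of the system $-\Delta u_1=|\nabla u_2|^p$, $-\Delta u_2=|\nabla u_1|^q$ in $B_{r_0}\setminus\{0\}$ (resp. in $\mathbb{R}^N\setminus\overline{B_{r_0}}$). Then there exist $\rho\in(0,r_0)$ (resp. $\rho>r_0$) and $C>0$, depending on $u_1,u_2$, such that for any $r\in(0,\rho)$ (resp. any $r>\rho$), $$|\overline{u_1}(r)|\le C\max\bigl(1,r^{-\frac{2-p(q-1)}{pq-1}}\bigr)\ \text{ if } p(q-1)\ne2,\qquad |\overline{u_1}(r)|\le C|\ln r|\ \text{ if } p(q-1)=2,$$ $$|\overline{u_2}(r)|\le C\max\bigl(1,r^{-\frac{2-q(p-1)}{pq-1}}\bigr)\ \text{ if } q(p-1)\ne2,\qquad |\overline{u_2}(r)|\le C|\ln r|\ \text{ if } q(p-1)=2.$$ (iii) Let $(\widetilde u_1,\widetilde u_2)$ be any positive subsolution of the system $-\Delta\widetilde u_1+|\nabla\widetilde u_2|^p=0$, $-\Delta\widetilde u_2+|\nabla\widetilde u_1|^q=0$ in $B_{r_0}\setminus\{0\}$ (resp. in $\mathbb{R}^N\setminus\overline{B_{r_0}}$). Then there exist $\rho\in(0,r_0)$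 (resp. $\rho>r_0$) and $C>0$, depending on $\widetilde u_1,\widetilde u_2$, such that for $0<|x|<\rho$ (resp. $|x|>\rho$), $$\widetilde u_1(x)\le C\max\bigl(1,|x|^{-\frac{2-p(q-1)}{pq-1}}\bigr)\ \text{ if } p(q-1)\ne2,\qquad \widetilde u_1(x)\le C|\ln|x||\ \text{ if } p(q-1)=2,$$ $$\widetilde u_2(x)\le C\max\bigl(1,|x|^{-\frac{2-q(p-1)}{pq-1}}\bigr)\ \text{ if } q(p-1)\ne2,\qquad \widetilde u_2(x)\le C|\ln|x||\ \text{ if } q(p-1)=2.$$
   Context: A supersolution in a domain $\Omega$ of the system $-\Delta u_1=|\nabla u_2|^p$, $-\Delta u_2=|\nabla u_1|^q$ is a couple of $C^2(\Omega)$ functions with $-\Delta u_1\ge|\nabla u_2|^p$ and $-\Delta u_2\ge|\nabla u_1|^q$ in $\Omega$. A subsolution of the system in (iii) is a couple of $C^2(\Omega)$ functions with $-\Delta\widetilde u_1+|\nabla\widetilde u_2|^p\le0$ and $-\Delta\widetilde u_2+|\nabla\widetilde u_1|^q\le0$ in $\Omega$. $\overline u(r)$ denotes the mean value of $u$ on the sphere $\{|x|=r\}$. $B_{r_0}$ is the open ball with center $0$ and radius $r_0>0$. *)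

theory Defs
  imports "HOL-Analysis.Analysis"
begin

definition gradient :: "('a::euclidean_space \<Rightarrow> real) \<Rightarrow> 'a \<Rightarrow> 'a" where
  "gradient u x = (THE D. GDERIV u x :> D)"

text \<open>The matrix of \<open>frechet_derivative (gradient u) (at x)\<close> is the Hessian of \<open>u\<close> at \<open>x\<close>, so
  \<open>C2_on\<close> says that all second partial derivatives exist and are continuous. It is meant for
  open \<open>S\<close> only, all derivatives being taken in the full space.\<close>

definition C2_on :: "'a::euclidean_space set \<Rightarrow> ('a \<Rightarrow> real) \<Rightarrow> bool" where
  "C2_on S u \<longleftrightarrow>
     (\<forall>x\<in>S. u differentiable (at x)) \<and>
     (\<forall>x\<in>S. gradient u differentiable (at x)) \<and>
     (\<forall>h. continuous_on S (\<lambda>x. frechet_derivative (gradient u) (at x) h))"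

definition laplacian :: "('a::euclidean_space \<Rightarrow> real) \<Rightarrow> 'a \<Rightarrow> real" where
  "laplacian u x = (\<Sum>b\<in>Basis. frechet_derivative (gradient u) (at x) b \<bullet> b)"

definition supersolution ::
    "real \<Rightarrow> real \<Rightarrow> 'a::euclidean_space set \<Rightarrow> ('a \<Rightarrow> real) \<Rightarrow> ('a \<Rightarrow> real) \<Rightarrow> bool" where
  "supersolution p q \<Omega> u1 u2 \<longleftrightarrow>
     C2_on \<Omega> u1 \<and> C2_on \<Omega> u2 \<and>
     (\<forall>x\<in>\<Omega>. - laplacian u1 x \<ge> norm (gradient u2 x) powr p \<and>
            - laplacian u2 x \<ge> norm (gradient u1 x) powr q)"

definition absorption_subsolution ::
    "real \<Rightarrow> real \<Rightarrow> 'a::euclidean_space set \<Rightarrow> ('a \<Rightarrow> real) \<Rightarrow> ('a \<Rightarrow> real) \<Rightarrow> bool" where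
  "absorption_subsolution p q \<Omega> u1 u2 \<longleftrightarrow>
     C2_on \<Omega> u1 \<and> C2_on \<Omega> u2 \<and>
     (\<forall>x\<in>\<Omega>. - laplacian u1 x + norm (gradient u2 x) powr p \<le> 0 \<and>
            - laplacian u2 x + norm (gradient u1 x) powr q \<le> 0)"

text \<open>Surface measure on the unit sphere, as it arises in polar coordinates: the surface measure of
  \<open>E\<close> is the dimension times the Lebesgue measure of the solid cone
  \<open>{t *\<^sub>R \<omega> | t \<omega>. 0 < t \<and> t < 1 \<and> \<omega> \<in> E}\<close>.
  Note that \<open>sgn x = x /\<^sub>R norm x\<close>.\<close>

definition unit_sphere_measure :: "'a::euclidean_space measure" where
  "unit_sphere_measure =
     scale_measure (of_nat DIM('a)) (distr (restrict_space lborel (ball 0 1 - {0})) borel sgn)"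

definition sphere_mean :: "('a::euclidean_space \<Rightarrow> real) \<Rightarrow> real \<Rightarrow> real" where
  "sphere_mean u r =
     (LINT \<omega>|unit_sphere_measure. u (r *\<^sub>R \<omega>)) / measure (unit_sphere_measure :: 'a measure) UNIV"

text \<open>The comparison function for the first component; the one for the second component is
  obtained by exchanging \<open>p\<close> and \<open>q\<close>.\<close>

definition growth :: "real \<Rightarrow> real \<Rightarrow> real \<Rightarrow> real" where
  "growth p q r =
     (if p * (q - 1) \<noteq> 2 then max 1 (r powr (- ((2 - p * (q - 1)) / (p * q - 1))))
      else \<bar>ln r\<bar>)"

end

theory Submission
  imports Defs "HOL-Probability.Probability_Measure"
begin

text \<open>Everything rests on one ordinary differential inequality. For a $C^2$ function \<open>u\<close> in dimension \<open>N\<close> near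
the sphere of radius \<open>r\<close>, let \<open>m(r)\<close> be its mean over that sphere. The divergence theorem says that
\<open>(r^(N-1) m')' = r^(N-1)\<close> times the mean of the Laplacian of \<open>u\<close>. A subsolution of the absorption system,
and likewise the negative of a supersolution of the other system, satisfies \<open>|grad u2|^p \<le> Laplacian u1\<close>
and \<open>|grad u1|^q \<le> Laplacian u2\<close>. By Jensen's inequality the fluxes \<open>y_i = r^(N-1) m_i'\<close> then satisfy
\<open>y1' \<ge> r^(N-1) |m2'|^p\<close> and \<open>y2' \<ge> r^(N-1) |m1'|^q\<close>. This is a superlinear system since \<open>p q > 1\<close>.

A superlinear system blows up after a time controlled by the initial data, so a solution that
exists on a whole interval is bounded in its middle, whatever the signs are (\<open>keller_osserman\<close>).
Applied on an annulus of radius comparable to \<open>R\<close> and scaled back, this gives the universal estimate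
\<open>|m1'(R)| \<le> K R^(-(1+p)/(pq-1))\<close>, with \<open>K\<close> depending on the dimension, \<open>p\<close> and \<open>q\<close> only
(\<open>mean_gradient_estimate\<close>). All three claims follow from it.

\<^item> Integrating the estimate in \<open>R\<close> gives a constant plus a power of \<open>R\<close>, or a logarithm when the exponent
  vanishes; near \<open>0\<close> and near infinity this is at most a multiple of \<open>growth\<close> (\<open>mean_growth\<close>).

\<^item> The components of a subsolution are subharmonic, so for a nonnegative one the value at \<open>x\<close> is at
  most \<open>3^N\<close> times the largest spherical mean over the radii between \<open>|x|/2\<close> and \<open>3|x|/2\<close>
  (\<open>pointwise_le_of_mean_le\<close>); hence the pointwise bounds.

\<^item> For a pair on the whole space, \<open>y1\<close> is nondecreasing and vanishes at \<open>0\<close>, while the estimate gives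
  \<open>y1(R) \<le> K R^(N-1-(1+p)/(pq-1))\<close>. The exponent is negative precisely if \<open>(N-1)pq < N+p\<close>, which forces
  \<open>y1 = 0\<close>. Then the means of \<open>|grad u2|^p\<close> over all spheres vanish, so \<open>u2\<close> is constant,
  and with it \<open>y2 = 0\<close>, so \<open>u1\<close> is constant too (\<open>liouville_gradient_system\<close>).\<close>

section \<open>A Keller-Osserman bound for superlinear differential inequalities\<close>

text \<open>Only lower bounds for the derivatives are recorded, and the two functions may have any sign:
this is all that is known about the radial fluxes.\<close>

definition superlinear_pair ::
    "real \<Rightarrow> real \<Rightarrow> real \<Rightarrow> real set \<Rightarrow> (real \<Rightarrow> real) \<Rightarrow> (real \<Rightarrow> real) \<Rightarrow> bool" where
  "superlinear_pair c p q S w1 w2 \<longleftrightarrow>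
     (\<forall>t\<in>S. (\<exists>d. (w1 has_real_derivative d) (at t) \<and> c * \<bar>w2 t\<bar> powr p \<le> d) \<and>
            (\<exists>d. (w2 has_real_derivative d) (at t) \<and> c * \<bar>w1 t\<bar> powr q \<le> d))"

lemma superlinear_pair_subset:
  "superlinear_pair c p q S w1 w2 \<Longrightarrow> T \<subseteq> S \<Longrightarrow> superlinear_pair c p q T w1 w2"
  by (auto simp: superlinear_pair_def)

lemma superlinear_pair_commute:
  "superlinear_pair c p q S w1 w2 \<longleftrightarrow> superlinear_pair c q p S w2 w1"
  by (auto simp: superlinear_pair_def)

text \<open>Reversing time and changing both signs is a symmetry of the system; it turns lower bounds for
the first function into upper bounds and statements about the future into statements about the past.\<close>

lemma superlinear_pair_reflect:
  assumes "superlinear_pair c p q S w1 w2" and "\<And>t. t \<in> T \<Longrightarrow> - t \<in> S"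
  shows "superlinear_pair c p q T (\<lambda>t. - w1 (- t)) (\<lambda>t. - w2 (- t))"
proof -
  have refl: "((\<lambda>t. - w (- t)) has_real_derivative d) (at t)"
    if "(w has_real_derivative d) (at (- t))" for w d and t :: real
    using DERIV_minus[OF DERIV_mirror[THEN iffD1, OF that]] by simp
  show ?thesis
    using assms unfolding superlinear_pair_def by (fastforce intro: refl)
qed

lemma superlinear_pair_increment:
  assumes w: "superlinear_pair c p q {a..b} w1 w2" and "a \<le> b"
    and L: "\<And>t. a \<le> t \<Longrightarrow> t \<le> b \<Longrightarrow> L \<le> c * \<bar>w2 t\<bar> powr p"
  shows "w1 a + L * (b - a) \<le> w1 b"
proof -
  have "w1 a - L * a \<le> w1 b - L * b"
  proof (rule DERIV_nonneg_imp_nondecreasing[OF \<open>a \<le> b\<close>])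
    fix t assume t: "a \<le> t" "t \<le> b"
    then obtain d where d: "(w1 has_real_derivative d) (at t)" "c * \<bar>w2 t\<bar> powr p \<le> d"
      using w unfolding superlinear_pair_def by force
    have "((\<lambda>t. w1 t - L * t) has_real_derivative d - L) (at t)"
      by (auto intro!: derivative_eq_intros d)
    then show "\<exists>y. ((\<lambda>t. w1 t - L * t) has_real_derivative y) (at t) \<and> 0 \<le> y"
      using L[OF t] d(2) by (intro exI[of _ "d - L"]) auto
  qed
  then show ?thesis by (simp add: algebra_simps)
qed

lemma superlinear_pair_mono:
  assumes "superlinear_pair c p q {a..b} w1 w2" "0 \<le> c" "a \<le> b"
  shows "w1 a \<le> w1 b"
  using superlinear_pair_increment[OF assms(1,3), of 0] assms(2) by simp

text \<open>Each of \<open>x\<close> and \<open>y\<close> is at most a power of the larger of the two terms on the right, and the exponents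
of these two powers add up to the inverse of the exponent on the left. That exponent exceeds 1 exactly
when \<open>p * q > 1\<close>, so this reduces the superlinear system to one superlinear inequality for
the product of the two functions.\<close>

lemma powr_product_le_sum:
  fixes x y p q :: real
  assumes "x > 0" "y > 0" "p > 0" "q > 0"
  shows "(x * y) powr ((p + 1) * (q + 1) / (p + q + 2)) \<le> y powr (p + 1) + x powr (q + 1)"
proof -
  define M where "M = max (y powr (p + 1)) (x powr (q + 1))"
  have M: "M > 0" using assms by (simp add: M_def less_max_iff_disj)
  have y: "y \<le> M powr (1 / (p + 1))"
  proof -
    have "y = (y powr (p + 1)) powr (1 / (p + 1))" using assms by (simp add: powr_powr)
    also have "\<dots> \<le> M powr (1 / (p + 1))" by (rule powr_mono2) (use assms in \<open>auto simp: M_def\<close>)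
    finally show ?thesis .
  qed
  have x: "x \<le> M powr (1 / (q + 1))"
  proof -
    have "x = (x powr (q + 1)) powr (1 / (q + 1))" using assms by (simp add: powr_powr)
    also have "\<dots> \<le> M powr (1 / (q + 1))" by (rule powr_mono2) (use assms in \<open>auto simp: M_def\<close>)
    finally show ?thesis .
  qed
  have "x * y \<le> M powr (1 / (q + 1)) * M powr (1 / (p + 1))"
    by (rule mult_mono[OF x y]) (use assms in auto)
  also have "\<dots> = M powr (1 / (q + 1) + 1 / (p + 1))" by (simp add: powr_add)
  finally have xy: "x * y \<le> M powr (1 / (q + 1) + 1 / (p + 1))" .
  have "(x * y) powr ((p + 1) * (q + 1) / (p + q + 2))
      \<le> (M powr (1 / (q + 1) + 1 / (p + 1))) powr ((p + 1) * (q + 1) / (p + q + 2))"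
    by (rule powr_mono2) (use assms xy in auto)
  also have "\<dots> = M"
  proof -
    have one: "(1 / (q + 1) + 1 / (p + 1)) * ((p + 1) * (q + 1) / (p + q + 2)) = 1"
    proof -
      have nz: "q + 1 \<noteq> 0" "p + 1 \<noteq> 0" "p + q + 2 \<noteq> 0" using assms by auto
      have "1 / (q + 1) + 1 / (p + 1) = (p + q + 2) / ((p + 1) * (q + 1))"
        using nz by (simp add: divide_simps)
      then show ?thesis using nz by simp
    qed
    show ?thesis unfolding powr_powr one using M by simp
  qed
  also have "\<dots> \<le> y powr (p + 1) + x powr (q + 1)" by (auto simp: M_def)
  finally show ?thesis .
qed

text \<open>As long as both functions are nonnegative they grow, and their product \<open>z\<close> satisfies
\<open>z' \<ge> c * z powr (1 + \<delta>)\<close> with \<open>\<delta> > 0\<close>. Such a function stays finite for a quarter unit of time only if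
it started below an explicit constant. During the quarter unit of time before, the second function
has grown to at least a multiple of \<open>m powr q\<close>, where \<open>m\<close> is the initial value of the first, so a
bound for \<open>z\<close> is a bound for \<open>m\<close>.\<close>

lemma keller_osserman_forward:
  fixes p q c :: real
  assumes pq: "p > 0" "q > 0" "p * q > 1" and c: "c > 0"
  shows "\<exists>K>0. \<forall>a w1 w2. superlinear_pair c p q {a..a + 1/2} w1 w2 \<longrightarrow> 0 \<le> w2 a \<longrightarrow> w1 a \<le> K"
proof -
  define \<delta> where "\<delta> = (p * q - 1) / (p + q + 2)"
  have \<delta>: "\<delta> > 0" using pq by (simp add: \<delta>_def)
  \<comment> \<open>\<open>Z\<close> bounds the product of the two functions at time \<open>a + 1/4\<close>.\<close>
  define Z where "Z = (c * \<delta> / 4) powr (- 1 / \<delta>)"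
  have Z: "Z > 0" using c \<delta> by (simp add: Z_def)
  define K where "K = 1 + 4 * Z / c"
  have K: "K > 1" using Z c by (simp add: K_def)
  have "w1 a \<le> K" if w: "superlinear_pair c p q {a..a + 1/2} w1 w2" and w2a: "0 \<le> w2 a" for a w1 w2
  proof (cases "w1 a \<le> 1")
    case True
    then show ?thesis using K by linarith
  next
    case False
    define m where "m = w1 a"
    have m: "m > 1" using False by (simp add: m_def)
    have sub: "superlinear_pair c p q {a..t} w1 w2" "superlinear_pair c q p {a..t} w2 w1"
      if "t \<le> a + 1/2" for t
      using superlinear_pair_subset[OF w, of "{a..t}"] that superlinear_pair_commute by auto
    have w1m: "m \<le> w1 t" if "a \<le> t" "t \<le> a + 1/2" for t
      using superlinear_pair_mono[OF sub(1)] that c by (auto simp: m_def)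
    have w2m: "c * m powr q * (t - a) \<le> w2 t" if "a \<le> t" "t \<le> a + 1/2" for t
    proof -
      have "w2 a + c * m powr q * (t - a) \<le> w2 t"
      proof (rule superlinear_pair_increment[OF sub(2)])
        fix s assume "a \<le> s" "s \<le> t"
        then have "m \<le> \<bar>w1 s\<bar>" using w1m[of s] that by linarith
        then show "c * m powr q \<le> c * \<bar>w1 s\<bar> powr q"
          using c m pq by (intro mult_left_mono powr_mono2) auto
      qed (use that in auto)
      then show ?thesis using w2a by linarith
    qed
    define b where "b = a + 1/4"
    define z where "z t = w1 t * w2 t" for t
    have w1pos: "w1 t > 0" if "b \<le> t" "t \<le> a + 1/2" for t
      using w1m[of t] m that by (auto simp: b_def)
    have w2pos: "w2 t > 0" if "b \<le> t" "t \<le> a + 1/2" for t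
    proof -
      have "0 < c * m powr q * (t - a)" using c m that by (simp add: b_def)
      then show ?thesis using w2m[of t] that by (auto simp: b_def)
    qed
    have zpos: "z t > 0" if "b \<le> t" "t \<le> a + 1/2" for t
      using w1pos w2pos that by (simp add: z_def)
    \<comment> \<open>The derivative of \<open>z powr (- \<delta>)\<close> is at most \<open>- c * \<delta>\<close>.\<close>
    have le: "z (a + 1/2) powr (- \<delta>) + c * \<delta> * (a + 1/2) \<le> z b powr (- \<delta>) + c * \<delta> * b"
    proof (rule DERIV_nonpos_imp_nonincreasing[where f = "\<lambda>t. z t powr (- \<delta>) + c * \<delta> * t"])
      show "b \<le> a + 1/2" by (simp add: b_def)
      fix t assume t: "b \<le> t" "t \<le> a + 1/2"
      then obtain d1 d2 where d: "(w1 has_real_derivative d1) (at t)" "c * \<bar>w2 t\<bar> powr p \<le> d1"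
          "(w2 has_real_derivative d2) (at t)" "c * \<bar>w1 t\<bar> powr q \<le> d2"
        using w unfolding superlinear_pair_def b_def by force
      define dz where "dz = d1 * w2 t + d2 * w1 t"
      have z': "(z has_real_derivative dz) (at t)"
        unfolding z_def dz_def by (rule DERIV_mult[OF d(1,3), THEN DERIV_cong]) simp
      have p1: "\<bar>w2 t\<bar> powr p * w2 t = w2 t powr (p + 1)" "\<bar>w1 t\<bar> powr q * w1 t = w1 t powr (q + 1)"
        using w1pos[OF t] w2pos[OF t] by (simp_all add: powr_add)
      have "c * z t powr (1 + \<delta>) \<le> c * (w2 t powr (p + 1) + w1 t powr (q + 1))"
      proof -
        have "1 + \<delta> = (p + 1) * (q + 1) / (p + q + 2)" 
          using pq by (simp add: \<delta>_def divide_simps) (simp add: algebra_simps)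
        then show ?thesis
          using powr_product_le_sum[OF w1pos[OF t] w2pos[OF t] pq(1,2)] c by (simp add: z_def)
      qed
      also have "\<dots> = c * \<bar>w2 t\<bar> powr p * w2 t + c * \<bar>w1 t\<bar> powr q * w1 t"
        using p1 by (simp add: algebra_simps)
      also have "\<dots> \<le> dz"
        unfolding dz_def using d w1pos[OF t] w2pos[OF t] by (intro add_mono mult_right_mono) auto
      finally have dz: "c * z t powr (1 + \<delta>) \<le> dz" .
      have "((\<lambda>t. z t powr (- \<delta>) + c * \<delta> * t) has_real_derivative
              - \<delta> * z t powr (- \<delta> - 1) * dz + c * \<delta>) (at t)"
        using zpos[OF t]
        by (auto intro!: derivative_eq_intros z')
      moreover have "- \<delta> * z t powr (- \<delta> - 1) * dz + c * \<delta> \<le> 0"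
      proof -
        have "c * \<delta> = \<delta> * z t powr (- \<delta> - 1) * (c * z t powr (1 + \<delta>))"
          using zpos[OF t] by (simp add: powr_add[symmetric])
        also have "\<dots> \<le> \<delta> * z t powr (- \<delta> - 1) * dz"
          using dz \<delta> by (intro mult_left_mono) auto
        finally show ?thesis by simp
      qed
      ultimately show "\<exists>y. ((\<lambda>t. z t powr (- \<delta>) + c * \<delta> * t) has_real_derivative y) (at t) \<and> y \<le> 0"
        by blast
    qed
    have "c * \<delta> / 4 \<le> z b powr (- \<delta>)"
    proof -
      have "c * \<delta> * (a + 1/2) = c * \<delta> * b + c * \<delta> / 4" by (simp add: b_def algebra_simps)
      then show ?thesis using le powr_ge_zero[of "z (a + 1/2)" "- \<delta>"] by linarith
    qed
    then have "(z b powr (- \<delta>)) powr (- 1 / \<delta>) \<le> Z"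
      unfolding Z_def using c \<delta> by (intro powr_mono2') auto
    then have "z b \<le> Z" using zpos[of b] \<delta> by (simp add: powr_powr b_def)
    moreover have "m * (c / 4) \<le> z b"
    proof -
      have "c / 4 \<le> c * m powr q * (b - a)"
        using m c pq ge_one_powr_ge_zero[of m q] by (simp add: b_def)
      then have "c / 4 \<le> w2 b" using w2m[of b] by (simp add: b_def)
      then show ?thesis unfolding z_def using w1m[of b] m c by (intro mult_mono) (auto simp: b_def)
    qed
    ultimately have "m \<le> 4 * Z / c" using c by (simp add: field_simps)
    then show ?thesis by (simp add: K_def m_def)
  qed
  then show ?thesis using K by (intro exI[of _ K]) auto
qed

text \<open>If the second function is nonnegative at time 1/2, the forward lemma applies from there. Otherwise
it is negative up to time 1/2, and very negative up to time 0 if \<open>m = w1 0\<close> is large, because between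
these times it increases at least at the rate \<open>c * m powr q\<close>. Then going backwards from time 0 the first
function loses a multiple of \<open>m powr (p * q)\<close>, at least \<open>2 * m\<close>, so that at time -1/2 both functions are
negative and the first is at most \<open>- m\<close>. Reflecting time brings back the forward lemma.\<close>

lemma keller_osserman_upper:
  fixes p q c :: real
  assumes pq: "p > 0" "q > 0" "p * q > 1" and c: "c > 0"
  shows "\<exists>K>0. \<forall>w1 w2. superlinear_pair c p q {-1..1} w1 w2 \<longrightarrow> w1 0 \<le> K"
proof -
  obtain K where K: "K > 0" and fwd: "\<And>a w1 w2. superlinear_pair c p q {a..a + 1/2} w1 w2 \<Longrightarrow> 0 \<le> w2 a \<Longrightarrow> w1 a \<le> K"
    using keller_osserman_forward[OF assms] by blast
  define e where "e = c * (c / 2) powr p / 4"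
  have e: "e > 0" using c by (simp add: e_def)
  \<comment> \<open>Beyond the second summand, \<open>m\<close> is less than \<open>e * m powr (p * q)\<close>.\<close>
  define K' where "K' = K + e powr (- 1 / (p * q - 1))"
  have "w1 0 \<le> K'" if w: "superlinear_pair c p q {-1..1} w1 w2" for w1 w2
  proof (rule ccontr)
    assume neg: "\<not> w1 0 \<le> K'"
    define m where "m = w1 0"
    have "0 < e powr (- 1 / (p * q - 1))" using e by simp
    then have m: "m > K" "m > e powr (- 1 / (p * q - 1))" "m > 0"
      using neg K unfolding K'_def m_def by linarith+
    have sub: "superlinear_pair c p q {s..t} w1 w2" "superlinear_pair c q p {s..t} w2 w1"
      if "-1 \<le> s" "t \<le> 1" for s t
      using superlinear_pair_subset[OF w, of "{s..t}"] that superlinear_pair_commute by auto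
    have mono: "w1 s \<le> w1 t" "w2 s \<le> w2 t" if "-1 \<le> s" "s \<le> t" "t \<le> 1" for s t
      using superlinear_pair_mono[OF sub(1), of s t] superlinear_pair_mono[OF sub(2), of s t] that c by auto
    have w2neg: "w2 (1/2) < 0"
    proof (rule ccontr)
      assume "\<not> w2 (1/2) < 0"
      then have "w1 (1/2) \<le> K" by (intro fwd[of _ _ w2] sub) auto
      then show False using mono[of 0 "1/2"] m by (auto simp: m_def)
    qed
    have "w2 0 + c * m powr q * (1/2 - 0) \<le> w2 (1/2)"
    proof (rule superlinear_pair_increment[OF sub(2)])
      fix s :: real assume "0 \<le> s" "s \<le> 1/2"
      then have "m \<le> \<bar>w1 s\<bar>" using mono[of 0 s] by (simp add: m_def)
      then show "c * m powr q \<le> c * \<bar>w1 s\<bar> powr q"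
        using c m pq by (intro mult_left_mono powr_mono2) auto
    qed auto
    then have w20: "w2 0 \<le> - (c / 2 * m powr q)" using w2neg by simp
    have "w1 (-(1/2)) + 2 * m * (0 - (-(1/2))) * 2 \<le> w1 0"
    proof -
      have "w1 (-(1/2)) + (4 * m) * (0 - (-(1/2))) \<le> w1 0"
      proof (rule superlinear_pair_increment[OF sub(1)])
        fix s :: real assume s: "-(1/2) \<le> s" "s \<le> 0"
        have "c / 2 * m powr q \<le> \<bar>w2 s\<bar>" using mono[of s 0] s w20 by auto
        then have "(c / 2 * m powr q) powr p \<le> \<bar>w2 s\<bar> powr p"
          using c pq by (intro powr_mono2) auto
        then have le: "c * ((c / 2) powr p * m powr (p * q)) \<le> c * \<bar>w2 s\<bar> powr p"
          using c m by (simp add: powr_mult powr_powr mult.commute[of p q] del: powr_divide times_divide_eq_left)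
        have "(e powr (- 1 / (p * q - 1))) powr (p * q - 1) \<le> m powr (p * q - 1)"
          using m pq by (intro powr_mono2) auto
        moreover have "(e powr (- 1 / (p * q - 1))) powr (p * q - 1) = 1 / e"
          unfolding powr_powr using pq e by (simp add: powr_minus_divide)
        ultimately have "1 / e \<le> m powr (p * q - 1)" by simp
        then have "m * 1 \<le> m * (e * m powr (p * q - 1))"
          using e m by (intro mult_left_mono) (auto simp: field_simps)
        also have "\<dots> = e * m powr (p * q)"
          using m powr_add[of m 1 "p * q - 1"] by simp
        finally show "4 * m \<le> c * \<bar>w2 s\<bar> powr p" using le by (simp add: e_def)
      qed auto
      then show ?thesis by simp
    qed
    then have w1l: "w1 (-(1/2)) \<le> - m" using m by (simp add: m_def)
    have "superlinear_pair c p q {1/2..1/2 + 1/2} (\<lambda>t. - w1 (- t)) (\<lambda>t. - w2 (- t))"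
      by (rule superlinear_pair_reflect[OF w]) auto
    from fwd[OF this] have "- w1 (-(1/2)) \<le> K"
      using mono[of "-(1/2)" 0] w20 c m(3) by (auto simp: mult_nonneg_nonneg order_trans)
    then show False using w1l m by simp
  qed
  moreover have "K' > 0" using K by (simp add: K'_def add_pos_nonneg)
  ultimately show ?thesis by blast
qed

lemma keller_osserman:
  fixes p q c :: real
  assumes pq: "p > 0" "q > 0" "p * q > 1" and c: "c > 0"
  shows "\<exists>K>0. \<forall>w1 w2. superlinear_pair c p q {-1..1} w1 w2 \<longrightarrow> \<bar>w1 0\<bar> \<le> K"
proof -
  obtain K where K: "K > 0" and up: "\<And>w1 w2. superlinear_pair c p q {-1..1} w1 w2 \<Longrightarrow> w1 0 \<le> K"
    using keller_osserman_upper[OF assms] by blast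
  have "\<bar>w1 0\<bar> \<le> K" if "superlinear_pair c p q {-1..1} w1 w2" for w1 w2
    using up[OF that] up[OF superlinear_pair_reflect[OF that, of "{-1..1}"]] by simp
  then show ?thesis using K by blast
qed

section \<open>Polar coordinates\<close>

definition punctured_ball :: "'a::euclidean_space set" where
  "punctured_ball = ball 0 1 - {0}"

lemma sets_punctured_ball[measurable]: "(punctured_ball :: 'a::euclidean_space set) \<in> sets borel"
  by (simp add: punctured_ball_def)

lemma nn_integral_lborel_scale:
  fixes f :: "'a::euclidean_space \<Rightarrow> ennreal"
  assumes [measurable]: "f \<in> borel_measurable borel" and s: "s > 0"
  shows "(\<integral>\<^sup>+y. f y \<partial>lborel) = ennreal (s ^ DIM('a)) * (\<integral>\<^sup>+x. f (s *\<^sub>R x) \<partial>lborel)"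
  by (subst lborel_affine[of s 0])
     (use s in \<open>simp_all add: nn_integral_density nn_integral_distr nn_integral_cmult\<close>)

text \<open>This radial integral turns up when the order of integration is exchanged in polar coordinates.\<close>

lemma nn_integral_power_tail:
  assumes a: "a > 0" and n: "n > 0"
  shows "(\<integral>\<^sup>+s. ennreal (1 / s ^ Suc n) * indicator {a<..} s \<partial>lborel) = ennreal (1 / (real n * a ^ n))"
proof -
  have "(\<integral>\<^sup>+s. ennreal (1 / s ^ Suc n) * indicator {a<..} s \<partial>lborel)
      = (\<integral>\<^sup>+s. ennreal (1 / s ^ Suc n) * indicator {a..} s \<partial>lborel)"
    using AE_lborel_singleton[of a]
    by (intro nn_integral_cong_AE) (auto elim!: eventually_mono split: split_indicator)
  also have "\<dots> = ennreal (0 - (- (1 / (real n * a ^ n))))"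
  proof (rule nn_integral_FTC_atLeast)
    show "(\<lambda>s::real. 1 / s ^ Suc n) \<in> borel_measurable borel"
      by (intro borel_measurable_divide borel_measurable_power borel_measurable_const) auto
    fix s assume s: "a \<le> s"
    show "((\<lambda>s. - (1 / (real n * s ^ n))) has_real_derivative 1 / s ^ Suc n) (at s)"
      using s a n
      by (auto intro!: derivative_eq_intros simp: field_simps power_Suc[symmetric] power_add[symmetric] simp del: power_Suc)
    show "0 \<le> 1 / s ^ Suc n" using s a by simp
  next
    have "filterlim (\<lambda>s::real. real n * s ^ n) at_top at_top"
      by (rule filterlim_tendsto_pos_mult_at_top[OF tendsto_const])
         (use n in \<open>auto intro: filterlim_pow_at_top filterlim_ident\<close>)
    from tendsto_minus[OF tendsto_divide_0[OF tendsto_const[of 1] filterlim_at_top_imp_at_infinity[OF this]]]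
    show "((\<lambda>s. - (1 / (real n * s ^ n))) \<longlongrightarrow> 0) at_top" by simp
  qed
  finally show ?thesis by simp
qed

text \<open>No surface measure is involved: the sphere is replaced by the punctured ball, on which \<open>sgn\<close>
selects the direction. Substituting \<open>r = s * norm x\<close> on each ray turns the argument
\<open>r *\<^sub>R sgn x\<close> into \<open>s *\<^sub>R x\<close>; scaling \<open>y = s *\<^sub>R x\<close> in the outer variable then leaves, for each \<open>y\<close>,
an explicit integral over \<open>s > norm y\<close>.\<close>

lemma nn_integral_polar:
  fixes f :: "'a::euclidean_space \<Rightarrow> ennreal"
  assumes [measurable]: "f \<in> borel_measurable borel"
  shows "(\<integral>\<^sup>+r. ennreal (real DIM('a) * r ^ (DIM('a) - 1)) * indicator {0<..} r *
            (\<integral>\<^sup>+x. f (r *\<^sub>R sgn x) * indicator punctured_ball x \<partial>lborel) \<partial>lborel)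
         = (\<integral>\<^sup>+y. f y \<partial>lborel)"
proof -
  let ?N = "DIM('a)" let ?B = "punctured_ball :: 'a set"
  obtain n where n: "?N = Suc n" using DIM_positive[where 'a='a] gr0_implies_Suc by blast
  have "(\<integral>\<^sup>+r. ennreal (real ?N * r ^ n) * indicator {0<..} r *
            (\<integral>\<^sup>+x. f (r *\<^sub>R sgn x) * indicator ?B x \<partial>lborel) \<partial>lborel)
      = (\<integral>\<^sup>+r. (\<integral>\<^sup>+x. ennreal (real ?N * r ^ n) * indicator {0<..} r *
            (f (r *\<^sub>R sgn x) * indicator ?B x) \<partial>lborel) \<partial>lborel)"
    by (subst nn_integral_cmult[symmetric]) auto
  also have "\<dots> = (\<integral>\<^sup>+x. (\<integral>\<^sup>+r. ennreal (real ?N * r ^ n) * indicator {0<..} r *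
            (f (r *\<^sub>R sgn x) * indicator ?B x) \<partial>lborel) \<partial>lborel)"
    by (rule lborel_pair.Fubini'[symmetric]) measurable
  \<comment> \<open>Substitute \<open>r = s * norm x\<close> in the inner integral.\<close>
  also have "\<dots> = (\<integral>\<^sup>+x. (\<integral>\<^sup>+s. ennreal (real ?N * s ^ n * norm x ^ ?N) * indicator {0<..} s *
            (f (s *\<^sub>R x) * indicator ?B x) \<partial>lborel) \<partial>lborel)"
  proof (rule nn_integral_cong)
    fix x :: 'a
    show "(\<integral>\<^sup>+r. ennreal (real ?N * r ^ n) * indicator {0<..} r * (f (r *\<^sub>R sgn x) * indicator ?B x) \<partial>lborel)
        = (\<integral>\<^sup>+s. ennreal (real ?N * s ^ n * norm x ^ ?N) * indicator {0<..} s * (f (s *\<^sub>R x) * indicator ?B x) \<partial>lborel)"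
    proof (cases "x \<in> ?B")
      case True
      then have x: "norm x > 0" by (auto simp: punctured_ball_def)
      have "(\<integral>\<^sup>+r. ennreal (real ?N * r ^ n) * indicator {0<..} r * (f (r *\<^sub>R sgn x) * indicator ?B x) \<partial>lborel)
          = ennreal (norm x) * (\<integral>\<^sup>+s. ennreal (real ?N * (norm x * s) ^ n) * indicator {0<..} (norm x * s) *
              (f ((norm x * s) *\<^sub>R sgn x) * indicator ?B x) \<partial>lborel)"
        by (subst nn_integral_real_affine[where c="norm x" and t=0]) (use x in auto)
      also have "\<dots> = (\<integral>\<^sup>+s. ennreal (norm x) * (ennreal (real ?N * (norm x * s) ^ n) * indicator {0<..} (norm x * s) *
              (f ((norm x * s) *\<^sub>R sgn x) * indicator ?B x)) \<partial>lborel)"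
        by (subst nn_integral_cmult) auto
      also have "\<dots> = (\<integral>\<^sup>+s. ennreal (real ?N * s ^ n * norm x ^ ?N) * indicator {0<..} s * (f (s *\<^sub>R x) * indicator ?B x) \<partial>lborel)"
      proof (rule nn_integral_cong)
        fix s :: real
        have "(norm x * s) *\<^sub>R sgn x = s *\<^sub>R x" using x by (simp add: sgn_div_norm)
        moreover have "ennreal (norm x) * ennreal (real ?N * (norm x * s) ^ n) = ennreal (real ?N * s ^ n * norm x ^ ?N)" if "s > 0"
          using that x by (subst ennreal_mult[symmetric]) (auto simp: n power_mult_distrib mult_ac)
        ultimately show "ennreal (norm x) * (ennreal (real ?N * (norm x * s) ^ n) * indicator {0<..} (norm x * s) *
              (f ((norm x * s) *\<^sub>R sgn x) * indicator ?B x)) = ennreal (real ?N * s ^ n * norm x ^ ?N) * indicator {0<..} s * (f (s *\<^sub>R x) * indicator ?B x)"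
          using x by (auto simp: zero_less_mult_iff mult.assoc[symmetric] split: split_indicator)
      qed
      finally show ?thesis .
    qed simp
  qed
  also have "\<dots> = (\<integral>\<^sup>+s. (\<integral>\<^sup>+x. ennreal (real ?N * s ^ n * norm x ^ ?N) * indicator {0<..} s *
            (f (s *\<^sub>R x) * indicator ?B x) \<partial>lborel) \<partial>lborel)"
    by (rule lborel_pair.Fubini') measurable
  \<comment> \<open>Substitute \<open>y = s *\<^sub>R x\<close>; the unit ball becomes the condition \<open>norm y < s\<close>.\<close>
  also have "\<dots> = (\<integral>\<^sup>+s. (\<integral>\<^sup>+y. ennreal (real ?N * norm y ^ ?N * (1 / s ^ Suc ?N)) * indicator {norm y<..} s *
            (f y * indicator (- {0}) y) \<partial>lborel) \<partial>lborel)"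
  proof (rule nn_integral_cong)
    fix s :: real
    show "(\<integral>\<^sup>+x. ennreal (real ?N * s ^ n * norm x ^ ?N) * indicator {0<..} s * (f (s *\<^sub>R x) * indicator ?B x) \<partial>lborel)
        = (\<integral>\<^sup>+y. ennreal (real ?N * norm y ^ ?N * (1 / s ^ Suc ?N)) * indicator {norm y<..} s * (f y * indicator (- {0}) y) \<partial>lborel)"
    proof (cases "s > 0")
      case True
      define g where "g y = ennreal (real ?N * norm y ^ ?N * (1 / s ^ Suc ?N)) * indicator {norm y<..} s * (f y * indicator (- {0}) y)" for y
      have "(\<lambda>y::'a. indicator {norm y<..} s :: ennreal) = indicator (ball 0 s)"
        by (auto simp: fun_eq_iff split: split_indicator)
      then have [measurable]: "(\<lambda>y::'a. indicator {norm y<..} s :: ennreal) \<in> borel_measurable borel"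
        by (metis borel_measurable_indicator borel_open open_ball)
      have [measurable]: "(\<lambda>y. indicator (- {0::'a}) y :: ennreal) \<in> borel_measurable borel"
        by simp
      have [measurable]: "g \<in> borel_measurable borel" unfolding g_def by measurable
      have "(\<integral>\<^sup>+y. g y \<partial>lborel) = ennreal (s ^ ?N) * (\<integral>\<^sup>+x. g (s *\<^sub>R x) \<partial>lborel)"
        by (rule nn_integral_lborel_scale[OF _ True]) measurable
      also have "\<dots> = (\<integral>\<^sup>+x. ennreal (s ^ ?N) * g (s *\<^sub>R x) \<partial>lborel)"
        by (subst nn_integral_cmult) auto
      also have "\<dots> = (\<integral>\<^sup>+x. ennreal (real ?N * s ^ n * norm x ^ ?N) * indicator {0<..} s * (f (s *\<^sub>R x) * indicator ?B x) \<partial>lborel)"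
      proof (rule nn_integral_cong)
        fix x :: 'a
        have "s ^ ?N * (real ?N * norm (s *\<^sub>R x) ^ ?N * (1 / s ^ Suc ?N)) = real ?N * s ^ n * norm x ^ ?N"
          unfolding n using True by (simp add: power_mult_distrib)
        then have "ennreal (s ^ ?N) * ennreal (real ?N * norm (s *\<^sub>R x) ^ ?N * (1 / s ^ Suc ?N)) = ennreal (real ?N * s ^ n * norm x ^ ?N)"
          using True by (subst ennreal_mult[symmetric]) auto
        moreover have "norm (s *\<^sub>R x) < s \<longleftrightarrow> norm x < 1"
          using True by simp
        ultimately show "ennreal (s ^ ?N) * g (s *\<^sub>R x)
          = ennreal (real ?N * s ^ n * norm x ^ ?N) * indicator {0<..} s * (f (s *\<^sub>R x) * indicator ?B x)"
          unfolding g_def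
          using True by (auto simp: mult.assoc[symmetric] punctured_ball_def split: split_indicator)
      qed
      finally show ?thesis by (simp add: g_def)
    next
      case False
      then have "indicator {norm y<..} s = (0::ennreal)" for y :: 'a
        using norm_ge_zero[of y] by (auto split: split_indicator simp del: norm_ge_zero)
      then show ?thesis using False by simp
    qed
  qed
  also have "\<dots> = (\<integral>\<^sup>+y. (\<integral>\<^sup>+s. ennreal (real ?N * norm y ^ ?N * (1 / s ^ Suc ?N)) * indicator {norm y<..} s *
            (f y * indicator (- {0}) y) \<partial>lborel) \<partial>lborel)"
  proof (rule lborel_pair.Fubini'[symmetric])
    have "(\<lambda>z::real \<times> 'a. indicator {norm (snd z)<..} (fst z) :: ennreal) = (\<lambda>z. if norm (snd z) < fst z then 1 else 0)"
      by (auto simp: fun_eq_iff)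
    then have [measurable]: "(\<lambda>z::real \<times> 'a. indicator {norm (snd z)<..} (fst z) :: ennreal) \<in> borel_measurable (lborel \<Otimes>\<^sub>M lborel)"
      by simp
    have [measurable]: "(\<lambda>y. indicator (- {0::'a}) y :: ennreal) \<in> borel_measurable borel"
      by simp
    show "(\<lambda>(s, y). ennreal (real ?N * norm y ^ ?N * (1 / s ^ Suc ?N)) * indicator {norm y<..} s *
            (f y * indicator (- {0}) y)) \<in> borel_measurable (lborel \<Otimes>\<^sub>M lborel)"
      unfolding case_prod_beta by measurable
  qed
  also have "\<dots> = (\<integral>\<^sup>+y. f y \<partial>lborel)"
  proof (rule nn_integral_cong_AE)
    show "AE y in lborel. (\<integral>\<^sup>+s. ennreal (real ?N * norm y ^ ?N * (1 / s ^ Suc ?N)) * indicator {norm y<..} s *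
            (f y * indicator (- {0}) y) \<partial>lborel) = f y"
      using AE_lborel_singleton[of "0::'a"]
    proof eventually_elim
      fix y :: 'a assume y: "y \<noteq> 0"
      have "(\<integral>\<^sup>+s. ennreal (real ?N * norm y ^ ?N * (1 / s ^ Suc ?N)) * indicator {norm y<..} s * (f y * indicator (- {0}) y) \<partial>lborel)
         = (\<integral>\<^sup>+s. (ennreal (real ?N * norm y ^ ?N) * f y) * (ennreal (1 / s ^ Suc ?N) * indicator {norm y<..} s) \<partial>lborel)"
        using y by (intro nn_integral_cong) (subst ennreal_mult', auto simp: mult_ac split: split_indicator)
      also have "\<dots> = ennreal (real ?N * norm y ^ ?N) * f y * ennreal (1 / (real ?N * norm y ^ ?N))"
        using y by (subst nn_integral_cmult, simp, subst nn_integral_power_tail) auto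
      also have "\<dots> = f y * (ennreal (real ?N * norm y ^ ?N) * ennreal (1 / (real ?N * norm y ^ ?N)))"
        by (simp add: mult_ac)
      also have "ennreal (real ?N * norm y ^ ?N) * ennreal (1 / (real ?N * norm y ^ ?N)) = 1"
        using y by (subst ennreal_mult[symmetric]) auto
      finally show "(\<integral>\<^sup>+s. ennreal (real ?N * norm y ^ ?N * (1 / s ^ Suc ?N)) * indicator {norm y<..} s *
            (f y * indicator (- {0}) y) \<partial>lborel) = f y" by simp
    qed
  qed
  finally show ?thesis by (simp add: n)
qed

definition direction_measure :: "'a::euclidean_space measure" where
  "direction_measure = uniform_measure lborel punctured_ball"

text \<open>Directions are sampled as \<open>sgn x\<close> with \<open>x\<close> uniform in the punctured ball, so a spherical mean is
an expectation with respect to an absolutely continuous measure on the whole space.\<close>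

definition smean :: "('a::euclidean_space \<Rightarrow> real) \<Rightarrow> real \<Rightarrow> real" where
  "smean F r = (LINT x|direction_measure. F (r *\<^sub>R sgn x))"

lemma sets_direction_measure[measurable_cong, simp]: "sets direction_measure = sets borel"
  by (simp add: direction_measure_def)

lemma space_direction_measure[simp]: "space direction_measure = UNIV"
  by (simp add: direction_measure_def)

lemma emeasure_punctured_ball:
  "emeasure lborel (punctured_ball :: 'a::euclidean_space set) = emeasure lborel (ball (0::'a) 1)"
  unfolding punctured_ball_def
  by (rule emeasure_eq_AE) (use AE_lborel_singleton[of "0::'a"] in \<open>auto elim!: eventually_mono\<close>)

lemma emeasure_punctured_ball_finite:
  "emeasure lborel (punctured_ball :: 'a::euclidean_space set) \<noteq> \<infinity>"
  unfolding emeasure_punctured_ball using emeasure_lborel_ball_finite[of "0::'a" 1] by auto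

lemma measure_punctured_ball_pos: "measure lborel (punctured_ball :: 'a::euclidean_space set) > 0"
  by (metis content_ball_pos emeasure_punctured_ball measure_def zero_less_one)

lemma emeasure_punctured_ball_nonzero: "emeasure lborel (punctured_ball :: 'a::euclidean_space set) \<noteq> 0"
  using measure_punctured_ball_pos[where 'a='a] by (metis less_irrefl measure_eq_emeasure_eq_ennreal ennreal_0 order_refl)

interpretation direction: prob_space "direction_measure :: 'a::euclidean_space measure"
  unfolding direction_measure_def
  by (rule prob_space_uniform_measure[OF emeasure_punctured_ball_nonzero emeasure_punctured_ball_finite])

lemma AE_direction_norm_sgn: "AE x in (direction_measure :: 'a::euclidean_space measure). norm (sgn x) = 1"
  unfolding direction_measure_def
  by (rule AE_uniform_measureI) (auto simp: punctured_ball_def norm_sgn)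

text \<open>Stating polar coordinates as an identity of measures makes them available for signed functions.\<close>

lemma lborel_polar:
  "(lborel :: 'a::euclidean_space measure) =
     distr (density lborel (\<lambda>r. ennreal (real DIM('a) * measure lborel (punctured_ball :: 'a set) * r ^ (DIM('a) - 1)) *
              indicator {0<..} r) \<Otimes>\<^sub>M direction_measure) borel (\<lambda>(r, x). r *\<^sub>R sgn x)"
    (is "_ = distr (?Q \<Otimes>\<^sub>M ?P) borel ?h")
proof (rule measure_eqI)
  let ?V = "measure lborel (punctured_ball :: 'a set)"
  note V = measure_punctured_ball_pos[where 'a='a]
  have V_eq: "emeasure lborel (punctured_ball :: 'a set) = ennreal ?V"
    using emeasure_punctured_ball_finite by (intro emeasure_eq_ennreal_measure) auto
  show "sets lborel = sets (distr (?Q \<Otimes>\<^sub>M ?P) borel ?h)" by simp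
  fix A :: "'a set" assume "A \<in> sets lborel"
  then have [measurable]: "A \<in> sets borel" by simp
  have "emeasure (distr (?Q \<Otimes>\<^sub>M ?P) borel ?h) A = (\<integral>\<^sup>+z. indicator A (?h z) \<partial>(?Q \<Otimes>\<^sub>M ?P))"
    by (subst nn_integral_indicator[symmetric], simp, subst nn_integral_distr) auto
  also have "\<dots> = (\<integral>\<^sup>+r. (\<integral>\<^sup>+x. indicator A (r *\<^sub>R sgn x) \<partial>?P) \<partial>?Q)"
    by (subst direction.nn_integral_fst[symmetric]) auto
  also have "\<dots> = (\<integral>\<^sup>+r. ennreal (real DIM('a) * ?V * r ^ (DIM('a) - 1)) * indicator {0<..} r *
      (\<integral>\<^sup>+x. indicator A (r *\<^sub>R sgn x) \<partial>?P) \<partial>lborel)"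
    by (subst nn_integral_density) auto
  also have "\<dots> = (\<integral>\<^sup>+r. ennreal (real DIM('a) * r ^ (DIM('a) - 1)) * indicator {0<..} r *
            (\<integral>\<^sup>+x. indicator A (r *\<^sub>R sgn x) * indicator punctured_ball x \<partial>lborel) \<partial>lborel)"
  proof (rule nn_integral_cong)
    fix r :: real
    define J where "J = (\<integral>\<^sup>+x. indicator A (r *\<^sub>R sgn x) * indicator (punctured_ball :: 'a set) x \<partial>lborel)"
    have "(\<integral>\<^sup>+x. indicator A (r *\<^sub>R sgn x) \<partial>?P) = J / ennreal ?V"
      unfolding direction_measure_def J_def V_eq[symmetric] by (subst nn_integral_uniform_measure) auto
    moreover have "ennreal (real DIM('a) * ?V * r ^ (DIM('a) - 1)) * indicator {0<..} r * (J / ennreal ?V)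
        = ennreal (real DIM('a) * r ^ (DIM('a) - 1)) * indicator {0<..} r * J"
    proof (cases "r > 0")
      case True
      have "ennreal (real DIM('a) * ?V * r ^ (DIM('a) - 1)) = ennreal (real DIM('a) * r ^ (DIM('a) - 1)) * ennreal ?V"
        using True V by (subst ennreal_mult[symmetric]) (auto simp: mult_ac)
      moreover have "ennreal ?V * (J / ennreal ?V) = J"
        using V by (simp add: ennreal_times_divide mult_divide_eq_ennreal mult.commute)
      ultimately show ?thesis using True by (simp add: mult.assoc)
    qed simp
    ultimately show "ennreal (real DIM('a) * ?V * r ^ (DIM('a) - 1)) * indicator {0<..} r *
      (\<integral>\<^sup>+x. indicator A (r *\<^sub>R sgn x) \<partial>?P) = ennreal (real DIM('a) * r ^ (DIM('a) - 1)) * indicator {0<..} r *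
            (\<integral>\<^sup>+x. indicator A (r *\<^sub>R sgn x) * indicator punctured_ball x \<partial>lborel)"
      by (simp add: J_def)
  qed
  also have "\<dots> = (\<integral>\<^sup>+y. indicator A y \<partial>lborel)"
    by (rule nn_integral_polar) simp
  finally show "emeasure lborel A = emeasure (distr (?Q \<Otimes>\<^sub>M ?P) borel ?h) A" by simp
qed

lemma integral_polar:
  fixes F :: "'a::euclidean_space \<Rightarrow> real"
  assumes F: "integrable lborel F"
  defines "w \<equiv> (\<lambda>r. real DIM('a) * measure lborel (punctured_ball :: 'a set) * r ^ (DIM('a) - 1) * indicator {0<..} r)"
  shows "integrable lborel (\<lambda>r. w r * smean F r)"
    and "(LINT y|lborel. F y) = (LINT r|lborel. w r * smean F r)"
proof -
  let ?P = "direction_measure :: 'a measure"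
  have Fm: "F \<in> borel_measurable borel" using F by simp
  define Q where "Q = density lborel (\<lambda>r. ennreal (w r))"
  have w_nn: "w r \<ge> 0" for r by (auto simp: w_def split: split_indicator)
  have wm[measurable]: "w \<in> borel_measurable borel" unfolding w_def by measurable
  have Q_eq: "Q = density lborel (\<lambda>r. ennreal (real DIM('a) * measure lborel (punctured_ball :: 'a set) * r ^ (DIM('a) - 1)) *
              indicator {0<..} r)"
    unfolding Q_def w_def by (rule density_cong) (auto split: split_indicator)
  have polar: "(lborel :: 'a measure) = distr (Q \<Otimes>\<^sub>M ?P) borel (\<lambda>(r, x). r *\<^sub>R sgn x)"
    unfolding Q_eq by (rule lborel_polar)
  have setsQ[measurable_cong]: "sets Q = sets borel" by (simp add: Q_def)
  interpret Q: sigma_finite_measure Q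
    unfolding Q_def by (rule sigma_finite_measure.sigma_finite_iff_density_finite[OF sigma_finite_lborel, THEN iffD2]) auto
  interpret QP: pair_sigma_finite Q ?P ..
  have hm: "(\<lambda>(r, x). r *\<^sub>R sgn (x::'a)) \<in> measurable (Q \<Otimes>\<^sub>M ?P) borel" by measurable
  have int: "integrable (Q \<Otimes>\<^sub>M ?P) (\<lambda>z. F (case z of (r, x) \<Rightarrow> r *\<^sub>R sgn x))"
    using F integrable_distr_eq[OF hm Fm] polar by simp
  from QP.integrable_fst'[OF int] have i1: "integrable Q (smean F)" by (simp add: smean_def[abs_def])
  have "(LINT y|lborel. F y) = (LINT z|(Q \<Otimes>\<^sub>M ?P). F (case z of (r, x) \<Rightarrow> r *\<^sub>R sgn x))"
    using integral_distr[OF hm Fm] polar by simp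
  also have "\<dots> = (LINT r|Q. smean F r)"
    using QP.integral_fst'[OF int] by (simp add: smean_def)
  finally have i2: "(LINT y|lborel. F y) = (LINT r|Q. smean F r)" .
  have sm: "smean F \<in> borel_measurable lborel"
    using borel_measurable_integrable[OF i1] by (simp add: Q_def)
  show "integrable lborel (\<lambda>r. w r * smean F r)"
    using i1 sm w_nn unfolding Q_def by (subst (asm) integrable_real_density) auto
  show "(LINT y|lborel. F y) = (LINT r|lborel. w r * smean F r)"
    unfolding i2 Q_def using sm w_nn by (subst integral_real_density) auto
qed

lemma borel_measurable_on_ray[measurable]:
  assumes [measurable]: "F \<in> borel_measurable borel"
  shows "(\<lambda>x. F (r *\<^sub>R sgn x)) \<in> borel_measurable (direction_measure :: 'a::euclidean_space measure)"
  by measurable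

lemma integrable_on_sphere:
  fixes F :: "'a::euclidean_space \<Rightarrow> real"
  assumes F: "F \<in> borel_measurable borel" "continuous_on (sphere 0 r) F" and r: "0 \<le> r"
  shows "integrable direction_measure (\<lambda>x. F (r *\<^sub>R sgn x))"
proof -
  have "compact (F ` sphere 0 r)" by (rule compact_continuous_image[OF F(2)]) simp
  then have "bounded (F ` sphere 0 r)" by (rule compact_imp_bounded)
  then obtain M where M: "\<And>x. x \<in> sphere 0 r \<Longrightarrow> norm (F x) \<le> M"
    unfolding bounded_iff by blast
  show ?thesis
    by (rule direction.integrable_const_bound[of _ M])
       (use AE_direction_norm_sgn M r F(1) in \<open>auto elim!: eventually_mono\<close>)
qed

lemma smean_mono:
  fixes F G :: "'a::euclidean_space \<Rightarrow> real"
  assumes "F \<in> borel_measurable borel" "continuous_on (sphere 0 r) F"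
    and "G \<in> borel_measurable borel" "continuous_on (sphere 0 r) G"
    and r: "0 \<le> r" and le: "\<And>x. norm x = r \<Longrightarrow> F x \<le> G x"
  shows "smean F r \<le> smean G r"
  unfolding smean_def
  by (rule integral_mono_AE)
     (use AE_direction_norm_sgn r in \<open>auto intro!: integrable_on_sphere assms elim!: eventually_mono\<close>)

lemma smean_cong:
  fixes F G :: "'a::euclidean_space \<Rightarrow> real"
  assumes "F \<in> borel_measurable borel" "G \<in> borel_measurable borel"
    and r: "0 \<le> r" and eq: "\<And>x. norm x = r \<Longrightarrow> F x = G x"
  shows "smean F r = smean G r"
  unfolding smean_def
  by (rule integral_cong_AE)
     (use AE_direction_norm_sgn r assms in \<open>auto elim!: eventually_mono\<close>)

lemma smean_const: "smean (\<lambda>x::'a::euclidean_space. c) r = c"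
  using direction.prob_space[where 'a='a] by (simp add: smean_def)

lemma continuous_on_smean:
  fixes F :: "'a::euclidean_space \<Rightarrow> real"
  assumes F[measurable]: "F \<in> borel_measurable borel" and c: "continuous_on {x. a \<le> norm x \<and> norm x \<le> b} F"
    and a: "0 \<le> a"
  shows "continuous_on {a..b} (smean F)"
  unfolding continuous_on_sequentially
proof (intro allI ballI impI, elim conjE)
  fix X :: "nat \<Rightarrow> real" and r assume r: "r \<in> {a..b}" and X: "\<forall>n. X n \<in> {a..b}" "X \<longlonglongrightarrow> r"
  let ?A = "{x::'a. a \<le> norm x \<and> norm x \<le> b}"
  have "?A = cball 0 b - ball 0 a" by auto
  then have "compact ?A" by (simp add: compact_diff)
  then have "bounded (F ` ?A)" by (intro compact_imp_bounded compact_continuous_image[OF c])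
  then obtain M where M: "\<And>x. x \<in> ?A \<Longrightarrow> norm (F x) \<le> M"
    unfolding bounded_iff by blast
  show "(smean F \<circ> X) \<longlonglongrightarrow> smean F r"
    unfolding o_def smean_def
  proof (rule integral_dominated_convergence[where w="\<lambda>_. M"])
    show "AE x in direction_measure. (\<lambda>n. F (X n *\<^sub>R sgn x)) \<longlonglongrightarrow> F (r *\<^sub>R sgn x)"
      using AE_direction_norm_sgn
    proof eventually_elim
      fix x :: 'a assume x: "norm (sgn x) = 1"
      have "(\<lambda>n. X n *\<^sub>R sgn x) \<longlonglongrightarrow> r *\<^sub>R sgn x" by (intro tendsto_intros X)
      moreover have mem: "t *\<^sub>R sgn x \<in> ?A" if "t \<in> {a..b}" for t
        using that x a by simp
      ultimately show "(\<lambda>n. F (X n *\<^sub>R sgn x)) \<longlonglongrightarrow> F (r *\<^sub>R sgn x)"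
        by (intro continuous_on_tendsto_compose[OF c]) (use r X(1) in \<open>auto intro!: always_eventually mem\<close>)
    qed
    fix n
    show "AE x in direction_measure. norm (F (X n *\<^sub>R sgn x)) \<le> M"
      using AE_direction_norm_sgn
    proof eventually_elim
      fix x :: 'a assume x: "norm (sgn x) = 1"
      have "X n \<in> {a..b}" using X(1) by blast
      then show "norm (F (X n *\<^sub>R sgn x)) \<le> M" using x a by (intro M) auto
    qed
  qed auto
qed

text \<open>Differentiation under the integral sign; the radial derivative is bounded on a compact annulus,
which dominates the difference quotients.\<close>

lemma has_real_derivative_smean:
  fixes U R :: "'a::euclidean_space \<Rightarrow> real"
  assumes [measurable]: "U \<in> borel_measurable borel" "R \<in> borel_measurable borel"
    and R: "continuous_on {x. a < norm x \<and> norm x < b} R" and a: "0 \<le> a"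
    and U: "\<And>x. a < norm x \<Longrightarrow> norm x < b \<Longrightarrow> (U has_derivative (\<lambda>h. g x \<bullet> h)) (at x)"
    and Rg: "\<And>x. a < norm x \<Longrightarrow> norm x < b \<Longrightarrow> R x = g x \<bullet> sgn x"
    and r: "a < r" "r < b"
  shows "(smean U has_real_derivative smean R r) (at r)"
proof -
  define e where "e = min (r - a) (b - r) / 2"
  have e: "e > 0" "a < r - e" "r + e < b" using r by (auto simp: e_def min_def field_simps)
  let ?A = "{x::'a. r - e \<le> norm x \<and> norm x \<le> r + e}"
  have "?A = cball 0 (r + e) - ball 0 (r - e)" by auto
  then have "compact ?A" by (simp add: compact_diff)
  moreover have "continuous_on ?A R" by (rule continuous_on_subset[OF R]) (use e in auto)
  ultimately have "bounded (R ` ?A)" by (intro compact_imp_bounded compact_continuous_image)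
  then obtain M where M: "\<And>x. x \<in> ?A \<Longrightarrow> norm (R x) \<le> M" unfolding bounded_iff by blast
  have ray: "((\<lambda>t. U (t *\<^sub>R \<omega>)) has_real_derivative R (t *\<^sub>R \<omega>)) (at t)"
    if w: "norm \<omega> = 1" and t: "a < t" "t < b" for t and \<omega> :: 'a
  proof -
    have t0: "t > 0" using t a by simp
    have "((\<lambda>t. U (t *\<^sub>R \<omega>)) has_derivative (\<lambda>h. g (t *\<^sub>R \<omega>) \<bullet> (h *\<^sub>R \<omega>))) (at t)"
      by (rule has_derivative_compose[OF _ U]) (use w t t0 in \<open>auto intro!: derivative_eq_intros\<close>)
    moreover have "(\<lambda>h. g (t *\<^sub>R \<omega>) \<bullet> (h *\<^sub>R \<omega>)) = (*) (R (t *\<^sub>R \<omega>))"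
      using w t t0 by (subst Rg) (auto simp: sgn_scaleR sgn_div_norm)
    ultimately show ?thesis unfolding has_field_derivative_def by simp
  qed
  have Ucont: "continuous_on (sphere 0 t) U" if "a < t" "t < b" for t
    by (intro continuous_at_imp_continuous_on ballI has_derivative_continuous[OF U]) (use that in auto)
  have iU: "integrable direction_measure (\<lambda>x. U (t *\<^sub>R sgn x))" if "a < t" "t < b" for t
    by (rule integrable_on_sphere) (use that a Ucont in auto)
  have seq: "(\<lambda>n. (smean U (X n) - smean U r) / (X n - r)) \<longlonglongrightarrow> smean R r"
    if X: "\<forall>n. X n \<in> {r - e..r + e} - {r}" "X \<longlonglongrightarrow> r" for X :: "nat \<Rightarrow> real"
  proof -
    have Xn: "r - e \<le> X n" "X n \<le> r + e" "X n \<noteq> r" "a < X n" "X n < b" for n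
      using spec[OF X(1), of n] e by auto
    have "(\<lambda>n. LINT x|direction_measure. (U (X n *\<^sub>R sgn x) - U (r *\<^sub>R sgn x)) / (X n - r)) \<longlonglongrightarrow> smean R r"
      unfolding smean_def
    proof (rule integral_dominated_convergence[where w="\<lambda>_. M"])
      show "AE x in direction_measure. (\<lambda>n. (U (X n *\<^sub>R sgn x) - U (r *\<^sub>R sgn x)) / (X n - r)) \<longlonglongrightarrow> R (r *\<^sub>R sgn x)"
        using AE_direction_norm_sgn
      proof eventually_elim
        fix x :: 'a assume x: "norm (sgn x) = 1"
        have "((\<lambda>t. (U (t *\<^sub>R sgn x) - U (r *\<^sub>R sgn x)) / (t - r)) \<longlongrightarrow> R (r *\<^sub>R sgn x)) (at r)"
          using ray[OF x r] by (simp add: has_field_derivative_iff)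
        then show "(\<lambda>n. (U (X n *\<^sub>R sgn x) - U (r *\<^sub>R sgn x)) / (X n - r)) \<longlonglongrightarrow> R (r *\<^sub>R sgn x)"
          unfolding tendsto_at_iff_sequentially using X(2) Xn(3) by (auto simp: o_def)
      qed
      fix n
      show "AE x in direction_measure. norm ((U (X n *\<^sub>R sgn x) - U (r *\<^sub>R sgn x)) / (X n - r)) \<le> M"
        using AE_direction_norm_sgn
      proof eventually_elim
        fix x :: 'a assume x: "norm (sgn x) = 1"
        have "norm (U (X n *\<^sub>R sgn x) - U (r *\<^sub>R sgn x)) \<le> M * norm (X n - r)"
        proof (rule field_differentiable_bound[where S="{r - e..r + e}" and f'="\<lambda>t. R (t *\<^sub>R sgn x)"])
          fix t assume t: "t \<in> {r - e..r + e}"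
          show "((\<lambda>t. U (t *\<^sub>R sgn x)) has_field_derivative R (t *\<^sub>R sgn x)) (at t within {r - e..r + e})"
            by (rule has_field_derivative_at_within[OF ray]) (use t e x in auto)
          show "norm (R (t *\<^sub>R sgn x)) \<le> M" by (rule M) (use t e x a in auto)
        qed (use Xn e in auto)
        then show "norm ((U (X n *\<^sub>R sgn x) - U (r *\<^sub>R sgn x)) / (X n - r)) \<le> M"
          using Xn(3)[of n] by (simp add: norm_divide divide_le_eq)
      qed
    qed auto
    moreover have "(LINT x|direction_measure. (U (X n *\<^sub>R sgn x) - U (r *\<^sub>R sgn x)) / (X n - r))
        = (smean U (X n) - smean U r) / (X n - r)" for n
      using iU[OF Xn(4,5)] iU[OF r] by (simp add: smean_def)
    ultimately show ?thesis by (simp only:)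
  qed
  have "((\<lambda>t. (smean U t - smean U r) / (t - r)) \<longlongrightarrow> smean R r) (at r within {r - e..r + e})"
    unfolding tendsto_at_iff_sequentially using seq by (auto simp: o_def)
  moreover have "at r within {r - e..r + e} = at r"
    by (rule at_within_interior) (use e in auto)
  ultimately show ?thesis by (simp add: has_field_derivative_iff)
qed

section \<open>Integration by parts\<close>

text \<open>The difference quotients of \<open>f\<close> have integral zero because Lebesgue measure is translation
invariant, and they converge to \<open>f'\<close> boundedly on a common bounded set. Summed over a basis this is
the divergence theorem for compactly supported fields.\<close>

lemma integral_directional_derivative_eq_0:
  fixes f :: "'a::euclidean_space \<Rightarrow> real"
  assumes D: "\<And>x. (f has_derivative D x) (at x)"
    and f': "\<And>x. D x b = f' x" "continuous_on UNIV f'"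
    and supp: "\<And>x. norm x > M \<Longrightarrow> f x = 0 \<and> f' x = 0"
  shows "integral\<^sup>L lborel f' = 0"
proof -
  have fc: "continuous_on UNIV f"
    using D by (auto intro!: continuous_at_imp_continuous_on has_derivative_continuous)
  have [measurable]: "f \<in> borel_measurable borel" "f' \<in> borel_measurable borel"
    using fc f'(2) by (auto intro: borel_measurable_continuous_onI)
  have "compact (f' ` cball 0 M)"
    by (rule compact_continuous_image[OF continuous_on_subset[OF f'(2)]]) auto
  then have "bounded (f' ` cball 0 M)" by (rule compact_imp_bounded)
  then obtain L0 where L0: "\<And>x. x \<in> cball 0 M \<Longrightarrow> norm (f' x) \<le> L0" unfolding bounded_iff by blast
  define L where "L = max 0 L0"
  have L: "norm (f' x) \<le> L" for x
    using L0[of x] supp[of x] by (cases "norm x \<le> M") (auto simp: L_def)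
  have int_f: "integrable lborel f"
  proof -
    have "integrable lborel (\<lambda>x. indicator (cball 0 M) x *\<^sub>R f x)"
      by (rule borel_integrable_compact) (auto intro: continuous_on_subset[OF fc])
    moreover have "(\<lambda>x. indicator (cball 0 M) x *\<^sub>R f x) = f"
      using supp by (force simp: fun_eq_iff split: split_indicator)
    ultimately show ?thesis by simp
  qed
  have trans: "integrable lborel (\<lambda>x. f (c + x))" "(LINT x|lborel. f (c + x)) = integral\<^sup>L lborel f" for c
    using int_f integrable_distr_eq[of "(+) c" "lborel :: 'a measure" borel f] 
      integral_distr[of "(+) c" "lborel :: 'a measure" borel f]
    by (simp_all add: lborel_distr_plus)
  define h :: "nat \<Rightarrow> real" where "h n = 1 / real (Suc n)" for n
  have h: "h n > 0" "h n \<le> 1" for n by (auto simp: h_def)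
  have h_lim: "h \<longlonglongrightarrow> 0" unfolding h_def by (rule LIMSEQ_Suc[OF lim_1_over_n])
  have path: "((\<lambda>t. f (t *\<^sub>R b + x)) has_real_derivative f' (t *\<^sub>R b + x)) (at t)" for t x
  proof -
    have "((\<lambda>t. f (t *\<^sub>R b + x)) has_derivative (\<lambda>s. D (t *\<^sub>R b + x) (s *\<^sub>R b))) (at t)"
      by (rule has_derivative_compose[OF _ D]) (auto intro!: derivative_eq_intros)
    moreover have "(\<lambda>s. D (t *\<^sub>R b + x) (s *\<^sub>R b)) = (*) (f' (t *\<^sub>R b + x))"
      using linear_scale[OF has_derivative_linear[OF D]] f'(1) by (auto simp: fun_eq_iff)
    ultimately show ?thesis by (simp add: has_field_derivative_def)
  qed
  have "(\<lambda>n. LINT x|lborel. (f (h n *\<^sub>R b + x) - f x) / h n) \<longlonglongrightarrow> integral\<^sup>L lborel f'"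
  proof (rule integral_dominated_convergence[where w="\<lambda>x. L * indicator (cball 0 (M + norm b)) x"])
    show "integrable lborel (\<lambda>x. L * indicator (cball 0 (M + norm b)) (x::'a))"
      using emeasure_lborel_cball_finite[of "0::'a" "M + norm b"] by (intro integrable_mult_right integrable_real_indicator) auto
    show "AE x in lborel. (\<lambda>n. (f (h n *\<^sub>R b + x) - f x) / h n) \<longlonglongrightarrow> f' x"
    proof (rule AE_I2)
      fix x
      have "((\<lambda>t. (f (t *\<^sub>R b + x) - f x) / t) \<longlongrightarrow> f' x) (at 0)"
        using path[of x 0] by (simp add: has_field_derivative_iff)
      then show "(\<lambda>n. (f (h n *\<^sub>R b + x) - f x) / h n) \<longlonglongrightarrow> f' x"
        unfolding tendsto_at_iff_sequentially using h(1) h_lim by (auto simp: o_def less_imp_neq[symmetric])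
    qed
    fix n
    show "AE x in lborel. norm ((f (h n *\<^sub>R b + x) - f x) / h n) \<le> L * indicator (cball 0 (M + norm b)) x"
    proof (rule AE_I2)
      fix x
      show "norm ((f (h n *\<^sub>R b + x) - f x) / h n) \<le> L * indicator (cball 0 (M + norm b)) x"
      proof (cases "x \<in> cball 0 (M + norm b)")
        case True
        have "norm (f (h n *\<^sub>R b + x) - f (0 *\<^sub>R b + x)) \<le> L * norm (h n - 0)"
          by (rule field_differentiable_bound[where S=UNIV and f'="\<lambda>t. f' (t *\<^sub>R b + x)" and f = "\<lambda>t. f (t *\<^sub>R b + x)"])
             (use path L in auto)
        then show ?thesis using h(1)[of n] True by (simp add: norm_divide divide_le_eq)
      next
        case False
        then have x: "norm x > M + norm b" by simp
        have "norm (h n *\<^sub>R b) \<le> norm b" using h[of n] by (simp add: mult_left_le_one_le)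
        then have "norm (h n *\<^sub>R b + x) > M" using x norm_triangle_ineq2[of x "- (h n *\<^sub>R b)"] by (simp add: add.commute)
        moreover have "norm x > M" using x norm_ge_zero[of b] by linarith
        ultimately have "f (h n *\<^sub>R b + x) = 0" "f x = 0" using supp by auto
        then show ?thesis using False by simp
      qed
    qed
  qed auto
  moreover have "(LINT x|lborel. (f (h n *\<^sub>R b + x) - f x) / h n) = 0" for n
    using trans[of "h n *\<^sub>R b"] int_f by simp
  ultimately have "(\<lambda>n. 0) \<longlonglongrightarrow> integral\<^sup>L lborel f'" by (simp only:)
  then show ?thesis by (simp add: LIMSEQ_const_iff)
qed

text \<open>A weak derivative that is continuous is a classical one. Let \<open>h\<close> be the difference of \<open>Y\<close> and an
antiderivative of \<open>Z\<close>; testing with \<open>\<phi>' = (h - K) * w\<close>, where \<open>w\<close> is a positive weight vanishing at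
both end points and \<open>K\<close> the weighted mean of \<open>h\<close>, gives \<open>integral (h - K)^2 * w = 0\<close>, hence \<open>h = K\<close>.
The weight makes the extension of \<open>\<phi>'\<close> by zero continuous.\<close>

lemma weak_derivative_imp_derivative:
  fixes Y Z :: "real \<Rightarrow> real"
  assumes Y: "continuous_on {c..d} Y" and Z: "continuous_on {c..d} Z"
    and weak: "\<And>\<phi> \<phi>'. continuous_on UNIV \<phi>' \<Longrightarrow> (\<And>t. (\<phi> has_real_derivative \<phi>' t) (at t)) \<Longrightarrow>
        (\<And>t. t \<notin> {c..d} \<Longrightarrow> \<phi> t = 0 \<and> \<phi>' t = 0) \<Longrightarrow> integral {c..d} (\<lambda>t. \<phi>' t * Y t + \<phi> t * Z t) = 0"
    and r: "c < r" "r < d"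
  shows "(Y has_real_derivative Z r) (at r)"
proof -
  have cd: "c < d" using r by simp
  define Zt where "Zt t = integral {c..t} Z" for t
  have Zt': "(Zt has_real_derivative Z t) (at t within {c..d})" if "t \<in> {c..d}" for t
    using integral_has_vector_derivative[OF Z that] unfolding Zt_def has_real_derivative_iff_has_vector_derivative .
  have Ztc: "continuous_on {c..d} Zt"
    by (rule DERIV_continuous_on[OF Zt'])
  define h where "h t = Y t - Zt t" for t
  have hc: "continuous_on {c..d} h" unfolding h_def by (intro continuous_intros Y Ztc)
  define w where "w t = (t - c) * (d - t)" for t
  have wc: "continuous_on S w" for S unfolding w_def by (intro continuous_intros)
  have w_nn: "w t \<ge> 0" if "t \<in> {c..d}" for t using that by (simp add: w_def)
  have w_pos: "w t > 0" if "c < t" "t < d" for t using that by (simp add: w_def)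
  have w_out: "w t \<le> 0" if "t \<notin> {c..d}" for t
    using that cd by (auto simp: w_def mult_le_0_iff)
  have iw: "integral {c..d} w > 0"
  proof -
    have "integral {c..d} w \<ge> 0" by (rule integral_nonneg) (auto intro!: integrable_continuous_real wc w_nn)
    moreover have "integral {c..d} w \<noteq> 0"
      using integral_eq_0_iff[OF wc cd] w_nn w_pos[OF r] r by force
    ultimately show ?thesis by simp
  qed
  define K where "K = integral {c..d} (\<lambda>t. h t * w t) / integral {c..d} w"
  \<comment> \<open>The test function \<open>\<phi>'\<close>; clamping \<open>t\<close> to \<open>{c..d}\<close> and cutting off \<open>w\<close> extend it continuously by zero.\<close>
  define \<psi> where "\<psi> t = (h (max c (min d t)) - K) * max 0 (w t)" for t
  have \<psi>_in: "\<psi> t = (h t - K) * w t" if "t \<in> {c..d}" for t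
    using that w_nn[OF that] by (auto simp: \<psi>_def max_def min_def)
  have \<psi>_out: "\<psi> t = 0" if "t \<notin> {c<..<d}" for t
  proof (cases "t = c \<or> t = d")
    case True then show ?thesis by (auto simp: \<psi>_def w_def)
  next
    case False
    then show ?thesis using that w_out[of t] by (auto simp: \<psi>_def)
  qed
  have \<psi>c: "continuous_on UNIV \<psi>"
    unfolding \<psi>_def using cd
    by (intro continuous_intros wc continuous_on_compose2[OF hc]) auto
  have int\<psi>: "integral {c..d} \<psi> = 0"
  proof -
    have "integral {c..d} \<psi> = integral {c..d} (\<lambda>t. h t * w t - K * w t)"
      by (rule integral_cong) (simp add: \<psi>_in algebra_simps)
    also have "\<dots> = integral {c..d} (\<lambda>t. h t * w t) - K * integral {c..d} w"
      by (subst integral_diff) (auto intro!: integrable_continuous_real continuous_intros hc wc)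
    finally show ?thesis using iw by (simp add: K_def)
  qed
  obtain \<Phi> where \<Phi>: "\<And>t. (\<Phi> has_real_derivative \<psi> t) (at t)"
    using einterval_antiderivative[of "-\<infinity>" "\<infinity>" \<psi>] \<psi>c
    by (auto simp: continuous_on_eq_continuous_at has_real_derivative_iff_has_vector_derivative)
  have \<Phi>c: "\<Phi> t = \<Phi> c" if "t \<le> c" for t
  proof -
    have "\<exists>k. \<forall>x\<in>{..c}. \<Phi> x = k"
    proof (rule has_field_derivative_zero_constant)
      fix x assume "x \<in> {..c}"
      then have "\<psi> x = 0" by (intro \<psi>_out) auto
      then show "(\<Phi> has_field_derivative 0) (at x within {..c})" using has_field_derivative_at_within[OF \<Phi>[of x]] by simp
    qed auto
    then show ?thesis using that by force
  qed
  have \<Phi>d: "\<Phi> t = \<Phi> d" if "t \<ge> d" for t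
  proof -
    have "\<exists>k. \<forall>x\<in>{d..}. \<Phi> x = k"
    proof (rule has_field_derivative_zero_constant)
      fix x assume "x \<in> {d..}"
      then have "\<psi> x = 0" by (intro \<psi>_out) auto
      then show "(\<Phi> has_field_derivative 0) (at x within {d..})" using has_field_derivative_at_within[OF \<Phi>[of x]] by simp
    qed auto
    then show ?thesis using that by force
  qed
  have "(\<psi> has_integral (\<Phi> d - \<Phi> c)) {c..d}"
    using cd \<Phi> by (intro fundamental_theorem_of_calculus)
      (auto simp: has_real_derivative_iff_has_vector_derivative[symmetric] intro: has_field_derivative_at_within)
  then have \<Phi>dc: "\<Phi> d = \<Phi> c" using int\<psi> by (simp add: integral_unique)
  define \<phi> where "\<phi> t = \<Phi> t - \<Phi> c" for t
  have \<phi>': "(\<phi> has_real_derivative \<psi> t) (at t)" for t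
    unfolding \<phi>_def using \<Phi>[of t] by (auto intro!: derivative_eq_intros)
  have \<phi>0: "\<phi> t = 0" if "t \<notin> {c<..<d}" for t
    using that \<Phi>c[of t] \<Phi>d[of t] \<Phi>dc by (auto simp: \<phi>_def)
  have \<phi>c: "continuous_on S \<phi>" for S
    using \<phi>' by (meson DERIV_continuous_on has_field_derivative_at_within)
  have 1: "integral {c..d} (\<lambda>t. \<psi> t * Y t + \<phi> t * Z t) = 0"
    by (rule weak[OF \<psi>c \<phi>']) (use \<phi>0 \<psi>_out in auto)
  have "((\<lambda>t. \<psi> t * Zt t + \<phi> t * Z t) has_integral (\<phi> d * Zt d - \<phi> c * Zt c)) {c..d}"
  proof (rule fundamental_theorem_of_calculus)
    fix t assume t: "t \<in> {c..d}"
    show "((\<lambda>t. \<phi> t * Zt t) has_vector_derivative \<psi> t * Zt t + \<phi> t * Z t) (at t within {c..d})"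
      unfolding has_real_derivative_iff_has_vector_derivative[symmetric]
      by (rule DERIV_cong[OF DERIV_mult[OF has_field_derivative_at_within[OF \<phi>'] Zt'[OF t]]]) simp
  qed (use cd in simp)
  then have 2: "integral {c..d} (\<lambda>t. \<psi> t * Zt t + \<phi> t * Z t) = 0"
    using \<phi>0 by (simp add: integral_unique)
  have \<psi>cc: "continuous_on {c..d} \<psi>" using \<psi>c by (rule continuous_on_subset) simp
  have "integral {c..d} (\<lambda>t. (h t - K)\<^sup>2 * w t) = integral {c..d} (\<lambda>t. (\<psi> t * Y t + \<phi> t * Z t) - (\<psi> t * Zt t + \<phi> t * Z t) - K * \<psi> t)"
    by (rule integral_cong) (simp add: \<psi>_in h_def power2_eq_square algebra_simps)
  also have "\<dots> = 0"
    using 1 2 int\<psi>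
    by (subst integral_diff integral_mult_right; (intro integrable_continuous_real continuous_intros Y Z Ztc \<phi>c \<psi>cc)?)+ simp
  finally have "\<forall>t\<in>{c..d}. (h t - K)\<^sup>2 * w t = 0"
    using w_nn cd by (subst (asm) integral_eq_0_iff) (auto intro!: continuous_intros hc wc)
  then have hK: "h t = K" if "c < t" "t < d" for t
    using that w_pos[OF that] by auto
  have "(Zt has_real_derivative Z r) (at r)"
    using Zt'[of r] r by (simp add: at_within_Icc_at)
  then have "((\<lambda>t. Zt t + K) has_real_derivative Z r) (at r)"
    by (auto intro!: derivative_eq_intros)
  then show ?thesis
    by (rule has_field_derivative_transform_within_open[where S="{c<..<d}"]) (use r hK in \<open>auto simp: h_def algebra_simps\<close>)
qed

section \<open>The flux of a function through spheres\<close>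

text \<open>Functions on \<open>\<Omega>\<close> carry no information outside \<open>\<Omega>\<close>, where they may fail to be measurable.
Their extensions by zero are Borel measurable on the whole space and have the same means over spheres
inside \<open>\<Omega>\<close>.\<close>

definition extend0 :: "'a set \<Rightarrow> ('a \<Rightarrow> real) \<Rightarrow> 'a \<Rightarrow> real" where
  "extend0 \<Omega> f x = (if x \<in> \<Omega> then f x else 0)"

lemma borel_measurable_extend0:
  fixes f :: "'a::euclidean_space \<Rightarrow> real"
  assumes "open \<Omega>" "continuous_on \<Omega> f"
  shows "extend0 \<Omega> f \<in> borel_measurable borel"
proof -
  have "(\<lambda>x. indicator \<Omega> x *\<^sub>R f x) \<in> borel_measurable borel"
    by (rule borel_measurable_continuous_on_indicator) (use assms in auto)
  moreover have "(\<lambda>x. indicator \<Omega> x *\<^sub>R f x) = extend0 \<Omega> f"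
    by (auto simp: extend0_def split: split_indicator)
  ultimately show ?thesis by simp
qed

lemma continuous_on_extend0:
  assumes "continuous_on \<Omega> f" "S \<subseteq> \<Omega>"
  shows "continuous_on S (extend0 \<Omega> f)"
  by (rule continuous_on_eq[OF continuous_on_subset[OF assms]]) (use assms in \<open>auto simp: extend0_def\<close>)

text \<open>The gradient \<open>g\<close> and the Hessian \<open>H\<close> are carried along as functions, so that negation
and translation act on them by plain substitution.\<close>

definition C2_jet :: "'a::euclidean_space set \<Rightarrow> ('a \<Rightarrow> real) \<Rightarrow> ('a \<Rightarrow> 'a) \<Rightarrow> ('a \<Rightarrow> 'a \<Rightarrow> 'a) \<Rightarrow> bool" where
  "C2_jet \<Omega> u g H \<longleftrightarrow>
     (\<forall>x\<in>\<Omega>. (u has_derivative (\<lambda>h. g x \<bullet> h)) (at x) \<and> (g has_derivative H x) (at x)) \<and>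
     (\<forall>h. continuous_on \<Omega> (\<lambda>x. H x h))"

definition operator_trace :: "('a::euclidean_space \<Rightarrow> 'a) \<Rightarrow> real" where
  "operator_trace A = (\<Sum>b\<in>Basis. A b \<bullet> b)"

lemma C2_jet_subset: "C2_jet \<Omega> u g H \<Longrightarrow> S \<subseteq> \<Omega> \<Longrightarrow> C2_jet S u g H"
  unfolding C2_jet_def by (auto intro: continuous_on_subset)

lemma C2_jet_continuous:
  assumes "C2_jet \<Omega> u g H"
  shows "continuous_on \<Omega> u" "continuous_on \<Omega> g" "continuous_on \<Omega> (\<lambda>x. operator_trace (H x))"
proof -
  show "continuous_on \<Omega> u" "continuous_on \<Omega> g"
    using assms unfolding C2_jet_def
    by (auto intro!: continuous_at_imp_continuous_on has_derivative_continuous)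
  have "continuous_on \<Omega> (\<lambda>x. H x h)" for h using assms by (simp add: C2_jet_def)
  then show "continuous_on \<Omega> (\<lambda>x. operator_trace (H x))"
    unfolding operator_trace_def by (intro continuous_intros)
qed

lemma C2_jet_uminus:
  "C2_jet \<Omega> u g H \<Longrightarrow> C2_jet \<Omega> (\<lambda>x. - u x) (\<lambda>x. - g x) (\<lambda>x h. - H x h)"
  unfolding C2_jet_def inner_minus_left
  by (intro conjI ballI allI has_derivative_minus continuous_on_minus) blast+

lemma C2_jet_translate:
  fixes c :: "'a::euclidean_space"
  assumes "C2_jet ((+) c ` S) u g H"
  shows "C2_jet S (\<lambda>x. u (c + x)) (\<lambda>x. g (c + x)) (\<lambda>x. H (c + x))"
proof -
  have tr: "((\<lambda>x. c + x) has_derivative (\<lambda>h. h)) (at x)" for x :: 'a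
    by (auto intro!: derivative_eq_intros)
  show ?thesis
    using assms unfolding C2_jet_def
    by (auto intro!: has_derivative_compose[OF tr] continuous_on_compose2[of "(+) c ` S" _ S "\<lambda>x. c + x"] continuous_intros)
qed

lemma continuous_on_radial_component:
  assumes "C2_jet \<Omega> u g H" "0 \<notin> \<Omega>"
  shows "continuous_on \<Omega> (\<lambda>x. g x \<bullet> sgn x)"
proof -
  have "continuous_on \<Omega> sgn" using assms(2) by (intro continuous_intros) auto
  then show ?thesis by (intro continuous_on_inner C2_jet_continuous[OF assms(1)])
qed

text \<open>The field \<open>\<phi> (norm x) *\<^sub>R g x\<close> has compact support and divergence \<open>F\<close>. Its directional derivatives
are glued from the annulus, where the product rule applies, and the region where \<open>\<phi>\<close> vanishes.\<close>

lemma weak_radial_identity: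
  fixes u :: "'a::euclidean_space \<Rightarrow> real"
  assumes u: "C2_jet \<Omega> u g H" and \<Omega>: "open \<Omega>" "0 \<notin> \<Omega>"
    and sub: "{x. a < norm x \<and> norm x < b} \<subseteq> \<Omega>" and acd: "0 \<le> a" "a < c" "d < b"
    and \<phi>': "continuous_on UNIV \<phi>'" "\<And>t. (\<phi> has_real_derivative \<phi>' t) (at t)"
    and \<phi>0: "\<And>t. t \<notin> {c..d} \<Longrightarrow> \<phi> t = 0 \<and> \<phi>' t = 0"
  defines "F \<equiv> (\<lambda>x. \<phi>' (norm x) * extend0 \<Omega> (\<lambda>x. g x \<bullet> sgn x) x + \<phi> (norm x) * extend0 \<Omega> (\<lambda>x. operator_trace (H x)) x)"
  shows "integrable lborel F" and "integral\<^sup>L lborel F = 0"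
proof -
  have \<phi>c: "continuous_on S \<phi>" for S
    using \<phi>'(2) by (meson DERIV_continuous_on has_field_derivative_at_within)
  let ?A = "{x::'a. a < norm x \<and> norm x < b}"
  let ?B = "{x::'a. norm x < c} \<union> {x. d < norm x}"
  have openA: "open ?A" by (intro open_Collect_conj open_Collect_less continuous_intros)
  have openB: "open ?B" by (intro open_Un open_Collect_less continuous_intros)
  have AB: "?A \<union> ?B = UNIV" using acd by auto
  have B0: "\<phi> (norm x) = 0" "\<phi>' (norm x) = 0" if "x \<in> ?B" for x :: 'a
    using \<phi>0[of "norm x"] that by auto
  have glue: "continuous_on UNIV f" if "continuous_on ?A f" "\<And>x. x \<in> ?B \<Longrightarrow> f x = 0" for f :: "'a \<Rightarrow> real"
  proof -
    have "continuous_on ?B f" by (rule continuous_on_eq[OF continuous_on_const[of _ 0]]) (use that(2) in auto)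
    from continuous_on_open_Un[OF openA openB that(1) this] show ?thesis using AB by simp
  qed
  define G where "G k x = \<phi> (norm x) * extend0 \<Omega> (\<lambda>x. g x \<bullet> k) x" for k x
  define G' where "G' k x = \<phi>' (norm x) * extend0 \<Omega> (\<lambda>x. (sgn x \<bullet> k) * (g x \<bullet> k)) x + \<phi> (norm x) * extend0 \<Omega> (\<lambda>x. H x k \<bullet> k) x" for k x
  have norm_c: "continuous_on S (\<lambda>x. \<phi> (norm x))" "continuous_on S (\<lambda>x. \<phi>' (norm x))" for S :: "'a set"
    by (auto intro!: continuous_on_compose2[OF \<phi>c[of UNIV]] continuous_on_compose2[OF \<phi>'(1)] continuous_intros)
  have sgn_c: "continuous_on \<Omega> sgn" using \<Omega>(2) by (intro continuous_intros) auto
  note uc = C2_jet_continuous[OF u]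
  have Hc: "continuous_on \<Omega> (\<lambda>x. H x k)" for k using u by (simp add: C2_jet_def)
  have G'c: "continuous_on UNIV (G' k)" for k
    unfolding G'_def
    by (intro glue continuous_intros norm_c continuous_on_extend0[OF _ sub] sgn_c uc Hc) (use B0 in auto)
  have supp: "G k x = 0 \<and> G' k x = 0" if "norm x > d" for x k
    using B0[of x] that by (simp add: G_def G'_def)
  have Fc: "continuous_on UNIV F"
    unfolding F_def
    by (intro glue continuous_intros norm_c continuous_on_extend0[OF _ sub] uc continuous_on_radial_component[OF u \<Omega>(2)]) (use B0 in auto)
  have int_compact: "integrable lborel f" if "continuous_on UNIV f" "\<And>x. norm x > d \<Longrightarrow> f x = 0" for f :: "'a \<Rightarrow> real"
  proof -
    have "integrable lborel (\<lambda>x. indicator (cball 0 d) x *\<^sub>R f x)"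
      by (rule borel_integrable_compact) (auto intro: continuous_on_subset[OF that(1)])
    moreover have "(\<lambda>x. indicator (cball 0 d) x *\<^sub>R f x) = f"
      using that(2) by (force simp: fun_eq_iff split: split_indicator)
    ultimately show ?thesis by simp
  qed
  show "integrable lborel F" by (rule int_compact[OF Fc]) (use B0 in \<open>auto simp: F_def\<close>)
  have G'0: "integral\<^sup>L lborel (G' k) = 0" for k
  proof -
    have "\<exists>D. (G k has_derivative D) (at x) \<and> D k = G' k x" for x
    proof (cases "x \<in> ?A")
      case True
      then have x: "x \<in> \<Omega>" "x \<noteq> 0" using sub \<Omega> by auto
      have n: "(norm has_derivative (\<lambda>h. sgn x \<bullet> h)) (at x)"
        using has_derivative_norm[of x] x by (simp add: inner_commute)
      have "((\<lambda>x. \<phi> (norm x)) has_derivative (\<lambda>h. \<phi>' (norm x) * (sgn x \<bullet> h))) (at x)"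
        using has_derivative_compose[OF n, of \<phi> "(*) (\<phi>' (norm x))"] \<phi>'(2)[of "norm x"]
        by (simp add: has_field_derivative_def)
      moreover have "((\<lambda>x. g x \<bullet> k) has_derivative (\<lambda>h. H x h \<bullet> k)) (at x)"
        by (rule has_derivative_inner_left) (use u x in \<open>auto simp: C2_jet_def\<close>)
      ultimately have D: "((\<lambda>x. \<phi> (norm x) * (g x \<bullet> k)) has_derivative
          (\<lambda>h. \<phi> (norm x) * (H x h \<bullet> k) + \<phi>' (norm x) * (sgn x \<bullet> h) * (g x \<bullet> k))) (at x)"
        by (rule has_derivative_mult)
      have GD: "(G k has_derivative
          (\<lambda>h. \<phi> (norm x) * (H x h \<bullet> k) + \<phi>' (norm x) * (sgn x \<bullet> h) * (g x \<bullet> k))) (at x)"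
        by (rule has_derivative_transform_within_open[OF D \<Omega>(1) x(1)]) (auto simp: G_def extend0_def)
      show ?thesis
        by (rule exI, rule conjI, rule GD) (use x in \<open>simp add: G'_def extend0_def algebra_simps\<close>)
    next
      case False
      then have x: "x \<in> ?B" using AB by blast
      have "(G k has_derivative (\<lambda>h. 0)) (at x)"
        by (rule has_derivative_transform_within_open[OF has_derivative_const openB x]) (use B0 in \<open>auto simp: G_def\<close>)
      then show ?thesis using B0[OF x] by (intro exI conjI) (auto simp: G'_def)
    qed
    then obtain D where D: "\<And>x. (G k has_derivative D x) (at x)" "\<And>x. D x k = G' k x" by metis
    show ?thesis by (rule integral_directional_derivative_eq_0[OF D G'c supp])
  qed
  \<comment> \<open>\<open>F\<close> is the divergence of the field with components \<open>G k\<close>.\<close>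
  have "F x = (\<Sum>k\<in>Basis. G' k x)" for x
    by (simp add: F_def G'_def extend0_def operator_trace_def sum.distrib sum_distrib_left[symmetric] euclidean_inner[of "g x" "sgn x"] mult.commute)
  then have "F = (\<lambda>x. \<Sum>k\<in>Basis. G' k x)" by (simp add: fun_eq_iff)
  then have "integral\<^sup>L lborel F = (\<Sum>k\<in>Basis. integral\<^sup>L lborel (G' k))"
    using int_compact[OF G'c] supp by (simp add: Bochner_Integration.integral_sum)
  then show "integral\<^sup>L lborel F = 0" by (simp add: G'0)
qed

text \<open>In polar coordinates the weak identity says that the flux has the weak derivative claimed
here; both sides being continuous, it is a classical one.\<close>

lemma radial_flux_derivative:
  fixes u :: "'a::euclidean_space \<Rightarrow> real"
  assumes u: "C2_jet \<Omega> u g H" and \<Omega>: "open \<Omega>" "0 \<notin> \<Omega>"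
    and sub: "{x. a < norm x \<and> norm x < b} \<subseteq> \<Omega>" and r: "0 \<le> a" "a < r" "r < b"
  shows "((\<lambda>r. r ^ (DIM('a) - 1) * smean (extend0 \<Omega> (\<lambda>x. g x \<bullet> sgn x)) r) has_real_derivative
           r ^ (DIM('a) - 1) * smean (extend0 \<Omega> (\<lambda>x. operator_trace (H x))) r) (at r)"
proof -
  define c where "c = (a + r) / 2"
  define d where "d = (r + b) / 2"
  have cd: "a < c" "c < r" "r < d" "d < b" using r by (auto simp: c_def d_def)
  let ?N = "DIM('a) - 1" and ?V = "measure lborel (punctured_ball :: 'a set)"
  let ?R = "extend0 \<Omega> (\<lambda>x. g x \<bullet> sgn x)" and ?D = "extend0 \<Omega> (\<lambda>x. operator_trace (H x))"
  have cs: "{x::'a. c \<le> norm x \<and> norm x \<le> d} \<subseteq> \<Omega>" using sub cd by auto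
  note rc = continuous_on_radial_component[OF u \<Omega>(2)] and Dc = C2_jet_continuous(3)[OF u]
  have Rc: "continuous_on {c..d} (smean ?R)" and Dc': "continuous_on {c..d} (smean ?D)"
    using cd r cs by (auto intro!: continuous_on_smean borel_measurable_extend0 continuous_on_extend0 rc Dc \<Omega>(1))
  show ?thesis
  proof (rule weak_derivative_imp_derivative[OF _ _ _ cd(2,3)])
    show "continuous_on {c..d} (\<lambda>r. r ^ ?N * smean ?R r)" by (intro continuous_intros Rc)
    show "continuous_on {c..d} (\<lambda>r. r ^ ?N * smean ?D r)" by (intro continuous_intros Dc')
    fix \<phi> \<phi>' :: "real \<Rightarrow> real"
    assume \<phi>'c: "continuous_on UNIV \<phi>'" and \<phi>': "\<And>t. (\<phi> has_real_derivative \<phi>' t) (at t)"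
      and \<phi>0: "\<And>t. t \<notin> {c..d} \<Longrightarrow> \<phi> t = 0 \<and> \<phi>' t = 0"
    have \<phi>c: "continuous_on S \<phi>" for S
      using \<phi>' by (meson DERIV_continuous_on has_field_derivative_at_within)
    define F where "F x = \<phi>' (norm x) * ?R x + \<phi> (norm x) * ?D x" for x
    note weak = weak_radial_identity[OF u \<Omega> sub r(1) cd(1,4) \<phi>'c \<phi>' \<phi>0, folded F_def]
    define Q where "Q r = r ^ ?N * (\<phi>' r * smean ?R r + \<phi> r * smean ?D r)" for r
    have sF: "smean F t = \<phi>' t * smean ?R t + \<phi> t * smean ?D t" if t: "t \<in> {c..d}" for t
    proof -
      have t0: "0 \<le> t" using t cd r by auto
      have st: "sphere 0 t \<subseteq> \<Omega>" using cs t by auto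
      have [simp]: "integrable direction_measure (\<lambda>x. ?R (t *\<^sub>R sgn x))" "integrable direction_measure (\<lambda>x. ?D (t *\<^sub>R sgn x))"
        using t0 st by (auto intro!: integrable_on_sphere borel_measurable_extend0 continuous_on_extend0 rc Dc \<Omega>(1))
      have [measurable]: "?R \<in> borel_measurable borel" "?D \<in> borel_measurable borel"
        by (auto intro!: borel_measurable_extend0 rc Dc \<Omega>(1))
      have [measurable]: "\<phi> \<in> borel_measurable borel" "\<phi>' \<in> borel_measurable borel"
        using \<phi>c \<phi>'c by (auto intro!: borel_measurable_continuous_onI)
      have [measurable]: "F \<in> borel_measurable borel" using weak(1) by auto
      have "smean F t = smean (\<lambda>x. \<phi>' t * ?R x + \<phi> t * ?D x) t"
        by (rule smean_cong) (use t0 in \<open>auto simp: F_def\<close>)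
      also have "\<dots> = \<phi>' t * smean ?R t + \<phi> t * smean ?D t"
        by (simp add: smean_def)
      finally show ?thesis .
    qed
    have sF0: "smean F t = 0" if t: "t \<notin> {c..d}" "t > 0" for t
    proof -
      have "smean F t = (LINT x|(direction_measure :: 'a measure). 0)"
        unfolding smean_def
      proof (rule integral_cong_AE)
        show "(\<lambda>x. F (t *\<^sub>R sgn x)) \<in> borel_measurable direction_measure"
          using weak(1) by (intro borel_measurable_on_ray) auto
        show "AE x in direction_measure. F (t *\<^sub>R sgn x) = 0"
          using AE_direction_norm_sgn by eventually_elim (use \<phi>0[OF t(1)] t(2) in \<open>simp add: F_def\<close>)
      qed simp
      then show ?thesis by simp
    qed
    have "0 = (LINT r|lborel. real DIM('a) * ?V * r ^ ?N * indicator {0<..} r * smean F r)"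
      using integral_polar(2)[OF weak(1)] weak(2) by simp
    also have "\<dots> = (LINT r|lborel. real DIM('a) * ?V * (indicator {c..d} r *\<^sub>R Q r))"
    proof (rule Bochner_Integration.integral_cong[OF refl])
      fix t
      show "real DIM('a) * ?V * t ^ ?N * indicator {0<..} t * smean F t = real DIM('a) * ?V * (indicator {c..d} t *\<^sub>R Q t)"
        using sF[of t] sF0[of t] cd r by (auto simp: Q_def split: split_indicator)
    qed
    also have "\<dots> = real DIM('a) * ?V * set_lebesgue_integral lborel {c..d} Q"
      by (simp add: set_lebesgue_integral_def)
    also have "set_lebesgue_integral lborel {c..d} Q = integral {c..d} Q"
      unfolding Q_def by (intro set_borel_integral_eq_integral borel_integrable_atLeastAtMost' continuous_intros Rc Dc' \<phi>c continuous_on_subset[OF \<phi>'c]) auto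
    finally have "integral {c..d} Q = 0"
      using measure_punctured_ball_pos[where 'a='a] by simp
    then show "integral {c..d} (\<lambda>t. \<phi>' t * (t ^ ?N * smean ?R t) + \<phi> t * (t ^ ?N * smean ?D t)) = 0"
      by (simp add: Q_def[abs_def] algebra_simps)
  qed
qed

lemma mean_derivative:
  fixes u :: "'a::euclidean_space \<Rightarrow> real"
  assumes u: "C2_jet \<Omega> u g H" and \<Omega>: "open \<Omega>" "0 \<notin> \<Omega>"
    and sub: "{x. a < norm x \<and> norm x < b} \<subseteq> \<Omega>" and r: "0 \<le> a" "a < r" "r < b"
  shows "(smean (extend0 \<Omega> u) has_real_derivative smean (extend0 \<Omega> (\<lambda>x. g x \<bullet> sgn x)) r) (at r)"
proof (rule has_real_derivative_smean[OF _ _ _ r(1) _ _ r(2,3)])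
  show "extend0 \<Omega> u \<in> borel_measurable borel" "extend0 \<Omega> (\<lambda>x. g x \<bullet> sgn x) \<in> borel_measurable borel"
    by (auto intro!: borel_measurable_extend0 \<Omega>(1) C2_jet_continuous[OF u] continuous_on_radial_component[OF u \<Omega>(2)])
  show "continuous_on {x. a < norm x \<and> norm x < b} (extend0 \<Omega> (\<lambda>x. g x \<bullet> sgn x))"
    by (intro continuous_on_extend0 continuous_on_radial_component[OF u \<Omega>(2)] sub)
  fix x :: 'a assume "a < norm x" "norm x < b"
  then have x: "x \<in> \<Omega>" using sub by auto
  show "extend0 \<Omega> (\<lambda>x. g x \<bullet> sgn x) x = g x \<bullet> sgn x" using x by (simp add: extend0_def)
  show "(extend0 \<Omega> u has_derivative (\<lambda>h. g x \<bullet> h)) (at x)"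
    by (rule has_derivative_transform_within_open[OF _ \<Omega>(1) x]) (use u x in \<open>auto simp: C2_jet_def extend0_def\<close>)
qed

section \<open>A universal bound for the gradients of the means\<close>

lemma powr_above_tangent:
  fixes s t p :: real
  assumes "p \<ge> 1" "t > 0" "s \<ge> 0"
  shows "t powr p + p * t powr (p - 1) * (s - t) \<le> s powr p"
proof (cases "s = 0")
  case True
  have "t powr (p - 1) * t = t powr p" using assms powr_add[of t "p - 1" 1] by simp
  moreover have "t powr p + p * t powr (p - 1) * (s - t) = t powr p - p * (t powr (p - 1) * t)" using True by simp
  ultimately have "t powr p + p * t powr (p - 1) * (s - t) = (1 - p) * t powr p" by (simp only: left_diff_distrib mult_1)
  also have "\<dots> \<le> 0" using assms by (simp add: mult_nonpos_nonneg)
  finally show ?thesis using True by simp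
next
  case False
  have "p * t powr (p - 1) * (s - t) \<le> s powr p - t powr p"
  proof (rule convex_on_imp_above_tangent[OF powr_convex[OF assms(1)]])
    show "((\<lambda>x. x powr p) has_real_derivative p * t powr (p - 1)) (at t within {0<..})"
      by (rule has_field_derivative_at_within[OF has_real_derivative_powr[OF assms(2)]])
  qed (use assms False in \<open>auto simp: interior_open\<close>)
  then show ?thesis by simp
qed

text \<open>Jensen's inequality, obtained by averaging the tangent line of \<open>\<lambda>s. s powr p\<close> at the mean.\<close>

lemma powr_smean_le:
  fixes F :: "'a::euclidean_space \<Rightarrow> real"
  assumes F[measurable]: "F \<in> borel_measurable borel" and Fc: "continuous_on (sphere 0 r) F"
    and nn: "\<And>x. F x \<ge> 0" and p: "p \<ge> 1" and r: "0 \<le> r"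
  shows "smean F r powr p \<le> smean (\<lambda>x. F x powr p) r"
proof -
  have Fp: "continuous_on (sphere 0 r) (\<lambda>x. F x powr p)"
    by (rule continuous_on_powr'[OF Fc continuous_on_const]) (use nn p in auto)
  have t0: "smean F r \<ge> 0" unfolding smean_def using nn by (simp add: Bochner_Integration.integral_nonneg)
  show ?thesis
  proof (cases "smean F r = 0")
    case True
    have "smean (\<lambda>x. F x powr p) r \<ge> 0" unfolding smean_def by (simp add: Bochner_Integration.integral_nonneg)
    then show ?thesis using True by simp
  next
    case False
    define t where "t = smean F r"
    have t: "t > 0" using False t0 by (simp add: t_def)
    have iF: "integrable direction_measure (\<lambda>x. F (r *\<^sub>R sgn x))"
      by (rule integrable_on_sphere[OF F Fc r])
    have affine: "smean (\<lambda>x. c + d * (F x - t)) r = c" for c d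
      using iF direction.prob_space[where 'a='a] by (simp add: smean_def t_def)
    have "t powr p = smean (\<lambda>x. t powr p + p * t powr (p - 1) * (F x - t)) r"
      by (rule affine[symmetric])
    also have "\<dots> \<le> smean (\<lambda>x. F x powr p) r"
    proof (rule smean_mono[OF _ _ _ Fp r])
      show "continuous_on (sphere 0 r) (\<lambda>x. t powr p + p * t powr (p - 1) * (F x - t))"
        by (intro continuous_on_add continuous_on_mult continuous_on_diff continuous_on_const Fc)
      show "t powr p + p * t powr (p - 1) * (F x - t) \<le> F x powr p" for x
        by (rule powr_above_tangent[OF p t nn])
    qed measurable
    finally show ?thesis by (simp add: t_def)
  qed
qed

lemma abs_smean_radial_powr_le:
  fixes u :: "'a::euclidean_space \<Rightarrow> real"
  assumes u: "C2_jet \<Omega> u g H" and \<Omega>: "open \<Omega>" "0 \<notin> \<Omega>" and r: "0 \<le> r" "sphere 0 r \<subseteq> \<Omega>" and p: "p \<ge> 1"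
    and f: "continuous_on \<Omega> f" "\<And>x. x \<in> \<Omega> \<Longrightarrow> norm (g x) powr p \<le> f x"
  shows "\<bar>smean (extend0 \<Omega> (\<lambda>x. g x \<bullet> sgn x)) r\<bar> powr p \<le> smean (extend0 \<Omega> f) r"
proof -
  let ?R = "extend0 \<Omega> (\<lambda>x. g x \<bullet> sgn x)" and ?G = "extend0 \<Omega> (\<lambda>x. norm (g x))"
  have gc: "continuous_on \<Omega> (\<lambda>x. norm (g x))" by (intro continuous_intros C2_jet_continuous[OF u])
  note rc = continuous_on_radial_component[OF u \<Omega>(2)]
  have [measurable]: "?R \<in> borel_measurable borel" "?G \<in> borel_measurable borel" "extend0 \<Omega> f \<in> borel_measurable borel"
    by (rule borel_measurable_extend0[OF \<Omega>(1)], rule rc gc f(1))+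
  have cont: "continuous_on (sphere 0 r) ?R" "continuous_on (sphere 0 r) ?G" "continuous_on (sphere 0 r) (extend0 \<Omega> f)"
    by (intro continuous_on_extend0[OF _ r(2)] rc gc f)+
  have G_nn: "?G x \<ge> 0" for x by (simp add: extend0_def)
  have Gp: "continuous_on (sphere 0 r) (\<lambda>x. ?G x powr p)"
    by (rule continuous_on_powr'[OF cont(2) continuous_on_const]) (use G_nn p in auto)
  have "\<bar>smean ?R r\<bar> \<le> smean (\<lambda>x. \<bar>?R x\<bar>) r"
    unfolding smean_def by (rule integral_abs_bound)
  also have "\<dots> \<le> smean ?G r"
  proof (rule smean_mono[OF _ continuous_on_rabs[OF cont(1)] _ cont(2) r(1)])
    fix x :: 'a
    have "\<bar>g x \<bullet> sgn x\<bar> \<le> norm (g x) * norm (sgn x)" by (rule Cauchy_Schwarz_ineq2)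
    also have "\<dots> \<le> norm (g x)" by (simp add: norm_sgn)
    finally show "\<bar>?R x\<bar> \<le> ?G x" by (simp add: extend0_def)
  qed simp_all
  finally have "\<bar>smean ?R r\<bar> \<le> smean ?G r" .
  then have "\<bar>smean ?R r\<bar> powr p \<le> smean ?G r powr p"
    by (rule powr_mono2[OF order_trans[OF zero_le_one p] abs_ge_zero])
  also have "\<dots> \<le> smean (\<lambda>x. ?G x powr p) r"
    by (rule powr_smean_le[OF _ cont(2) G_nn p r(1)]) simp
  also have "\<dots> \<le> smean (extend0 \<Omega> f) r"
  proof (rule smean_mono[OF _ Gp _ cont(3) r(1)])
    show "?G x powr p \<le> extend0 \<Omega> f x" if "norm x = r" for x
    proof -
      have "x \<in> \<Omega>" using that r(2) by auto
      then show ?thesis using f(2) by (simp add: extend0_def)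
    qed
  qed measurable
  finally show ?thesis .
qed

text \<open>A nonnegative continuous function with zero mean vanishes for almost every direction. If it were
positive somewhere, the directions with this property would form a nonempty open set.\<close>

lemma smean_eq_0_imp_eq_0:
  fixes F :: "'a::euclidean_space \<Rightarrow> real"
  assumes F[measurable]: "F \<in> borel_measurable borel" and Fc: "continuous_on (sphere 0 r) F"
    and nn: "\<And>x. F x \<ge> 0" and r: "0 < r" and zero: "smean F r = 0" and y: "norm y = r"
  shows "F y = 0"
proof (rule ccontr)
  assume Fy: "F y \<noteq> 0"
  have "integrable direction_measure (\<lambda>x. F (r *\<^sub>R sgn x))"
    by (rule integrable_on_sphere[OF F Fc]) (use r in simp)
  then have "AE x in (direction_measure :: 'a measure). F (r *\<^sub>R sgn x) = 0"
    using zero nn by (simp add: smean_def integral_nonneg_eq_0_iff_AE)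
  then have ae: "AE x in lborel. x \<in> punctured_ball \<longrightarrow> F (r *\<^sub>R sgn x) = 0"
    unfolding direction_measure_def
    by (subst (asm) AE_uniform_measure) (use emeasure_punctured_ball_finite emeasure_punctured_ball_nonzero in \<open>auto simp: less_top[symmetric] zero_less_iff_neq_zero\<close>)
  let ?S = "punctured_ball \<inter> (\<lambda>x. F (r *\<^sub>R sgn x)) -` (- {0})"
  have "continuous_on punctured_ball (\<lambda>x::'a. F (r *\<^sub>R sgn x))"
  proof (rule continuous_on_compose2[OF Fc])
    show "continuous_on punctured_ball (\<lambda>x::'a. r *\<^sub>R sgn x)"
      by (intro continuous_intros) (simp add: punctured_ball_def)
    show "(\<lambda>x::'a. r *\<^sub>R sgn x) ` punctured_ball \<subseteq> sphere 0 r"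
      using r by (simp add: punctured_ball_def image_subset_iff norm_sgn)
  qed
  then have "open ?S"
    by (rule continuous_open_preimage) (auto simp: punctured_ball_def)
  moreover have "?S \<noteq> {}"
  proof -
    have "y \<noteq> 0" using y r by auto
    then have "r *\<^sub>R sgn ((1/2) *\<^sub>R sgn y) = y" using y r
      by (simp add: sgn_scaleR) (simp add: sgn_div_norm)
    then have "(1/2) *\<^sub>R sgn y \<in> ?S" using Fy \<open>y \<noteq> 0\<close>
      by (simp add: punctured_ball_def norm_sgn sgn_zero_iff)
    then show ?thesis by blast
  qed
  moreover have "?S \<in> null_sets lebesgue"
  proof -
    have "{x \<in> space lborel. \<not> (x \<in> punctured_ball \<longrightarrow> F (r *\<^sub>R sgn x) = 0)} = ?S" by auto
    moreover have "?S \<in> sets lborel" using \<open>open ?S\<close> by simp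
    ultimately have "?S \<in> null_sets lborel" using ae by (subst (asm) AE_iff_null) auto
    then show ?thesis by (rule null_sets_completionI)
  qed
  ultimately show False using open_not_negligible negligible_iff_null_sets by blast
qed

text \<open>The common form of both problems: a subsolution of the absorption system satisfies these
inequalities itself, a supersolution of the other system after a change of sign of both components.\<close>

definition gradient_inequalities ::
    "real \<Rightarrow> real \<Rightarrow> 'a::euclidean_space set \<Rightarrow> ('a \<Rightarrow> real) \<Rightarrow> ('a \<Rightarrow> 'a) \<Rightarrow> ('a \<Rightarrow> 'a \<Rightarrow> 'a) \<Rightarrow>
      ('a \<Rightarrow> real) \<Rightarrow> ('a \<Rightarrow> 'a) \<Rightarrow> ('a \<Rightarrow> 'a \<Rightarrow> 'a) \<Rightarrow> bool" where
  "gradient_inequalities p q \<Omega> u1 g1 H1 u2 g2 H2 \<longleftrightarrow>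
     C2_jet \<Omega> u1 g1 H1 \<and> C2_jet \<Omega> u2 g2 H2 \<and>
     (\<forall>x\<in>\<Omega>. norm (g2 x) powr p \<le> operator_trace (H1 x) \<and> norm (g1 x) powr q \<le> operator_trace (H2 x))"

lemma gradient_inequalities_commute:
  "gradient_inequalities p q \<Omega> u1 g1 H1 u2 g2 H2 \<longleftrightarrow> gradient_inequalities q p \<Omega> u2 g2 H2 u1 g1 H1"
  by (auto simp: gradient_inequalities_def)

lemma gradient_inequalities_subset:
  "gradient_inequalities p q \<Omega> u1 g1 H1 u2 g2 H2 \<Longrightarrow> S \<subseteq> \<Omega> \<Longrightarrow> gradient_inequalities p q S u1 g1 H1 u2 g2 H2"
  by (auto simp: gradient_inequalities_def intro: C2_jet_subset)

text \<open>The value \<open>D\<close> is the mean of the Laplacian of \<open>u1\<close>.\<close>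

lemma radial_flux_inequality:
  fixes u1 :: "'a::euclidean_space \<Rightarrow> real"
  assumes sys: "gradient_inequalities p q \<Omega> u1 g1 H1 u2 g2 H2" and \<Omega>: "open \<Omega>" "0 \<notin> \<Omega>"
    and sub: "{x. a < norm x \<and> norm x < b} \<subseteq> \<Omega>" and r: "0 \<le> a" "a < r" "r < b" and p: "p \<ge> 1"
  obtains D where
    "((\<lambda>r. r ^ (DIM('a) - 1) * smean (extend0 \<Omega> (\<lambda>x. g1 x \<bullet> sgn x)) r) has_real_derivative
      r ^ (DIM('a) - 1) * D) (at r)"
    "\<bar>smean (extend0 \<Omega> (\<lambda>x. g2 x \<bullet> sgn x)) r\<bar> powr p \<le> D"
proof (rule that)
  have u: "C2_jet \<Omega> u1 g1 H1" "C2_jet \<Omega> u2 g2 H2" using sys by (auto simp: gradient_inequalities_def)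
  show "((\<lambda>r. r ^ (DIM('a) - 1) * smean (extend0 \<Omega> (\<lambda>x. g1 x \<bullet> sgn x)) r) has_real_derivative
      r ^ (DIM('a) - 1) * smean (extend0 \<Omega> (\<lambda>x. operator_trace (H1 x))) r) (at r)"
    by (rule radial_flux_derivative[OF u(1) \<Omega> sub r])
  show "\<bar>smean (extend0 \<Omega> (\<lambda>x. g2 x \<bullet> sgn x)) r\<bar> powr p \<le> smean (extend0 \<Omega> (\<lambda>x. operator_trace (H1 x))) r"
    by (rule abs_smean_radial_powr_le[OF u(2) \<Omega>])
       (use r sub p sys C2_jet_continuous[OF u(1)] in \<open>auto simp: gradient_inequalities_def\<close>)
qed

text \<open>The homogeneity that makes the bound of the next lemma universal: with \<open>\<rho> = r / R\<close> the scaled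
fluxes satisfy a system whose constant \<open>c\<close> does not depend on \<open>R\<close>. The condition \<open>e1 + 1 = p * e2\<close>,
together with its mirror image, determines the exponents \<open>e1 = (1 + p) / (p * q - 1)\<close>
and \<open>e2 = (1 + q) / (p * q - 1)\<close>.\<close>

lemma scaled_inequality:
  fixes R \<rho> S D p e1 e2 :: real and n :: nat
  assumes "R > 0" "0 < \<rho>" "\<rho> \<le> 3/2" "p \<ge> 1" "\<bar>S\<bar> powr p \<le> D" "e1 + 1 = p * e2"
    and c: "0 \<le> c" "c \<le> (3/2) powr (real n * (1 - p)) / 2"
  shows "c * \<bar>R powr e2 * \<rho> ^ n * S\<bar> powr p \<le> R powr e1 * \<rho> ^ n * (R / 2) * D"
proof -
  have "c * \<bar>R powr e2 * \<rho> ^ n * S\<bar> powr p = c * \<rho> powr (real n * p) * (R powr (e1 + 1) * \<bar>S\<bar> powr p)"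
    using assms(1,2) unfolding assms(6)
    by (simp add: abs_mult powr_mult powr_powr powr_realpow[symmetric] mult_ac)
  also have "\<dots> \<le> \<rho> powr real n / 2 * (R powr (e1 + 1) * D)"
  proof (rule mult_mono)
    have "(3/2) powr (real n * (1 - p)) \<le> \<rho> powr (real n * (1 - p))"
      using assms by (intro powr_mono2') (auto simp: mult_nonneg_nonpos)
    then have "c * \<rho> powr (real n * p) \<le> \<rho> powr (real n * (1 - p)) / 2 * \<rho> powr (real n * p)"
      using c by (intro mult_right_mono) auto
    also have "\<dots> = \<rho> powr real n / 2"
      using assms by (simp add: powr_add[symmetric] algebra_simps)
    finally show "c * \<rho> powr (real n * p) \<le> \<rho> powr real n / 2" .
    show "R powr (e1 + 1) * \<bar>S\<bar> powr p \<le> R powr (e1 + 1) * D"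
      using assms by (intro mult_left_mono) auto
  qed (use assms in auto)
  also have "\<dots> = R powr e1 * \<rho> ^ n * (R / 2) * D"
    using assms(1,2) by (simp add: powr_add powr_realpow[symmetric])
  finally show ?thesis .
qed

text \<open>The fluxes, considered as functions of \<open>s\<close> with \<open>r = R * (1 + s / 2)\<close> and multiplied by suitable powers
of \<open>R\<close>, form a superlinear pair on \<open>{-1..1}\<close>; the Keller-Osserman bound at \<open>s = 0\<close> is the claim.\<close>

lemma mean_gradient_estimate:
  fixes p q :: real
  assumes pq: "p \<ge> 1" "q \<ge> 1" "p * q > 1"
  shows "\<exists>K>0. \<forall>\<Omega> (u1 :: 'a::euclidean_space \<Rightarrow> real) g1 H1 u2 g2 H2 R.
    gradient_inequalities p q \<Omega> u1 g1 H1 u2 g2 H2 \<longrightarrow> open \<Omega> \<longrightarrow> 0 \<notin> \<Omega> \<longrightarrow> R > 0 \<longrightarrow>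
    {x. R / 4 < norm x \<and> norm x < 2 * R} \<subseteq> \<Omega> \<longrightarrow>
    \<bar>smean (extend0 \<Omega> (\<lambda>x. g1 x \<bullet> sgn x)) R\<bar> \<le> K * R powr (- ((1 + p) / (p * q - 1)))"
proof -
  define n where "n = DIM('a) - 1"
  \<comment> \<open>\<open>3/2\<close> is the largest value of \<open>r / R\<close> for \<open>s\<close> in \<open>{-1..1}\<close>.\<close>
  define cf where "cf p = (3/2) powr (real n * (1 - p)) / 2" for p :: real
  define c where "c = min (cf p) (cf q)"
  have c: "c > 0" "c \<le> cf p" "c \<le> cf q" by (auto simp: c_def cf_def)
  obtain K where K: "K > 0" and KO: "\<And>w1 w2. superlinear_pair c p q {-1..1} w1 w2 \<Longrightarrow> \<bar>w1 0\<bar> \<le> K"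
    using keller_osserman[of p q c] pq c by auto
  define e1 where "e1 = (1 + p) / (p * q - 1)"
  define e2 where "e2 = (1 + q) / (p * q - 1)"
  have e: "e1 + 1 = p * e2" "e2 + 1 = q * e1"
    using pq by (simp_all add: e1_def e2_def add_divide_eq_iff algebra_simps)
  show ?thesis
  proof (intro exI[of _ K] conjI allI impI)
    show "K > 0" by (rule K)
    fix \<Omega> and u1 :: "'a \<Rightarrow> real" and g1 H1 u2 g2 H2 and R :: real
    assume sys: "gradient_inequalities p q \<Omega> u1 g1 H1 u2 g2 H2" and \<Omega>: "open \<Omega>" "0 \<notin> \<Omega>" and R: "R > 0"
      and sub: "{x. R / 4 < norm x \<and> norm x < 2 * R} \<subseteq> \<Omega>"
    define S1 where "S1 = smean (extend0 \<Omega> (\<lambda>x. g1 x \<bullet> sgn x))"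
    define S2 where "S2 = smean (extend0 \<Omega> (\<lambda>x. g2 x \<bullet> sgn x))"
    define v where "v e S s = R powr e / R ^ n * ((R * (1 + s / 2)) ^ n * S (R * (1 + s / 2)))" for e S and s :: real
    have v: "v e S s = R powr e * (1 + s / 2) ^ n * S (R * (1 + s / 2))" for e S s
      using R by (simp add: v_def power_mult_distrib)
    have v': "(v e S has_real_derivative R powr e * (1 + s / 2) ^ n * (R / 2) * D) (at s)"
      if "((\<lambda>r. r ^ n * S r) has_real_derivative (R * (1 + s / 2)) ^ n * D) (at (R * (1 + s / 2)))" for e S s D
    proof -
      have 1: "((\<lambda>s. R * (1 + s / 2)) has_real_derivative R / 2) (at s)"
        by (auto intro!: derivative_eq_intros)
      have "((\<lambda>s. (R * (1 + s / 2)) ^ n * S (R * (1 + s / 2))) has_real_derivative (R * (1 + s / 2)) ^ n * D * (R / 2)) (at s)"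
        by (rule DERIV_chain2[OF that 1])
      from DERIV_cmult[OF this, of "R powr e / R ^ n"] show ?thesis
        unfolding v_def[abs_def] by (rule DERIV_cong) (use R in \<open>simp add: power_mult_distrib\<close>)
    qed
    have "superlinear_pair c p q {-1..1} (v e1 S1) (v e2 S2)"
      unfolding superlinear_pair_def
    proof (intro ballI conjI)
      fix s :: real assume s: "s \<in> {-1..1}"
      let ?r = "R * (1 + s / 2)"
      have r: "R / 4 < ?r" "?r < 2 * R"
        using s mult_strict_left_mono[OF _ R, of "1/4" "1 + s / 2"] mult_strict_left_mono[OF _ R, of "1 + s / 2" 2]
        by (simp_all add: mult.commute)
      have \<rho>: "0 < 1 + s / 2" "1 + s / 2 \<le> 3/2" using s by auto
      note flux = radial_flux_inequality[OF _ \<Omega> sub _ r]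
      obtain D where D: "((\<lambda>r. r ^ n * S1 r) has_real_derivative ?r ^ n * D) (at ?r)" "\<bar>S2 ?r\<bar> powr p \<le> D"
        using flux[OF sys] R pq unfolding n_def S1_def S2_def by auto
      show "\<exists>d. (v e1 S1 has_real_derivative d) (at s) \<and> c * \<bar>v e2 S2 s\<bar> powr p \<le> d"
      proof (intro exI conjI)
        show "(v e1 S1 has_real_derivative R powr e1 * (1 + s / 2) ^ n * (R / 2) * D) (at s)"
          by (rule v'[OF D(1)])
        show "c * \<bar>v e2 S2 s\<bar> powr p \<le> R powr e1 * (1 + s / 2) ^ n * (R / 2) * D"
          unfolding v by (rule scaled_inequality[OF R \<rho> pq(1) D(2) e(1)]) (use c in \<open>simp_all add: cf_def\<close>)
      qed
      obtain D where D: "((\<lambda>r. r ^ n * S2 r) has_real_derivative ?r ^ n * D) (at ?r)" "\<bar>S1 ?r\<bar> powr q \<le> D"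
        using flux[OF sys[THEN gradient_inequalities_commute[THEN iffD1]]] R pq unfolding n_def S1_def S2_def by auto
      show "\<exists>d. (v e2 S2 has_real_derivative d) (at s) \<and> c * \<bar>v e1 S1 s\<bar> powr q \<le> d"
      proof (intro exI conjI)
        show "(v e2 S2 has_real_derivative R powr e2 * (1 + s / 2) ^ n * (R / 2) * D) (at s)"
          by (rule v'[OF D(1)])
        show "c * \<bar>v e1 S1 s\<bar> powr q \<le> R powr e2 * (1 + s / 2) ^ n * (R / 2) * D"
          unfolding v by (rule scaled_inequality[OF R \<rho> pq(2) D(2) e(2)]) (use c in \<open>simp_all add: cf_def\<close>)
      qed
    qed
    from KO[OF this] have "R powr e1 * \<bar>S1 R\<bar> \<le> K" by (simp add: v abs_mult)
    then have "\<bar>S1 R\<bar> \<le> K * R powr (- e1)"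
      using R by (simp add: powr_minus field_simps)
    then show "\<bar>smean (extend0 \<Omega> (\<lambda>x. g1 x \<bullet> sgn x)) R\<bar> \<le> K * R powr (- ((1 + p) / (p * q - 1)))"
      by (simp add: S1_def e1_def)
  qed
qed

section \<open>Supersolutions and subsolutions\<close>

text \<open>The gradient is defined by a definite description; its existence comes from the adjoint of the
derivative.\<close>

lemma gradient_works:
  fixes u :: "'a::euclidean_space \<Rightarrow> real"
  assumes "u differentiable (at x)"
  shows "(u has_derivative (\<lambda>h. gradient u x \<bullet> h)) (at x)"
proof -
  obtain f where f: "(u has_derivative f) (at x)" using assms by (auto simp: differentiable_def)
  define w where "w = adjoint f 1"
  have "f = (\<lambda>h. h \<bullet> w)"
    using adjoint_works[OF has_derivative_linear[OF f], of _ 1] by (simp add: w_def fun_eq_iff)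
  then have G: "GDERIV u x :> w" using f by (simp add: gderiv_def)
  have "GDERIV u x :> gradient u x"
    unfolding gradient_def
  proof (rule theI[of _ w])
    fix D assume "GDERIV u x :> D"
    then have "(\<lambda>h. h \<bullet> D) = (\<lambda>h. h \<bullet> w)"
      using G unfolding gderiv_def by (rule has_derivative_unique)
    then have "(D - w) \<bullet> (D - w) = 0" by (metis cancel_comm_monoid_add_class.diff_cancel inner_diff_right)
    then show "D = w" by simp
  qed (rule G)
  then show ?thesis by (simp add: gderiv_def inner_commute)
qed

lemma C2_on_imp_C2_jet:
  assumes "C2_on \<Omega> u"
  shows "C2_jet \<Omega> u (gradient u) (\<lambda>x. frechet_derivative (gradient u) (at x))"
  using assms unfolding C2_on_def C2_jet_def
  by (auto intro: gradient_works simp: frechet_derivative_works[symmetric])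

lemma laplacian_eq_operator_trace: "laplacian u x = operator_trace (frechet_derivative (gradient u) (at x))"
  by (simp add: laplacian_def operator_trace_def)

lemma absorption_subsolution_imp_gradient_inequalities:
  assumes "absorption_subsolution p q \<Omega> u1 u2"
  obtains g1 H1 g2 H2 where "gradient_inequalities p q \<Omega> u1 g1 H1 u2 g2 H2"
  using assms
  by (intro that[of "gradient u1" "\<lambda>x. frechet_derivative (gradient u1) (at x)" "gradient u2" "\<lambda>x. frechet_derivative (gradient u2) (at x)"])
     (auto simp: gradient_inequalities_def absorption_subsolution_def laplacian_eq_operator_trace[symmetric] C2_on_imp_C2_jet)

lemma supersolution_imp_gradient_inequalities:
  assumes "supersolution p q \<Omega> u1 u2"
  obtains g1 H1 g2 H2 where "gradient_inequalities p q \<Omega> (\<lambda>x. - u1 x) g1 H1 (\<lambda>x. - u2 x) g2 H2"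
proof (rule that)
  have tr: "operator_trace (\<lambda>h. - A h) = - operator_trace A" for A :: "'a \<Rightarrow> 'a" by (simp add: operator_trace_def sum_negf)
  show "gradient_inequalities p q \<Omega> (\<lambda>x. - u1 x) (\<lambda>x. - gradient u1 x) (\<lambda>x h. - frechet_derivative (gradient u1) (at x) h)
     (\<lambda>x. - u2 x) (\<lambda>x. - gradient u2 x) (\<lambda>x h. - frechet_derivative (gradient u2) (at x) h)"
    using assms
    by (auto simp: gradient_inequalities_def supersolution_def tr laplacian_eq_operator_trace[symmetric] intro!: C2_jet_uminus C2_on_imp_C2_jet)
qed

section \<open>Growth of the spherical means\<close>

text \<open>An antiderivative of \<open>s powr (- (k + 1))\<close>.\<close>

definition power_primitive :: "real \<Rightarrow> real \<Rightarrow> real" where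
  "power_primitive k s = (if k = 0 then ln s else - (s powr (- k) / k))"

lemma power_primitive_deriv:
  assumes "s > 0"
  shows "(power_primitive k has_real_derivative s powr (- (k + 1))) (at s)"
proof (cases "k = 0")
  case True
  then have "power_primitive k = ln" by (simp add: power_primitive_def fun_eq_iff)
  then show ?thesis using True assms DERIV_ln[OF assms] by (simp add: powr_minus)
next
  case False
  have "((\<lambda>s. - (s powr (- k) / k)) has_real_derivative - ((- k) * s powr (- k - 1) / k)) (at s)"
    by (intro DERIV_minus DERIV_cdivide has_real_derivative_powr assms)
  moreover have "power_primitive k = (\<lambda>s. - (s powr (- k) / k))" using False by (simp add: power_primitive_def fun_eq_iff)
  ultimately show ?thesis using False by simp
qed

lemma abs_diff_le_power_primitive:
  assumes ab: "0 < a" "a \<le> b"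
    and f: "\<And>s. a \<le> s \<Longrightarrow> s \<le> b \<Longrightarrow> \<exists>d. (f has_real_derivative d) (at s) \<and> \<bar>d\<bar> \<le> K * s powr (- (k + 1))"
  shows "\<bar>f b - f a\<bar> \<le> K * (power_primitive k b - power_primitive k a)"
proof -
  have "\<sigma> * (f b - f a) \<le> K * (power_primitive k b - power_primitive k a)" if \<sigma>: "\<sigma> = 1 \<or> \<sigma> = -1" for \<sigma> :: real
  proof -
    have "K * power_primitive k a - \<sigma> * f a \<le> K * power_primitive k b - \<sigma> * f b"
    proof (rule DERIV_nonneg_imp_nondecreasing[OF ab(2)])
      fix s assume s: "a \<le> s" "s \<le> b"
      then obtain d where d: "(f has_real_derivative d) (at s)" "\<bar>d\<bar> \<le> K * s powr (- (k + 1))" using f by blast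
      have "s > 0" using s ab by simp
      have "((\<lambda>s. K * power_primitive k s - \<sigma> * f s) has_real_derivative K * s powr (- (k + 1)) - \<sigma> * d) (at s)"
        by (intro DERIV_diff DERIV_cmult power_primitive_deriv d \<open>s > 0\<close>)
      moreover have "0 \<le> K * s powr (- (k + 1)) - \<sigma> * d" using d(2) \<sigma> by auto
      ultimately show "\<exists>y. ((\<lambda>s. K * power_primitive k s - \<sigma> * f s) has_real_derivative y) (at s) \<and> 0 \<le> y" by blast
    qed
    then show ?thesis by (simp add: algebra_simps)
  qed
  from this[of 1] this[of "-1"] show ?thesis by auto
qed

abbreviation growth_exponent :: "real \<Rightarrow> real \<Rightarrow> real" where
  "growth_exponent p q \<equiv> (2 - p * (q - 1)) / (p * q - 1)"

lemma growth_ge_1: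
  assumes "1 \<le> \<bar>ln r\<bar>"
  shows "1 \<le> growth p q r"
  using assms by (auto simp: growth_def)

lemma abs_power_primitive_le_growth:
  assumes "p * q > 1"
  shows "\<bar>power_primitive (growth_exponent p q) r\<bar> \<le> (1 / \<bar>growth_exponent p q\<bar> + 1) * growth p q r"
proof (cases "p * (q - 1) = 2")
  case True
  then show ?thesis by (simp add: power_primitive_def growth_def)
next
  case False
  define k where "k = growth_exponent p q"
  have k: "k \<noteq> 0" using False assms by (auto simp: k_def)
  have "\<bar>power_primitive k r\<bar> = 1 / \<bar>k\<bar> * r powr (- k)" using k by (simp add: power_primitive_def)
  also have "\<dots> \<le> (1 / \<bar>k\<bar> + 1) * growth p q r"
    by (rule mult_mono) (use False in \<open>auto simp: growth_def k_def\<close>)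
  finally show ?thesis by (simp add: k_def)
qed

text \<open>The exponent \<open>(1 + p) / (p * q - 1)\<close> is one more than the exponent in \<open>growth\<close>, so an antiderivative of
the bound is a multiple of \<open>growth p q\<close> up to a constant. Where \<open>\<bar>ln r\<bar> \<ge> 1\<close>, constants are bounded
by multiples of \<open>growth p q r\<close> as well.\<close>

lemma growth_bound_of_derivative_bound:
  assumes pq: "p * q > 1" and S: "is_interval S" "S \<subseteq> {0<..}" "S \<noteq> {}" and ln: "\<And>r. r \<in> S \<Longrightarrow> 1 \<le> \<bar>ln r\<bar>"
    and K: "K \<ge> 0"
    and f: "\<And>r. r \<in> S \<Longrightarrow> \<exists>d. (f has_real_derivative d) (at r) \<and> \<bar>d\<bar> \<le> K * r powr (- ((1 + p) / (p * q - 1)))"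
  shows "\<exists>C>0. \<forall>r\<in>S. \<bar>f r\<bar> \<le> C * growth p q r"
proof -
  define k where "k = growth_exponent p q"
  have k1: "(1 + p) / (p * q - 1) = k + 1" using pq by (simp add: k_def field_simps)
  obtain s0 where s0: "s0 \<in> S" using S(3) by blast
  define E where "E = 1 / \<bar>k\<bar> + 1"
  define C where "C = \<bar>f s0\<bar> + K * \<bar>power_primitive k s0\<bar> + K * E + 1"
  have E: "E > 0" by (simp add: E_def add_nonneg_pos)
  have "C > 0" using K E unfolding C_def by (intro add_nonneg_pos add_nonneg_nonneg mult_nonneg_nonneg) auto
  have diff: "\<bar>f b - f a\<bar> \<le> K * (power_primitive k b - power_primitive k a)" if "a \<in> S" "b \<in> S" "a \<le> b" for a b
  proof (rule abs_diff_le_power_primitive[OF _ that(3)])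
    show "0 < a" using that S by auto
    fix s assume "a \<le> s" "s \<le> b"
    then have "s \<in> S" using S(1) that by (meson mem_is_interval_1_I)
    then show "\<exists>d. (f has_real_derivative d) (at s) \<and> \<bar>d\<bar> \<le> K * s powr (- (k + 1))" using f k1 by simp
  qed
  have "\<bar>f r\<bar> \<le> C * growth p q r" if r: "r \<in> S" for r
  proof -
    have g: "1 \<le> growth p q r" by (rule growth_ge_1[OF ln[OF r]])
    have "\<bar>f r - f s0\<bar> \<le> K * (\<bar>power_primitive k r\<bar> + \<bar>power_primitive k s0\<bar>)"
    proof (cases "r \<le> s0")
      case True
      have "K * (power_primitive k s0 - power_primitive k r) \<le> K * (\<bar>power_primitive k r\<bar> + \<bar>power_primitive k s0\<bar>)"
        using K by (intro mult_left_mono) auto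
      with diff[OF r s0 True] show ?thesis by linarith
    next
      case False
      have "K * (power_primitive k r - power_primitive k s0) \<le> K * (\<bar>power_primitive k r\<bar> + \<bar>power_primitive k s0\<bar>)"
        using K by (intro mult_left_mono) auto
      with diff[OF s0 r] False show ?thesis by linarith
    qed
    then have "\<bar>f r\<bar> \<le> \<bar>f s0\<bar> + K * \<bar>power_primitive k s0\<bar> + K * \<bar>power_primitive k r\<bar>"
      by (simp add: algebra_simps)
    also have "\<dots> \<le> (\<bar>f s0\<bar> + K * \<bar>power_primitive k s0\<bar>) * growth p q r + K * (E * growth p q r)"
    proof (intro add_mono mult_left_mono)
      have "0 \<le> \<bar>f s0\<bar> + K * \<bar>power_primitive k s0\<bar>" using K by simp
      from mult_left_mono[OF g this]
      show "\<bar>f s0\<bar> + K * \<bar>power_primitive k s0\<bar> \<le> (\<bar>f s0\<bar> + K * \<bar>power_primitive k s0\<bar>) * growth p q r" by simp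
      show "\<bar>power_primitive k r\<bar> \<le> E * growth p q r"
        using abs_power_primitive_le_growth[OF pq] by (simp add: k_def E_def)
    qed (rule K)
    also have "\<dots> \<le> C * growth p q r" using g by (simp add: C_def algebra_simps)
    finally show ?thesis .
  qed
  then show ?thesis using \<open>C > 0\<close> by blast
qed

lemma mean_growth_single:
  fixes u1 :: "'a::euclidean_space \<Rightarrow> real"
  assumes pq: "p \<ge> 1" "q \<ge> 1" "p * q > 1"
    and sys: "gradient_inequalities p q \<Omega> u1 g1 H1 u2 g2 H2" and \<Omega>: "open \<Omega>" "0 \<notin> \<Omega>"
    and S: "is_interval S" "S \<subseteq> {0<..}" "S \<noteq> {}"
    and SR: "\<And>R. R \<in> S \<Longrightarrow> 1 \<le> \<bar>ln R\<bar> \<and> {x. R / 4 < norm x \<and> norm x < 2 * R} \<subseteq> \<Omega>"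
  shows "\<exists>C>0. \<forall>r\<in>S. \<bar>smean (extend0 \<Omega> u1) r\<bar> \<le> C * growth p q r"
proof -
  obtain K where K: "K > 0" and est: "\<And>R. R > 0 \<Longrightarrow> {x. R / 4 < norm x \<and> norm x < 2 * R} \<subseteq> \<Omega> \<Longrightarrow>
    \<bar>smean (extend0 \<Omega> (\<lambda>x. g1 x \<bullet> sgn x)) R\<bar> \<le> K * R powr (- ((1 + p) / (p * q - 1)))"
    using mean_gradient_estimate[OF pq, where 'a='a] sys \<Omega> by blast
  show ?thesis
  proof (rule growth_bound_of_derivative_bound[OF pq(3) S])
    fix r assume r: "r \<in> S"
    then have r0: "r > 0" using S by auto
    show "1 \<le> \<bar>ln r\<bar>" using SR[OF r] by blast
    have "(smean (extend0 \<Omega> u1) has_real_derivative smean (extend0 \<Omega> (\<lambda>x. g1 x \<bullet> sgn x)) r) (at r)"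
      by (rule mean_derivative[OF _ \<Omega> conjunct2[OF SR[OF r]]]) (use sys r0 in \<open>auto simp: gradient_inequalities_def\<close>)
    moreover note est[OF r0 conjunct2[OF SR[OF r]]]
    ultimately show "\<exists>d. (smean (extend0 \<Omega> u1) has_real_derivative d) (at r) \<and> \<bar>d\<bar> \<le> K * r powr (- ((1 + p) / (p * q - 1)))"
      by blast
  qed (use K in auto)
qed

lemma mean_growth:
  fixes u1 :: "'a::euclidean_space \<Rightarrow> real"
  assumes pq: "p \<ge> 1" "q \<ge> 1" "p * q > 1"
    and sys: "gradient_inequalities p q \<Omega> u1 g1 H1 u2 g2 H2" and \<Omega>: "open \<Omega>" "0 \<notin> \<Omega>"
    and S: "is_interval S" "S \<subseteq> {0<..}" "S \<noteq> {}"
    and SR: "\<And>R. R \<in> S \<Longrightarrow> 1 \<le> \<bar>ln R\<bar> \<and> {x. R / 4 < norm x \<and> norm x < 2 * R} \<subseteq> \<Omega>"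
  shows "\<exists>C>0. \<forall>r\<in>S. \<bar>smean (extend0 \<Omega> u1) r\<bar> \<le> C * growth p q r \<and> \<bar>smean (extend0 \<Omega> u2) r\<bar> \<le> C * growth q p r"
proof -
  obtain C1 where C1: "C1 > 0" "\<And>r. r \<in> S \<Longrightarrow> \<bar>smean (extend0 \<Omega> u1) r\<bar> \<le> C1 * growth p q r"
    using mean_growth_single[OF pq sys \<Omega> S SR] by blast
  have "q * p > 1" using pq(3) by (simp add: mult.commute)
  then obtain C2 where C2: "C2 > 0" "\<And>r. r \<in> S \<Longrightarrow> \<bar>smean (extend0 \<Omega> u2) r\<bar> \<le> C2 * growth q p r"
    using mean_growth_single[OF pq(2,1) _ sys[THEN gradient_inequalities_commute[THEN iffD1]] \<Omega> S SR] by blast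
  have "\<bar>smean (extend0 \<Omega> u1) r\<bar> \<le> (C1 + C2) * growth p q r \<and> \<bar>smean (extend0 \<Omega> u2) r\<bar> \<le> (C1 + C2) * growth q p r"
    if r: "r \<in> S" for r
  proof -
    have "C1 * growth p q r \<le> (C1 + C2) * growth p q r" "C2 * growth q p r \<le> (C1 + C2) * growth q p r"
      using growth_ge_1[of r p q] growth_ge_1[of r q p] SR[OF r] C1(1) C2(1) by (auto intro!: mult_right_mono)
    then show ?thesis using C1(2)[OF r] C2(2)[OF r] by linarith
  qed
  then show ?thesis using C1(1) C2(1) by (intro exI[of _ "C1 + C2"]) auto
qed

text \<open>This is an inequality and not an equation because the integrand in \<open>sphere_mean\<close> may fail to be
measurable off the unit sphere, through the values of \<open>u\<close> outside \<open>\<Omega>\<close>; its integral is then zero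
by convention.\<close>

lemma abs_sphere_mean_le:
  fixes u :: "'a::euclidean_space \<Rightarrow> real"
  assumes u: "continuous_on \<Omega> u" and \<Omega>: "open \<Omega>" and r: "0 \<le> r" "sphere 0 r \<subseteq> \<Omega>"
  shows "\<bar>sphere_mean u r\<bar> \<le> \<bar>smean (extend0 \<Omega> u) r\<bar>"
proof (cases "integrable (unit_sphere_measure :: 'a measure) (\<lambda>\<omega>. u (r *\<^sub>R \<omega>))")
  case False
  then show ?thesis by (simp add: sphere_mean_def not_integrable_integral_eq)
next
  case True
  let ?B = "ball (0::'a) 1 - {0}" and ?V = "measure lborel (punctured_ball :: 'a set)"
  let ?P0 = "restrict_space lborel ?B" and ?D = "distr (restrict_space lborel ?B) borel sgn"
  have V: "?V > 0" by (rule measure_punctured_ball_pos)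
  have pb: "?B = punctured_ball" by (simp add: punctured_ball_def)
  have [measurable]: "sgn \<in> borel_measurable ?P0" by (rule measurable_restrict_space1) simp
  define f where "f \<omega> = u (r *\<^sub>R \<omega>)" for \<omega>
  have sets_D: "sets (unit_sphere_measure :: 'a measure) = sets borel" by (simp add: unit_sphere_measure_def)
  have [measurable]: "f \<in> borel_measurable borel"
    using borel_measurable_integrable[OF True] unfolding f_def[abs_def]
    by (subst measurable_cong_sets[OF sets_D[symmetric] refl])
  have usm: "unit_sphere_measure = density ?D (\<lambda>_. ennreal (real DIM('a)))"
    unfolding unit_sphere_measure_def
    by (rule measure_eqI) (auto simp: emeasure_density_const ennreal_of_nat_eq_real_of_nat)
  have "(LINT \<omega>|unit_sphere_measure. f \<omega>) = real DIM('a) * (LINT \<omega>|?D. f \<omega>)"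
    unfolding usm by (subst integral_density) auto
  also have "(LINT \<omega>|?D. f \<omega>) = (LINT x|?P0. f (sgn x))"
    by (rule integral_distr) auto
  also have "\<dots> = (LINT x|lborel. indicator ?B x *\<^sub>R f (sgn x))"
    by (rule integral_restrict_space) simp
  finally have num: "(LINT \<omega>|unit_sphere_measure. f \<omega>) = real DIM('a) * (LINT x|lborel. indicator ?B x *\<^sub>R f (sgn x))" .
  have "measure (unit_sphere_measure :: 'a measure) UNIV = real DIM('a) * measure ?D UNIV"
    unfolding usm by (simp add: measure_density_const)
  also have "measure ?D UNIV = ?V"
    by (subst measure_distr) (auto simp: space_restrict_space measure_restrict_space pb[symmetric])
  finally have den: "measure (unit_sphere_measure :: 'a measure) UNIV = real DIM('a) * ?V" .
  have V_eq: "emeasure lborel (punctured_ball :: 'a set) = ennreal ?V"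
    using emeasure_punctured_ball_finite by (intro emeasure_eq_ennreal_measure) auto
  have dm: "(direction_measure :: 'a measure) = density lborel (\<lambda>x. ennreal (indicator punctured_ball x / ?V))"
    unfolding direction_measure_def uniform_measure_def V_eq
    by (rule density_cong) (use V divide_ennreal[of 1 ?V] in \<open>auto split: split_indicator\<close>)
  have [measurable]: "extend0 \<Omega> u \<in> borel_measurable borel" by (rule borel_measurable_extend0[OF \<Omega> u])
  have "smean (extend0 \<Omega> u) r = (LINT x|lborel. (indicator punctured_ball x / ?V) *\<^sub>R extend0 \<Omega> u (r *\<^sub>R sgn x))"
    unfolding smean_def dm using V by (subst integral_density) auto
  also have "\<dots> = (LINT x|lborel. (indicator ?B x *\<^sub>R f (sgn x)) / ?V)"
  proof (rule Bochner_Integration.integral_cong[OF refl])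
    fix x :: 'a
    have "r *\<^sub>R sgn x \<in> \<Omega>" if "x \<in> ?B" using r that by (auto simp: norm_sgn)
    then show "(indicator punctured_ball x / ?V) *\<^sub>R extend0 \<Omega> u (r *\<^sub>R sgn x) = (indicator ?B x *\<^sub>R f (sgn x)) / ?V"
      by (auto simp: f_def extend0_def punctured_ball_def split: split_indicator)
  qed
  also have "\<dots> = sphere_mean u r"
    unfolding sphere_mean_def den using num by (simp add: f_def)
  finally show ?thesis by simp
qed

section \<open>From means to pointwise bounds\<close>

text \<open>The derivative of the flux is a nonnegative multiple of the mean of the Laplacian.\<close>

lemma radial_flux_mono:
  fixes u :: "'a::euclidean_space \<Rightarrow> real"
  assumes u: "C2_jet \<Omega> u g H" and \<Omega>: "open \<Omega>" "0 \<notin> \<Omega>"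
    and sub: "{x. a < norm x \<and> norm x < b} \<subseteq> \<Omega>" and nn: "\<And>x. x \<in> \<Omega> \<Longrightarrow> 0 \<le> operator_trace (H x)"
    and r: "0 \<le> a" "a < s" "s \<le> r" "r < b"
  defines "Y \<equiv> (\<lambda>r. r ^ (DIM('a) - 1) * smean (extend0 \<Omega> (\<lambda>x. g x \<bullet> sgn x)) r)"
  shows "Y s \<le> Y r"
proof (rule DERIV_nonneg_imp_nondecreasing[OF r(3)])
  fix t assume t: "s \<le> t" "t \<le> r"
  have "0 \<le> smean (extend0 \<Omega> (\<lambda>x. operator_trace (H x))) t"
    unfolding smean_def using nn by (intro Bochner_Integration.integral_nonneg) (simp add: extend0_def)
  moreover have "(Y has_real_derivative t ^ (DIM('a) - 1) * smean (extend0 \<Omega> (\<lambda>x. operator_trace (H x))) t) (at t)"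
    unfolding Y_def by (rule radial_flux_derivative[OF u \<Omega> sub r(1)]) (use t r in auto)
  ultimately show "\<exists>y. (Y has_real_derivative y) (at t) \<and> 0 \<le> y"
    using t r by (intro exI[of _ "t ^ (DIM('a) - 1) * smean (extend0 \<Omega> (\<lambda>x. operator_trace (H x))) t"]) auto
qed

text \<open>Across a ball the flux is monotone in the radius and tends to zero at the centre, because the
gradient is bounded there while the area factor \<open>s ^ (DIM('a) - 1)\<close> tends to zero.\<close>

lemma radial_flux_nonneg:
  fixes u :: "'a::euclidean_space \<Rightarrow> real"
  assumes u: "C2_jet \<Omega> u g H" and \<Omega>: "open \<Omega>" and ball: "ball 0 b \<subseteq> \<Omega>" and dim: "DIM('a) \<ge> 2"
    and nn: "\<And>x. x \<in> \<Omega> \<Longrightarrow> 0 \<le> operator_trace (H x)" and r: "0 < r" "r < b"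
  shows "0 \<le> smean (extend0 (\<Omega> - {0}) (\<lambda>x. g x \<bullet> sgn x)) r"
proof -
  let ?\<Omega> = "\<Omega> - {0}" and ?n = "DIM('a) - 1"
  let ?R = "extend0 ?\<Omega> (\<lambda>x. g x \<bullet> sgn x)"
  have u': "C2_jet ?\<Omega> u g H" by (rule C2_jet_subset[OF u]) auto
  have \<Omega>': "open ?\<Omega>" "0 \<notin> ?\<Omega>" using \<Omega> by auto
  have sub: "{x. 0 < norm x \<and> norm x < b} \<subseteq> ?\<Omega>" using ball by auto
  have "continuous_on (cball 0 r) g" by (rule continuous_on_subset[OF C2_jet_continuous(2)[OF u]]) (use ball r in auto)
  then have "bounded (g ` cball 0 r)" by (intro compact_imp_bounded compact_continuous_image) auto
  then obtain M0 where M0: "\<And>x. x \<in> cball 0 r \<Longrightarrow> norm (g x) \<le> M0" unfolding bounded_iff by blast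
  have lower: "- M0 \<le> smean ?R s" if s: "0 < s" "s \<le> r" for s
  proof -
    have "- M0 = smean (\<lambda>x::'a. - M0) s" by (rule smean_const[symmetric])
    also have "\<dots> \<le> smean ?R s"
    proof (rule smean_mono)
      show "?R \<in> borel_measurable borel"
        by (rule borel_measurable_extend0[OF \<Omega>'(1) continuous_on_radial_component[OF u' \<Omega>'(2)]])
      show "continuous_on (sphere 0 s) ?R"
        by (rule continuous_on_extend0[OF continuous_on_radial_component[OF u' \<Omega>'(2)]]) (use s r ball in auto)
      fix x :: 'a assume x: "norm x = s"
      have "\<bar>g x \<bullet> sgn x\<bar> \<le> norm (g x) * norm (sgn x)" by (rule Cauchy_Schwarz_ineq2)
      also have "\<dots> \<le> norm (g x)" by (simp add: norm_sgn)
      also have "\<dots> \<le> M0" using M0[of x] x s by simp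
      finally have "\<bar>g x \<bullet> sgn x\<bar> \<le> M0" .
      moreover have "x \<in> ?\<Omega>" using sub x s r by auto
      ultimately show "- M0 \<le> ?R x" by (simp add: extend0_def)
    qed (use s in auto)
    finally show ?thesis .
  qed
  have "((\<lambda>s. s ^ ?n * (- M0)) \<longlongrightarrow> 0 ^ ?n * (- M0)) (at_right 0)"
    by (intro tendsto_intros)
  then have lim: "((\<lambda>s. s ^ ?n * (- M0)) \<longlongrightarrow> 0) (at_right 0)" using dim by (simp add: zero_power)
  have "0 \<le> r ^ ?n * smean ?R r"
  proof (rule tendsto_upperbound[OF lim])
    show "\<forall>\<^sub>F s in at_right 0. s ^ ?n * (- M0) \<le> r ^ ?n * smean ?R r"
      unfolding eventually_at_right_field
    proof (intro exI[of _ r] conjI allI impI)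
      fix s assume s: "0 < s" "s < r"
      have "s ^ ?n * (- M0) \<le> s ^ ?n * smean ?R s" using lower[of s] s by (intro mult_left_mono) auto
      also have "\<dots> \<le> r ^ ?n * smean ?R r"
        by (rule radial_flux_mono[OF u' \<Omega>' sub]) (use s r nn in auto)
      finally show "s ^ ?n * (- M0) \<le> r ^ ?n * smean ?R r" .
    qed (use r in auto)
  qed simp
  then show ?thesis by (metis linorder_not_less mult_pos_neg r(1) zero_less_power)
qed

text \<open>The mean is nondecreasing in the radius, as its derivative is a flux, and by continuity it tends
to the value at the centre as the radius tends to zero.\<close>

lemma sub_mean_value:
  fixes u :: "'a::euclidean_space \<Rightarrow> real"
  assumes u: "C2_jet \<Omega> u g H" and \<Omega>: "open \<Omega>" and ball: "ball 0 b \<subseteq> \<Omega>" and dim: "DIM('a) \<ge> 2"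
    and nn: "\<And>x. x \<in> \<Omega> \<Longrightarrow> 0 \<le> operator_trace (H x)" and r: "0 < r" "r < b"
  shows "u 0 \<le> smean (extend0 (\<Omega> - {0}) u) r"
proof (rule field_le_epsilon)
  fix e :: real assume e: "e > 0"
  let ?\<Omega> = "\<Omega> - {0}"
  let ?U = "extend0 ?\<Omega> u"
  have u': "C2_jet ?\<Omega> u g H" by (rule C2_jet_subset[OF u]) auto
  have \<Omega>': "open ?\<Omega>" "0 \<notin> ?\<Omega>" using \<Omega> by auto
  have sub: "{x. 0 < norm x \<and> norm x < b} \<subseteq> ?\<Omega>" using ball by auto
  have 0: "0 \<in> \<Omega>" using ball r by auto
  have "continuous (at 0) u" using u 0 unfolding C2_jet_def by (blast intro: has_derivative_continuous)
  then obtain \<delta> where \<delta>: "\<delta> > 0" "\<And>x. norm x < \<delta> \<Longrightarrow> \<bar>u x - u 0\<bar> < e"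
    using e unfolding continuous_at_eps_delta by (auto simp: dist_norm)
  define s where "s = min r (\<delta> / 2)"
  have s: "0 < s" "s \<le> r" "s < \<delta>" using r \<delta> by (auto simp: s_def)
  have "u 0 - e = smean (\<lambda>x::'a. u 0 - e) s" by (rule smean_const[symmetric])
  also have "\<dots> \<le> smean ?U s"
  proof (rule smean_mono)
    show "?U \<in> borel_measurable borel" by (rule borel_measurable_extend0[OF \<Omega>'(1) C2_jet_continuous(1)[OF u']])
    show "continuous_on (sphere 0 s) ?U" by (rule continuous_on_extend0[OF C2_jet_continuous(1)[OF u']]) (use s r ball in auto)
    fix x :: 'a assume x: "norm x = s"
    have "x \<in> ?\<Omega>" using sub x s r by auto
    then show "u 0 - e \<le> ?U x" using \<delta>(2)[of x] x s by (simp add: extend0_def)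
  qed (use s in auto)
  also have "\<dots> \<le> smean ?U r"
  proof (rule DERIV_nonneg_imp_nondecreasing[OF s(2)])
    fix t assume t: "s \<le> t" "t \<le> r"
    have "(smean ?U has_real_derivative smean (extend0 ?\<Omega> (\<lambda>x. g x \<bullet> sgn x)) t) (at t)"
      by (rule mean_derivative[OF u' \<Omega>' sub]) (use t s r in auto)
    moreover have "0 \<le> smean (extend0 ?\<Omega> (\<lambda>x. g x \<bullet> sgn x)) t"
      by (rule radial_flux_nonneg[OF u \<Omega> ball dim nn]) (use t s r in auto)
    ultimately show "\<exists>y. (smean ?U has_real_derivative y) (at t) \<and> 0 \<le> y" by blast
  qed
  finally show "u 0 \<le> smean ?U r + e" by simp
qed

text \<open>In polar coordinates, compare \<open>F\<close> with the constant \<open>M\<close> on the same radially symmetric set.\<close>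

lemma integral_le_of_smean_le:
  fixes F :: "'a::euclidean_space \<Rightarrow> real"
  assumes F: "integrable lborel F" and A: "{x::'a. norm x \<in> T} \<in> sets borel" "emeasure lborel {x::'a. norm x \<in> T} < \<infinity>"
    and zero: "\<And>x. norm x \<notin> T \<Longrightarrow> F x = 0"
    and le: "\<And>r. r \<in> T \<Longrightarrow> r > 0 \<Longrightarrow> smean F r \<le> M"
  shows "integral\<^sup>L lborel F \<le> M * measure lborel {x::'a. norm x \<in> T}"
proof -
  let ?A = "{x::'a. norm x \<in> T}"
  have ind: "integrable lborel (\<lambda>x. M * indicator ?A x)" using A by (intro integrable_mult_right integrable_real_indicator) auto
  have [measurable]: "F \<in> borel_measurable borel" "?A \<in> sets borel" using F A by auto
  have F0: "smean F r = 0" if "r \<notin> T" "r > 0" for r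
  proof -
    have "smean F r = smean (\<lambda>x::'a. 0) r" by (rule smean_cong) (use that zero in auto)
    then show ?thesis by (simp add: smean_const)
  qed
  have I: "smean (\<lambda>x::'a. M * indicator ?A x) r = M * indicator T r" if "r > 0" for r
  proof -
    have "smean (\<lambda>x::'a. M * indicator ?A x) r = smean (\<lambda>x::'a. M * indicator T r) r"
      by (rule smean_cong) (use that in \<open>auto split: split_indicator\<close>)
    then show ?thesis by (simp add: smean_const)
  qed
  let ?w = "\<lambda>r. real DIM('a) * measure lborel (punctured_ball :: 'a set) * r ^ (DIM('a) - 1) * indicator {0<..} r"
  have "integral\<^sup>L lborel F = (LINT r|lborel. ?w r * smean F r)" by (rule integral_polar(2)[OF F])
  also have "\<dots> \<le> (LINT r|lborel. ?w r * smean (\<lambda>x::'a. M * indicator ?A x) r)"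
  proof (rule integral_mono[OF integral_polar(1)[OF F] integral_polar(1)[OF ind]])
    fix r :: real
    show "?w r * smean F r \<le> ?w r * smean (\<lambda>x::'a. M * indicator ?A x) r"
    proof (cases "r > 0")
      case True
      then have "smean F r \<le> smean (\<lambda>x::'a. M * indicator ?A x) r"
        using le[of r] F0[of r] by (cases "r \<in> T") (auto simp: I)
      then show ?thesis using True by (intro mult_left_mono) auto
    qed simp
  qed
  also have "\<dots> = (LINT x|lborel. M * indicator ?A x)" by (rule integral_polar(2)[OF ind, symmetric])
  also have "\<dots> = M * measure lborel ?A" using A by simp
  finally show ?thesis .
qed

text \<open>The value at \<open>x\<close> is at most the mean of \<open>u\<close> over the ball of radius \<open>norm x / 2\<close> around \<open>x\<close>. This
ball lies in the annulus of radii between \<open>norm x / 2\<close> and \<open>3 / 2 * norm x\<close> around the origin, whose volume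
is at most \<open>3 ^ DIM('a)\<close> times as large, and the integral of \<open>u\<close> over that annulus is controlled by its means
over spheres around the origin.\<close>

lemma pointwise_le_of_mean_le:
  fixes u :: "'a::euclidean_space \<Rightarrow> real"
  assumes u: "C2_jet \<Omega> u g H" and \<Omega>: "open \<Omega>" and dim: "DIM('a) \<ge> 2"
    and nn: "\<And>x. x \<in> \<Omega> \<Longrightarrow> 0 \<le> operator_trace (H x)" and pos: "\<And>x. x \<in> \<Omega> \<Longrightarrow> 0 \<le> u x"
    and sub: "{y. norm x / 4 < norm y \<and> norm y < 2 * norm x} \<subseteq> \<Omega>" and x: "x \<noteq> 0"
    and M: "\<And>r. norm x / 2 \<le> r \<Longrightarrow> r \<le> 3 / 2 * norm x \<Longrightarrow> smean (extend0 \<Omega> u) r \<le> M"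
  shows "u x \<le> 3 ^ DIM('a) * M"
proof -
  define R where "R = norm x"
  have R: "R > 0" using x by (simp add: R_def)
  let ?B = "cball (0::'a) (R / 2)" and ?A = "{y::'a. norm y \<in> {R / 2..3 / 2 * R}}"
  define v where "v y = u (x + y)" for y
  have near: "x + y \<in> \<Omega>" if "norm y < 3 / 4 * R" for y
  proof -
    have "norm (x + y) \<ge> norm x - norm y" by norm
    moreover have "norm (x + y) \<le> norm x + norm y" by norm
    ultimately show ?thesis using that R by (intro subsetD[OF sub]) (auto simp: R_def[symmetric])
  qed
  have im: "(+) x ` ball 0 (3 / 4 * R) \<subseteq> \<Omega>"
    by (rule image_subsetI) (use near in simp)
  have v: "C2_jet (ball 0 (3 / 4 * R)) v (\<lambda>y. g (x + y)) (\<lambda>y. H (x + y))"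
    unfolding v_def by (rule C2_jet_translate[OF C2_jet_subset[OF u im]])
  have vcont: "continuous_on ?B v" by (rule continuous_on_subset[OF C2_jet_continuous(1)[OF v]]) (use R in auto)
  have AO: "?A \<subseteq> \<Omega>"
    by (rule subset_trans[OF _ sub]) (use R in \<open>auto simp: R_def[symmetric]\<close>)
  have ucont: "continuous_on ?A u" by (rule continuous_on_subset[OF C2_jet_continuous(1)[OF u] AO])
  have "?A = cball 0 (3 / 2 * R) - ball 0 (R / 2)" by auto
  then have compactA: "compact ?A" by (simp add: compact_diff)
  define F1 where "F1 y = indicator ?B y *\<^sub>R v y" for y
  define F2 where "F2 y = indicator ?A y *\<^sub>R u y" for y
  have F1: "integrable lborel F1" unfolding F1_def by (rule borel_integrable_compact[OF _ vcont]) simp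
  have F2: "integrable lborel F2" unfolding F2_def by (rule borel_integrable_compact[OF compactA ucont])
  have B_eq: "?B = {y. norm y \<in> {..R / 2}}" by auto
  \<comment> \<open>The outer ball has three times the radius of \<open>?B\<close>.\<close>
  have vol: "measure lborel ?A \<le> 3 ^ DIM('a) * measure lborel ?B"
  proof -
    have "measure lborel ?A \<le> measure lborel (cball (0::'a) (3 / 2 * R))"
      by (rule measure_mono_fmeasurable) (use compactA in \<open>auto simp: fmeasurable_compact\<close>)
    also have "\<dots> = 3 ^ DIM('a) * measure lborel ?B"
    proof -
      have "(3 / 2 * R) ^ DIM('a) = 3 ^ DIM('a) * (R / 2) ^ DIM('a)"
        by (simp add: power_mult_distrib[symmetric])
      then show ?thesis using R by (simp add: content_cball)
    qed
    finally show ?thesis .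
  qed
  have Bpos: "measure lborel ?B > 0" using content_cball_pos[of "R / 2" "0::'a"] R by simp
  have "integral\<^sup>L lborel (\<lambda>y. - F1 y) \<le> (- u x) * measure lborel {y::'a. norm y \<in> {..R / 2}}"
  proof (rule integral_le_of_smean_le)
    show "integrable lborel (\<lambda>y. - F1 y)" using F1 by simp
    show "emeasure lborel {y::'a. norm y \<in> {..R / 2}} < \<infinity>"
      unfolding B_eq[symmetric] using emeasure_lborel_cball_finite[of "0::'a" "R / 2"] by simp
    fix r :: real assume r: "r \<in> {..R / 2}" "r > 0"
    let ?v = "extend0 (ball 0 (3 / 4 * R) - {0}) v"
    have "u x = v 0" by (simp add: v_def)
    also have "\<dots> \<le> smean ?v r"
      by (rule sub_mean_value[OF v]) (use nn near r R dim in auto)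
    also have "\<dots> = smean F1 r"
    proof (rule smean_cong)
      show "?v \<in> borel_measurable borel"
        by (rule borel_measurable_extend0[OF _ continuous_on_subset[OF C2_jet_continuous(1)[OF v]]]) auto
      show "F1 \<in> borel_measurable borel" using F1 by simp
    qed (use r R in \<open>auto simp: F1_def extend0_def\<close>)
    finally show "smean (\<lambda>y. - F1 y) r \<le> - u x" by (simp add: smean_def)
  qed (auto simp: F1_def B_eq[symmetric])
  then have 1: "u x * measure lborel ?B \<le> integral\<^sup>L lborel F1" by (simp add: B_eq)
  have "integral\<^sup>L lborel F1 = (LINT y|lborel. F1 (- x + y))"
  proof -
    have [measurable]: "F1 \<in> borel_measurable borel" using F1 by simp
    have "integral\<^sup>L (distr lborel borel ((+) (- x))) F1 = (LINT y|lborel. F1 (- x + y))"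
      by (rule integral_distr) auto
    then show ?thesis by (simp only: lborel_distr_plus)
  qed
  also have "\<dots> \<le> integral\<^sup>L lborel F2"
  proof (rule integral_mono[OF _ F2])
    have [measurable]: "F1 \<in> borel_measurable borel" using F1 by simp
    show "integrable lborel (\<lambda>y. F1 (- x + y))"
      using F1 integrable_distr_eq[of "(+) (- x)" lborel borel F1] by (simp add: lborel_distr_plus)
    fix y :: 'a
    show "F1 (- x + y) \<le> F2 y"
    proof (cases "- x + y \<in> ?B")
      case True
      then have "norm (y - x) \<le> R / 2" by (simp add: add.commute)
      moreover have "norm y \<ge> norm x - norm (y - x)" by norm
      moreover have "norm y \<le> norm x + norm (y - x)" by norm
      ultimately have "y \<in> ?A" unfolding R_def by simp
      then show ?thesis using True by (simp add: F1_def F2_def v_def)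
    next
      case False
      then show ?thesis using pos AO by (auto simp: F1_def F2_def split: split_indicator)
    qed
  qed
  also have "\<dots> \<le> M * measure lborel ?A"
  proof (rule integral_le_of_smean_le[OF F2])
    show "?A \<in> sets borel" using compactA by (simp add: borel_compact)
    show "emeasure lborel ?A < \<infinity>" using compactA emeasure_bounded_finite compact_imp_bounded by blast
    fix r assume r: "r \<in> {R / 2..3 / 2 * R}" "r > 0"
    have "smean F2 r = smean (extend0 \<Omega> u) r"
    proof (rule smean_cong)
      show "F2 \<in> borel_measurable borel" using F2 by simp
      show "extend0 \<Omega> u \<in> borel_measurable borel" by (rule borel_measurable_extend0[OF \<Omega> C2_jet_continuous(1)[OF u]])
      fix y :: 'a assume "norm y = r"
      then have "y \<in> ?A" using r by simp
      then show "F2 y = extend0 \<Omega> u y" using AO by (auto simp: F2_def extend0_def)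
    qed (use r in auto)
    also have "\<dots> \<le> M" using M[of r] r by (simp add: R_def)
    finally show "smean F2 r \<le> M" .
  qed (auto simp: F2_def)
  also have "\<dots> \<le> M * (3 ^ DIM('a) * measure lborel ?B)"
  proof (rule mult_left_mono[OF vol])
    have "0 \<le> smean (extend0 \<Omega> u) R"
      unfolding smean_def using pos by (intro Bochner_Integration.integral_nonneg) (auto simp: extend0_def)
    then show "0 \<le> M" using M[of R] R by (simp add: R_def)
  qed
  finally have "u x * measure lborel ?B \<le> (3 ^ DIM('a) * M) * measure lborel ?B" using 1 by (simp add: mult_ac)
  then show ?thesis using Bpos by simp
qed

text \<open>Radii that differ by a bounded factor have comparable growth; in the logarithmic case this needs
\<open>\<bar>ln R\<bar>\<close> to be bounded below.\<close>

lemma growth_doubling: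
  assumes pq: "p * q > 1"
  shows "\<exists>L>0. \<forall>R r. 0 < R \<longrightarrow> 1 \<le> \<bar>ln R\<bar> \<longrightarrow> R / 2 \<le> r \<longrightarrow> r \<le> 3 / 2 * R \<longrightarrow> growth p q r \<le> L * growth p q R"
proof -
  define k where "k = growth_exponent p q"
  define L where "L = 2 powr \<bar>k\<bar> + 2"
  have "growth p q r \<le> L * growth p q R" if R: "0 < R" "1 \<le> \<bar>ln R\<bar>" "R / 2 \<le> r" "r \<le> 3 / 2 * R" for R r
  proof (cases "p * (q - 1) = 2")
    case True
    have r: "r > 0" using R by simp
    have "ln (r / R) \<le> ln 2" "ln (R / r) \<le> ln 2" using R r by (auto simp: field_simps)
    then have "\<bar>ln r - ln R\<bar> \<le> ln 2" using R r by (simp add: ln_div abs_le_iff)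
    moreover have "ln 2 \<le> (1::real)" using ln_le_minus_one[of "2::real"] by simp
    ultimately have "\<bar>ln r\<bar> \<le> 2 * \<bar>ln R\<bar>" using R(2) by linarith
    also have "\<dots> \<le> L * \<bar>ln R\<bar>" by (intro mult_right_mono) (auto simp: L_def)
    finally show ?thesis using True by (simp add: growth_def)
  next
    case False
    have r: "r > 0" using R by simp
    have "r powr (- k) \<le> 2 powr \<bar>k\<bar> * R powr (- k)"
    proof (cases "k \<ge> 0")
      case True
      have "r powr (- k) \<le> (R / 2) powr (- k)" by (rule powr_mono2') (use True R in auto)
      also have "\<dots> = 2 powr \<bar>k\<bar> * R powr (- k)" using True R by (simp add: powr_divide powr_minus field_simps)
      finally show ?thesis .
    next
      case False
      have "r powr (- k) \<le> (2 * R) powr (- k)" by (rule powr_mono2) (use False R r in auto)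
      also have "\<dots> = 2 powr \<bar>k\<bar> * R powr (- k)" using False R by (simp add: powr_mult)
      finally show ?thesis .
    qed
    also have "\<dots> \<le> L * growth p q R"
      by (rule mult_mono) (use \<open>p * (q - 1) \<noteq> 2\<close> in \<open>auto simp: L_def growth_def k_def\<close>)
    finally have 1: "r powr (- k) \<le> L * growth p q R" .
    have "1 * 1 \<le> L * growth p q R" by (rule mult_mono) (use growth_ge_1[OF R(2)] in \<open>auto simp: L_def add_increasing\<close>)
    with 1 show ?thesis using False by (simp add: growth_def[of p q r] k_def)
  qed
  moreover have "L > 0" by (simp add: L_def add_nonneg_pos)
  ultimately show ?thesis by blast
qed

lemma pointwise_growth:
  fixes u1 :: "'a::euclidean_space \<Rightarrow> real"
  assumes dim: "DIM('a) \<ge> 2" and pq: "p \<ge> 1" "q \<ge> 1" "p * q > 1"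
    and sys: "gradient_inequalities p q \<Omega> u1 g1 H1 u2 g2 H2" and \<Omega>: "open \<Omega>" "0 \<notin> \<Omega>"
    and pos: "\<And>x. x \<in> \<Omega> \<Longrightarrow> 0 \<le> u1 x \<and> 0 \<le> u2 x"
    and S: "is_interval S" "S \<subseteq> {0<..}" "S \<noteq> {}"
    and SR: "\<And>R. R \<in> S \<Longrightarrow> 1 \<le> \<bar>ln R\<bar> \<and> {x. R / 4 < norm x \<and> norm x < 2 * R} \<subseteq> \<Omega>"
  shows "\<exists>C>0. \<forall>x. norm x / 2 \<in> S \<longrightarrow> 3 / 2 * norm x \<in> S \<longrightarrow> u1 x \<le> C * growth p q (norm x) \<and> u2 x \<le> C * growth q p (norm x)"
proof -
  have qp: "q * p > 1" using pq(3) by (simp add: mult.commute)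
  have u: "C2_jet \<Omega> u1 g1 H1" "C2_jet \<Omega> u2 g2 H2" using sys by (auto simp: gradient_inequalities_def)
  have nn: "0 \<le> operator_trace (H1 x)" "0 \<le> operator_trace (H2 x)" if "x \<in> \<Omega>" for x
    using sys that unfolding gradient_inequalities_def by (meson order_trans powr_ge_zero)+
  obtain C where C: "C > 0" and mean: "\<And>r. r \<in> S \<Longrightarrow> \<bar>smean (extend0 \<Omega> u1) r\<bar> \<le> C * growth p q r \<and> \<bar>smean (extend0 \<Omega> u2) r\<bar> \<le> C * growth q p r"
    using mean_growth[OF pq sys \<Omega> S SR] by blast
  obtain L1 where L1: "L1 > 0" "\<And>R r. 0 < R \<Longrightarrow> 1 \<le> \<bar>ln R\<bar> \<Longrightarrow> R / 2 \<le> r \<Longrightarrow> r \<le> 3 / 2 * R \<Longrightarrow> growth p q r \<le> L1 * growth p q R"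
    using growth_doubling[OF pq(3)] by blast
  obtain L2 where L2: "L2 > 0" "\<And>R r. 0 < R \<Longrightarrow> 1 \<le> \<bar>ln R\<bar> \<Longrightarrow> R / 2 \<le> r \<Longrightarrow> r \<le> 3 / 2 * R \<Longrightarrow> growth q p r \<le> L2 * growth q p R"
    using growth_doubling[OF qp] by blast
  define E where "E = 3 ^ DIM('a) * (C * (L1 + L2))"
  have "u1 x \<le> E * growth p q (norm x) \<and> u2 x \<le> E * growth q p (norm x)"
    if x: "norm x / 2 \<in> S" "3 / 2 * norm x \<in> S" for x
  proof -
    have R: "norm x > 0" using x(1) S(2) by auto
    have xS: "r \<in> S" if "norm x / 2 \<le> r" "r \<le> 3 / 2 * norm x" for r
      using mem_is_interval_1_I[OF S(1) x that] .
    have "norm x \<in> S" using xS[of "norm x"] R by simp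
    note SRx = SR[OF this]
    have g: "1 \<le> growth p q (norm x)" "1 \<le> growth q p (norm x)" using SRx by (auto intro: growth_ge_1)
    have "u1 x \<le> 3 ^ DIM('a) * (C * (L1 * growth p q (norm x)))"
    proof (rule pointwise_le_of_mean_le[OF u(1) \<Omega>(1) dim])
      fix r assume r: "norm x / 2 \<le> r" "r \<le> 3 / 2 * norm x"
      have "smean (extend0 \<Omega> u1) r \<le> C * growth p q r" using mean[OF xS[OF r]] by linarith
      also have "\<dots> \<le> C * (L1 * growth p q (norm x))"
        using C L1(2)[OF R conjunct1[OF SRx] r] by (intro mult_left_mono) auto
      finally show "smean (extend0 \<Omega> u1) r \<le> C * (L1 * growth p q (norm x))" .
    qed (use nn pos SRx R in auto)
    also have "\<dots> \<le> E * growth p q (norm x)"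
      using C L2(1) g by (simp add: E_def algebra_simps)
    finally have 1: "u1 x \<le> E * growth p q (norm x)" .
    have "u2 x \<le> 3 ^ DIM('a) * (C * (L2 * growth q p (norm x)))"
    proof (rule pointwise_le_of_mean_le[OF u(2) \<Omega>(1) dim])
      fix r assume r: "norm x / 2 \<le> r" "r \<le> 3 / 2 * norm x"
      have "smean (extend0 \<Omega> u2) r \<le> C * growth q p r" using mean[OF xS[OF r]] by linarith
      also have "\<dots> \<le> C * (L2 * growth q p (norm x))"
        using C L2(2)[OF R conjunct1[OF SRx] r] by (intro mult_left_mono) auto
      finally show "smean (extend0 \<Omega> u2) r \<le> C * (L2 * growth q p (norm x))" .
    qed (use nn pos SRx R in auto)
    also have "\<dots> \<le> E * growth q p (norm x)"
      using C L1(1) g by (simp add: E_def algebra_simps)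
    finally show ?thesis using 1 by simp
  qed
  moreover have "E > 0" using C L1(1) L2(1) by (simp add: E_def)
  ultimately show ?thesis by blast
qed

section \<open>The Liouville property\<close>

lemma constant_if_radial_means_vanish:
  fixes u :: "'a::euclidean_space \<Rightarrow> real"
  assumes u: "C2_jet UNIV u g H" and f: "continuous_on (- {0}) f" "\<And>x. x \<noteq> 0 \<Longrightarrow> norm (g x) powr p \<le> f x"
    and zero: "\<And>r. r > 0 \<Longrightarrow> smean (extend0 (- {0}) f) r = 0"
  shows "g x = 0" and "u constant_on UNIV"
proof -
  have f_nn: "0 \<le> f x" if "x \<noteq> 0" for x by (rule order_trans[OF powr_ge_zero f(2)[OF that]])
  have g0: "g x = 0" if x: "x \<noteq> 0" for x
  proof -
    have "extend0 (- {0}) f x = 0"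
    proof (rule smean_eq_0_imp_eq_0[OF _ _ _ _ zero refl])
      show "extend0 (- {0}) f \<in> borel_measurable borel" by (rule borel_measurable_extend0[OF _ f(1)]) auto
      show "continuous_on (sphere 0 (norm x)) (extend0 (- {0}) f)" by (rule continuous_on_extend0[OF f(1)]) (use x in auto)
    qed (use f_nn x in \<open>auto simp: extend0_def\<close>)
    then have "norm (g x) powr p \<le> 0" using f(2)[OF x] x by (simp add: extend0_def)
    then show ?thesis by (metis norm_eq_zero powr_eq_0_iff powr_ge_zero order_antisym)
  qed
  have "g 0 = 0"
  proof -
    have "(g \<longlongrightarrow> g 0) (at 0)"
      using C2_jet_continuous(2)[OF u] by (simp add: continuous_on_def)
    moreover have "(g \<longlongrightarrow> 0) (at 0)"
      by (rule tendsto_eventually) (use g0 in \<open>auto simp: eventually_at intro: exI[of _ 1]\<close>)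
    ultimately show ?thesis by (rule tendsto_unique[OF at_neq_bot[of "0::'a"]])
  qed
  then show gx: "g x = 0" for x using g0 by (cases "x = 0") auto
  have "\<exists>c. \<forall>x\<in>UNIV. u x = c"
    by (rule has_derivative_zero_constant) (use u gx in \<open>auto simp: C2_jet_def\<close>)
  then show "u constant_on UNIV" by (simp add: constant_on_def)
qed

text \<open>The first flux is nonnegative and nondecreasing, and it tends to zero at infinity by the gradient
estimate, so it vanishes. Hence so do the means of the Laplacian of \<open>u1\<close> and with them the
gradient of \<open>u2\<close>; then the second flux vanishes, and the same argument applies to the gradient
of \<open>u1\<close>.\<close>

lemma liouville_gradient_system:
  fixes u1 :: "'a::euclidean_space \<Rightarrow> real"
  assumes dim: "DIM('a) \<ge> 2" and pq: "p \<ge> 1" "q \<ge> 1" "p * q > 1"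
    and sub: "(real DIM('a) - 1) * p * q < real DIM('a) + p"
    and sys: "gradient_inequalities p q UNIV u1 g1 H1 u2 g2 H2"
  shows "u1 constant_on UNIV" and "u2 constant_on UNIV"
proof -
  let ?\<Omega> = "- {0::'a}"
  define n where "n = DIM('a) - 1"
  have sys': "gradient_inequalities p q ?\<Omega> u1 g1 H1 u2 g2 H2" by (rule gradient_inequalities_subset[OF sys]) simp
  have u: "C2_jet UNIV u1 g1 H1" "C2_jet UNIV u2 g2 H2" using sys by (auto simp: gradient_inequalities_def)
  have u': "C2_jet ?\<Omega> u1 g1 H1" "C2_jet ?\<Omega> u2 g2 H2" using sys' by (auto simp: gradient_inequalities_def)
  have \<Omega>: "open ?\<Omega>" "0 \<notin> ?\<Omega>" by auto
  have nn: "0 \<le> operator_trace (H1 x)" "0 \<le> operator_trace (H2 x)" for x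
    using sys unfolding gradient_inequalities_def by (meson UNIV_I order_trans powr_ge_zero)+
  have cont: "continuous_on ?\<Omega> (\<lambda>x. operator_trace (H1 x))" "continuous_on ?\<Omega> (\<lambda>x. operator_trace (H2 x))"
    using C2_jet_continuous(3)[OF u'(1)] C2_jet_continuous(3)[OF u'(2)] by auto
  define S1 where "S1 = smean (extend0 ?\<Omega> (\<lambda>x. g1 x \<bullet> sgn x))"
  define e where "e = (1 + p) / (p * q - 1)"
  obtain K where K: "K > 0" and est: "\<And>R. R > 0 \<Longrightarrow> {x::'a. R / 4 < norm x \<and> norm x < 2 * R} \<subseteq> ?\<Omega> \<Longrightarrow> \<bar>S1 R\<bar> \<le> K * R powr (- e)"
    unfolding S1_def e_def
    using mean_gradient_estimate[OF pq, where 'a='a] sys' \<Omega> by blast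
  have n1: "real n = real DIM('a) - 1" using dim by (simp add: n_def)
  have exponent: "real n - e < 0"
  proof -
    have "real n * p * q < real n + 1 + p" using sub n1 by simp
    then have "real n * (p * q - 1) < 1 + p" by (simp add: algebra_simps)
    then show ?thesis using pq by (simp add: e_def pos_less_divide_eq)
  qed
  have flux: "r ^ n * S1 r = 0" if r: "r > 0" for r
  proof (rule antisym)
    have "((\<lambda>t. K * t powr (real n - e)) \<longlongrightarrow> K * 0) at_top"
      using exponent by (intro tendsto_intros tendsto_neg_powr filterlim_ident) auto
    moreover have "\<forall>\<^sub>F t in at_top. r ^ n * S1 r \<le> K * t powr (real n - e)"
      using eventually_ge_at_top[of r]
    proof eventually_elim
      fix t assume t: "r \<le> t"
      have "r ^ n * S1 r \<le> t ^ n * S1 t"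
        unfolding n_def S1_def by (rule radial_flux_mono[OF u'(1) \<Omega>, of 0 "t + 1"]) (use t r nn in auto)
      also have "\<dots> \<le> t ^ n * (K * t powr (- e))"
        using est[of t] t r by (intro mult_left_mono) (auto simp: abs_le_iff)
      also have "\<dots> = K * t powr (real n - e)"
        using t r by (simp add: powr_diff powr_realpow powr_minus field_simps)
      finally show "r ^ n * S1 r \<le> K * t powr (real n - e)" .
    qed
    ultimately show "r ^ n * S1 r \<le> 0" by (intro tendsto_lowerbound[where F=at_top]) auto
    have "0 \<le> S1 r"
      using radial_flux_nonneg[OF u(1) open_UNIV _ dim nn(1) r, of "r + 1"] by (simp add: S1_def Compl_eq_Diff_UNIV)
    then show "0 \<le> r ^ n * S1 r" using r by simp
  qed
  have flux_deriv_0: "D = 0" if Y: "(Y has_real_derivative r ^ n * D) (at r)" and Y0: "\<And>r. r > 0 \<Longrightarrow> Y r = 0" and r: "r > 0" for Y D r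
  proof -
    have "(Y has_real_derivative 0) (at r)"
      by (rule has_field_derivative_transform_within_open[of "\<lambda>_. 0" 0 r "{0<..}"]) (use Y0 r in auto)
    from DERIV_unique[OF Y this] r show ?thesis by simp
  qed
  have D1: "smean (extend0 ?\<Omega> (\<lambda>x. operator_trace (H1 x))) r = 0" if r: "r > 0" for r
  proof (rule flux_deriv_0[OF _ flux r])
    show "((\<lambda>r. r ^ n * S1 r) has_real_derivative r ^ n * smean (extend0 ?\<Omega> (\<lambda>x. operator_trace (H1 x))) r) (at r)"
      unfolding n_def S1_def by (rule radial_flux_derivative[OF u'(1) \<Omega>, of 0 "r + 1"]) (use r in auto)
  qed
  have ineq1: "norm (g2 x) powr p \<le> operator_trace (H1 x)" and ineq2: "norm (g1 x) powr q \<le> operator_trace (H2 x)" for x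
    using sys by (auto simp: gradient_inequalities_def)
  note c2 = constant_if_radial_means_vanish[OF u(2) cont(1) ineq1 D1]
  show "u2 constant_on UNIV" by (rule c2(2))
  have D2: "smean (extend0 ?\<Omega> (\<lambda>x. operator_trace (H2 x))) r = 0" if r: "r > 0" for r
  proof (rule flux_deriv_0[OF _ _ r])
    show "((\<lambda>r. r ^ n * smean (extend0 ?\<Omega> (\<lambda>x. g2 x \<bullet> sgn x)) r) has_real_derivative r ^ n * smean (extend0 ?\<Omega> (\<lambda>x. operator_trace (H2 x))) r) (at r)"
      unfolding n_def by (rule radial_flux_derivative[OF u'(2) \<Omega>, of 0 "r + 1"]) (use r in auto)
    have "extend0 ?\<Omega> (\<lambda>x. g2 x \<bullet> sgn x) = (\<lambda>x. 0)" using c2(1) by (simp add: extend0_def fun_eq_iff)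
    then show "r ^ n * smean (extend0 ?\<Omega> (\<lambda>x. g2 x \<bullet> sgn x)) r = 0" for r by (simp add: smean_const)
  qed
  show "u1 constant_on UNIV" by (rule constant_if_radial_means_vanish(2)[OF u(1) cont(2) ineq2 D2])
qed

section \<open>Punctured balls and exterior domains\<close>

lemma smean_extend0_uminus: "smean (extend0 \<Omega> (\<lambda>x. - u x)) r = - smean (extend0 \<Omega> u) r"
proof -
  have "extend0 \<Omega> (\<lambda>x. - u x) = (\<lambda>x. - extend0 \<Omega> u x)" by (simp add: extend0_def fun_eq_iff)
  then show ?thesis by (simp add: smean_def)
qed

text \<open>Radii so small that the annulus used by the gradient estimate avoids the outer boundary
and that the logarithm stays away from zero.\<close>

lemma small_radii:
  fixes r0 :: real
  assumes "r0 > 0"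
  obtains \<rho> where "0 < \<rho>" "\<rho> < r0"
    "\<And>R. R \<in> {0<..<\<rho>} \<Longrightarrow> 1 \<le> \<bar>ln R\<bar> \<and> {x::'a::euclidean_space. R / 4 < norm x \<and> norm x < 2 * R} \<subseteq> ball 0 r0 - {0}"
proof (rule that[of "min (r0 / 2) (exp (-1))"])
  fix R :: real assume R: "R \<in> {0<..<min (r0 / 2) (exp (-1))}"
  then have "ln R < ln (exp (-1))" by (subst ln_less_cancel_iff) auto
  then show "1 \<le> \<bar>ln R\<bar> \<and> {x::'a. R / 4 < norm x \<and> norm x < 2 * R} \<subseteq> ball 0 r0 - {0}"
    using R by auto
qed (use assms in auto)

lemma large_radii:
  fixes r0 :: real
  assumes "r0 > 0"
  obtains \<rho> where "r0 < \<rho>"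
    "\<And>R. R \<in> {\<rho><..} \<Longrightarrow> 1 \<le> \<bar>ln R\<bar> \<and> {x::'a::euclidean_space. R / 4 < norm x \<and> norm x < 2 * R} \<subseteq> - cball 0 r0"
proof (rule that[of "max (4 * r0) (exp 1)"])
  fix R :: real assume R: "R \<in> {max (4 * r0) (exp 1)<..}"
  then have "ln (exp 1) < ln R" by (subst ln_less_cancel_iff) (auto intro: less_trans[OF exp_gt_zero])
  then show "1 \<le> \<bar>ln R\<bar> \<and> {x::'a. R / 4 < norm x \<and> norm x < 2 * R} \<subseteq> - cball 0 r0"
    using R by auto
qed (use assms in auto)

text \<open>Changing the sign of both components does not affect the absolute values of the means.\<close>

lemma supersolution_means_growth:
  fixes u1 :: "'a::euclidean_space \<Rightarrow> real"
  assumes pq: "p \<ge> 1" "q \<ge> 1" "p * q > 1"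
    and sup: "supersolution p q \<Omega> u1 u2" and \<Omega>: "open \<Omega>" "0 \<notin> \<Omega>"
    and S: "is_interval S" "S \<subseteq> {0<..}" "S \<noteq> {}"
    and SR: "\<And>R. R \<in> S \<Longrightarrow> 1 \<le> \<bar>ln R\<bar> \<and> {x. R / 4 < norm x \<and> norm x < 2 * R} \<subseteq> \<Omega>"
  shows "\<exists>C>0. \<forall>r\<in>S. \<bar>sphere_mean u1 r\<bar> \<le> C * growth p q r \<and> \<bar>sphere_mean u2 r\<bar> \<le> C * growth q p r"
proof -
  obtain g1 H1 g2 H2 where sys: "gradient_inequalities p q \<Omega> (\<lambda>x. - u1 x) g1 H1 (\<lambda>x. - u2 x) g2 H2"
    by (rule supersolution_imp_gradient_inequalities[OF sup])
  obtain C where C: "C > 0" "\<And>r. r \<in> S \<Longrightarrow> \<bar>smean (extend0 \<Omega> u1) r\<bar> \<le> C * growth p q r \<and> \<bar>smean (extend0 \<Omega> u2) r\<bar> \<le> C * growth q p r"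
    using mean_growth[OF pq sys \<Omega> S SR] unfolding smean_extend0_uminus abs_minus_cancel by blast
  have cont: "continuous_on \<Omega> u1" "continuous_on \<Omega> u2"
    using sup C2_jet_continuous(1)[OF C2_on_imp_C2_jet] by (auto simp: supersolution_def)
  have "\<bar>sphere_mean u1 r\<bar> \<le> C * growth p q r \<and> \<bar>sphere_mean u2 r\<bar> \<le> C * growth q p r" if r: "r \<in> S" for r
  proof -
    have "0 < r" using r S by auto
    then have "sphere 0 r \<subseteq> \<Omega>" by (intro subset_trans[OF _ conjunct2[OF SR[OF r]]]) auto
    then show ?thesis
      using abs_sphere_mean_le[OF cont(1) \<Omega>(1), of r] abs_sphere_mean_le[OF cont(2) \<Omega>(1), of r] C(2)[OF r] \<open>0 < r\<close> by force
  qed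
  then show ?thesis using C(1) by blast
qed

theorem theorem1p2:
  fixes p q :: real
  assumes "CARD('n::finite) \<ge> 3"
    and "p \<ge> q" and "q \<ge> 1" and "p * q > 1"
  shows
    "((real CARD('n) - 1) * p * q < max (real CARD('n) + p) (real CARD('n) + q) \<longrightarrow>
        (\<forall>u1 u2 :: real ^ 'n \<Rightarrow> real.
          supersolution p q UNIV u1 u2 \<longrightarrow> u1 constant_on UNIV \<and> u2 constant_on UNIV))
     \<and>
     (\<forall>r0 > 0. \<forall>u1 u2 :: real ^ 'n \<Rightarrow> real.
        (supersolution p q (ball 0 r0 - {0}) u1 u2 \<and>
         (\<forall>x \<in> ball 0 r0 - {0}. u1 x \<ge> 0 \<and> u2 x \<ge> 0) \<longrightarrow>
           (\<exists>\<rho> \<in> {0<..<r0}. \<exists>C > 0. \<forall>r \<in> {0<..<\<rho>}.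
              \<bar>sphere_mean u1 r\<bar> \<le> C * growth p q r \<and>
              \<bar>sphere_mean u2 r\<bar> \<le> C * growth q p r)) \<and>
        (supersolution p q (- cball 0 r0) u1 u2 \<and>
         (\<forall>x \<in> - cball 0 r0. u1 x \<ge> 0 \<and> u2 x \<ge> 0) \<longrightarrow>
           (\<exists>\<rho> > r0. \<exists>C > 0. \<forall>r > \<rho>.
              \<bar>sphere_mean u1 r\<bar> \<le> C * growth p q r \<and>
              \<bar>sphere_mean u2 r\<bar> \<le> C * growth q p r)))
     \<and>
     (\<forall>r0 > 0. \<forall>u1 u2 :: real ^ 'n \<Rightarrow> real.
        (absorption_subsolution p q (ball 0 r0 - {0}) u1 u2 \<and>
         (\<forall>x \<in> ball 0 r0 - {0}. u1 x > 0 \<and> u2 x > 0) \<longrightarrow>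
           (\<exists>\<rho> \<in> {0<..<r0}. \<exists>C > 0. \<forall>x. 0 < norm x \<and> norm x < \<rho> \<longrightarrow>
              u1 x \<le> C * growth p q (norm x) \<and>
              u2 x \<le> C * growth q p (norm x))) \<and>
        (absorption_subsolution p q (- cball 0 r0) u1 u2 \<and>
         (\<forall>x \<in> - cball 0 r0. u1 x > 0 \<and> u2 x > 0) \<longrightarrow>
           (\<exists>\<rho> > r0. \<exists>C > 0. \<forall>x. norm x > \<rho> \<longrightarrow>
              u1 x \<le> C * growth p q (norm x) \<and>
              u2 x \<le> C * growth q p (norm x))))"
proof -
  let ?N = "CARD('n)"
  have dim: "DIM(real ^ 'n) = ?N" "DIM(real ^ 'n) \<ge> 2" using assms(1) by auto
  have pq: "p \<ge> 1" "q \<ge> 1" "p * q > 1" using assms by auto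
  have liouville: "u1 constant_on UNIV \<and> u2 constant_on UNIV"
    if cond: "(real ?N - 1) * p * q < max (real ?N + p) (real ?N + q)" and sup: "supersolution p q UNIV u1 u2"
    for u1 u2 :: "real ^ 'n \<Rightarrow> real"
  proof -
    obtain g1 H1 g2 H2 where sys: "gradient_inequalities p q UNIV (\<lambda>x. - u1 x) g1 H1 (\<lambda>x. - u2 x) g2 H2"
      by (rule supersolution_imp_gradient_inequalities[OF sup])
    have "(real DIM(real ^ 'n) - 1) * p * q < real DIM(real ^ 'n) + p"
      using cond assms(2) dim(1) by simp
    note const = liouville_gradient_system[OF dim(2) pq this sys]
    have "u constant_on UNIV" if "(\<lambda>x. - u x) constant_on UNIV" for u :: "real ^ 'n \<Rightarrow> real"
      using that unfolding constant_on_def by (metis minus_equation_iff)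
    then show ?thesis using const by blast
  qed
  have punctured: "open (ball 0 r0 - {0 :: real ^ 'n})" "0 \<notin> ball 0 r0 - {0 :: real ^ 'n}" for r0
    by auto
  have exterior: "open (- cball (0 :: real ^ 'n) r0)" "0 \<notin> - cball (0 :: real ^ 'n) r0" if "r0 > 0" for r0
    using that by auto
  have interval: "is_interval {0<..<\<rho>}" "is_interval {\<rho><..}" for \<rho> :: real
    by (simp_all add: is_interval_oo is_interval_oi)
  have means_punctured: "\<exists>\<rho>\<in>{0<..<r0}. \<exists>C>0. \<forall>r\<in>{0<..<\<rho>}.
      \<bar>sphere_mean u1 r\<bar> \<le> C * growth p q r \<and> \<bar>sphere_mean u2 r\<bar> \<le> C * growth q p r"
    if r0: "r0 > 0" and sup: "supersolution p q (ball 0 r0 - {0}) u1 u2" for r0 and u1 u2 :: "real ^ 'n \<Rightarrow> real"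
  proof -
    obtain \<rho> where \<rho>: "0 < \<rho>" "\<rho> < r0"
      and SR: "\<And>R. R \<in> {0<..<\<rho>} \<Longrightarrow> 1 \<le> \<bar>ln R\<bar> \<and> {x :: real ^ 'n. R / 4 < norm x \<and> norm x < 2 * R} \<subseteq> ball 0 r0 - {0}"
      using small_radii[OF r0] by blast
    have "\<exists>C>0. \<forall>r\<in>{0<..<\<rho>}. \<bar>sphere_mean u1 r\<bar> \<le> C * growth p q r \<and> \<bar>sphere_mean u2 r\<bar> \<le> C * growth q p r"
      by (rule supersolution_means_growth[OF pq sup punctured interval(1) _ _ SR]) (use \<rho> in auto)
    then show ?thesis using \<rho> by (intro bexI[of _ \<rho>]) auto
  qed
  have means_exterior: "\<exists>\<rho>>r0. \<exists>C>0. \<forall>r>\<rho>.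
      \<bar>sphere_mean u1 r\<bar> \<le> C * growth p q r \<and> \<bar>sphere_mean u2 r\<bar> \<le> C * growth q p r"
    if r0: "r0 > 0" and sup: "supersolution p q (- cball 0 r0) u1 u2" for r0 and u1 u2 :: "real ^ 'n \<Rightarrow> real"
  proof -
    obtain \<rho> where \<rho>: "r0 < \<rho>"
      and SR: "\<And>R. R \<in> {\<rho><..} \<Longrightarrow> 1 \<le> \<bar>ln R\<bar> \<and> {x :: real ^ 'n. R / 4 < norm x \<and> norm x < 2 * R} \<subseteq> - cball 0 r0"
      using large_radii[OF r0] by blast
    have "\<exists>C>0. \<forall>r\<in>{\<rho><..}. \<bar>sphere_mean u1 r\<bar> \<le> C * growth p q r \<and> \<bar>sphere_mean u2 r\<bar> \<le> C * growth q p r"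
      by (rule supersolution_means_growth[OF pq sup exterior[OF r0] interval(2) _ _ SR]) (use \<rho> r0 in auto)
    then show ?thesis using \<rho> by (intro exI[of _ \<rho>]) auto
  qed
  have pointwise_punctured: "\<exists>\<rho>\<in>{0<..<r0}. \<exists>C>0. \<forall>x. 0 < norm x \<and> norm x < \<rho> \<longrightarrow>
      u1 x \<le> C * growth p q (norm x) \<and> u2 x \<le> C * growth q p (norm x)"
    if r0: "r0 > 0" and sub: "absorption_subsolution p q (ball 0 r0 - {0}) u1 u2"
      and pos: "\<forall>x\<in>ball 0 r0 - {0}. u1 x > 0 \<and> u2 x > 0" for r0 and u1 u2 :: "real ^ 'n \<Rightarrow> real"
  proof -
    obtain g1 H1 g2 H2 where sys: "gradient_inequalities p q (ball 0 r0 - {0}) u1 g1 H1 u2 g2 H2"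
      by (rule absorption_subsolution_imp_gradient_inequalities[OF sub])
    obtain \<rho> where \<rho>: "0 < \<rho>" "\<rho> < r0"
      and SR: "\<And>R. R \<in> {0<..<\<rho>} \<Longrightarrow> 1 \<le> \<bar>ln R\<bar> \<and> {x :: real ^ 'n. R / 4 < norm x \<and> norm x < 2 * R} \<subseteq> ball 0 r0 - {0}"
      using small_radii[OF r0] by blast
    have "\<exists>C>0. \<forall>x. norm x / 2 \<in> {0<..<\<rho>} \<longrightarrow> 3 / 2 * norm x \<in> {0<..<\<rho>} \<longrightarrow>
        u1 x \<le> C * growth p q (norm x) \<and> u2 x \<le> C * growth q p (norm x)"
      by (rule pointwise_growth[OF dim(2) pq sys punctured _ interval(1) _ _ SR])
         (use \<rho> pos in \<open>auto intro: less_imp_le\<close>)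
    then obtain C where C: "C > 0" "\<And>x. norm x / 2 \<in> {0<..<\<rho>} \<Longrightarrow> 3 / 2 * norm x \<in> {0<..<\<rho>} \<Longrightarrow>
        u1 x \<le> C * growth p q (norm x) \<and> u2 x \<le> C * growth q p (norm x)" by blast
    have in_S: "norm x / 2 \<in> {0<..<\<rho>} \<and> 3 / 2 * norm x \<in> {0<..<\<rho>}" if "0 < norm x" "norm x < \<rho> / 2" for x :: "real ^ 'n"
      using that unfolding greaterThanLessThan_iff by linarith
    show ?thesis
    proof (rule bexI[of _ "\<rho> / 2"], rule exI[of _ C], rule conjI[OF C(1)], intro allI impI, elim conjE)
      fix x :: "real ^ 'n" assume x: "0 < norm x" "norm x < \<rho> / 2"
      show "u1 x \<le> C * growth p q (norm x) \<and> u2 x \<le> C * growth q p (norm x)"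
        by (rule C(2)[OF conjunct1[OF in_S[OF x]] conjunct2[OF in_S[OF x]]])
    qed (use \<rho> in simp)
  qed
  have pointwise_exterior: "\<exists>\<rho>>r0. \<exists>C>0. \<forall>x. norm x > \<rho> \<longrightarrow>
      u1 x \<le> C * growth p q (norm x) \<and> u2 x \<le> C * growth q p (norm x)"
    if r0: "r0 > 0" and sub: "absorption_subsolution p q (- cball 0 r0) u1 u2"
      and pos: "\<forall>x\<in>- cball 0 r0. u1 x > 0 \<and> u2 x > 0" for r0 and u1 u2 :: "real ^ 'n \<Rightarrow> real"
  proof -
    obtain g1 H1 g2 H2 where sys: "gradient_inequalities p q (- cball 0 r0) u1 g1 H1 u2 g2 H2"
      by (rule absorption_subsolution_imp_gradient_inequalities[OF sub])
    obtain \<rho> where \<rho>: "r0 < \<rho>"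
      and SR: "\<And>R. R \<in> {\<rho><..} \<Longrightarrow> 1 \<le> \<bar>ln R\<bar> \<and> {x :: real ^ 'n. R / 4 < norm x \<and> norm x < 2 * R} \<subseteq> - cball 0 r0"
      using large_radii[OF r0] by blast
    have "\<exists>C>0. \<forall>x. norm x / 2 \<in> {\<rho><..} \<longrightarrow> 3 / 2 * norm x \<in> {\<rho><..} \<longrightarrow>
        u1 x \<le> C * growth p q (norm x) \<and> u2 x \<le> C * growth q p (norm x)"
      by (rule pointwise_growth[OF dim(2) pq sys exterior[OF r0] _ interval(2) _ _ SR])
         (use \<rho> r0 pos in \<open>auto intro: less_imp_le\<close>)
    then obtain C where C: "C > 0" "\<And>x. norm x / 2 \<in> {\<rho><..} \<Longrightarrow> 3 / 2 * norm x \<in> {\<rho><..} \<Longrightarrow>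
        u1 x \<le> C * growth p q (norm x) \<and> u2 x \<le> C * growth q p (norm x)" by blast
    show ?thesis
      using \<rho> r0 by (intro exI[of _ "2 * \<rho>"] conjI exI[of _ C] C(1) allI impI C(2)) auto
  qed
  show ?thesis
  proof (intro conjI allI impI; (elim conjE)?)
    fix u1 u2 :: "real ^ 'n \<Rightarrow> real"
    assume "(real ?N - 1) * p * q < max (real ?N + p) (real ?N + q)" "supersolution p q UNIV u1 u2"
    from liouville[OF this] show "u1 constant_on UNIV" "u2 constant_on UNIV" by simp_all
  qed (rule means_punctured means_exterior pointwise_punctured pointwise_exterior; assumption)+
qed

end
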